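(* Let $(\mathcal{A},\Sigma)$ be a $\sigma$-filtered pair and let $F:\mathcal{A}\to\mathbf{Cat}$ be a $2$-functor. Let $\mathcal{L}_\sigma(F)$ be the category whose objects are pairs $(x,A)$ with $A\in\mathcal{A}$, $x\in FA$, and whose arrows are homotopy classes of premorphisms. Then the following formulas define a $\sigma$-cone $\lambda$ for $F$ (with respect to $\Sigma$) with vertex $\mathcal{L}_\sigma(F)$, and this $\sigma$-cone is the $\sigma$-colimit of $F$ in $\mathbf{Cat}$: for $A\in\mathcal{A}$, $x\in FA$, an arrow $\xi:x\to y$ in $FA$, and an arrow $u:A\to B$ in $\mathcal{A}$, $$\lambda_A(x)=(x,A),\qquad \lambda_A(\xi)=[(\mathrm{id}_A,\xi,\mathrm{id}_A)]:(x,A)\to(y,A),$$ $$(\lambda_u)_x=[(\mathrm{id}_B,\mathrm{id}_{F(u)(x)},u)]:(F(u)(x),B)\to(x,A).$$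
   Context: 2-categories and 2-functors are strict. $\mathbf{Cat}$ is the 2-category of (small) categories, functors and natural transformations; size issues are disregarded ($\mathcal{A}$ is small enough for the categories considered to be objects of $\mathbf{Cat}$). A pair $(\mathcal{A},\Sigma)$ consists of a 2-category $\mathcal{A}$ and a family $\Sigma$ of arrows of $\mathcal{A}$ containing all identities and closed under composition. **$\sigma$-filtered.** $(\mathcal{A},\Sigma)$ is $\sigma$-filtered if $\mathcal{A}$ is non-empty and: ($\sigma$F0) for all $A,B\in\mathcal{A}$ there are $E\in\mathcal{A}$ and arrows $A\to E$, $B\to E$ in $\Sigma$; ($\sigma$F1) for all $f,g:A\to B$ with $g\in\Sigma$ there are $h:B\to E$ in $\Sigma$ and a 2-cell $\alpha:hf\Rightarrow hg$, and if $f\in\Sigma$ then $\alpha$ may be chosen invertible; ($\sigma$F2) for all 2-cells $\alpha,\beta:f\Rightarrow g$ with $f,g:A\to B$ and $g\in\Sigma$ there is $h:B\to E$ in $\Sigma$ with $h\alpha=h\beta$. **$\sigma$-cones and $\sigma$-colimits.** A $\sigma$-cone for a 2-functor $F:\mathcal{A}\to\mathcal{B}$ with vertex $E\in\mathcal{B}$ consists of arrows $\theta_A:FA\to E$ ($A\in\mathcal{A}$) and 2-cells $\theta_f:\theta_B\,Ff\Rightarrow\theta_A$ ($f:A\to B$ in $\mathcal{A}$) such that (LC0) $\theta_{\mathrm{id}_A}=\mathrm{id}_{\theta_A}$; (LC1) $\theta_{gf}=\theta_f\circ(\theta_g\,Ff)$ for composable $f,g$; (LC2) $\theta_f=\theta_g\circ(\theta_B\,F\gamma)$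 for every 2-cell $\gamma:f\Rightarrow g:A\to B$; and $\theta_f$ is invertible for every $f\in\Sigma$. A morphism $\varphi:\theta\to\theta'$ of $\sigma$-cones is a family of 2-cells $\varphi_A:\theta_A\Rightarrow\theta'_A$ with $\theta'_f\circ(\varphi_B\,Ff)=\varphi_A\circ\theta_f$ for all $f:A\to B$. This gives a category $\mathrm{Cones}_\sigma(F,E)$. A $\sigma$-cone $\lambda$ with vertex $L$ is the $\sigma$-colimit of $F$ if for every $E\in\mathcal{B}$ the functor $\lambda^*:\mathcal{B}(L,E)\to\mathrm{Cones}_\sigma(F,E)$ given by composing with $\lambda$ is an isomorphism of categories. **Premorphisms.** Let $F:\mathcal{A}\to\mathbf{Cat}$ be a 2-functor. For objects $(x,A)$, $(y,B)$ (with $x\in FA$, $y\in FB$) a premorphism $(x,A)\to(y,B)$ is a triple $(u,\xi,v)$, often abbreviated $\xi$, with $u:A\to C$ in $\Sigma$, $v:B\to C$ an arrow of $\mathcal{A}$, and $\xi:F(u)(x)\to F(v)(y)$ an arrow of $FC$. **Homotopy.** Two premorphisms $(u_1,\xi_1,v_1),(u_2,\xi_2,v_2):(x,A)\to(y,B)$, with $u_i:A\to C_i$, $v_i:B\to C_i$, are homotopical, written $\xi_1\sim\xi_2$, if there are an object $D$, arrows $w_A:A\to D$, $w_B:B\to D$, $w_i:C_i\to D$ ($i=1,2$), all in $\Sigma$, invertible 2-cells $\alpha_i:w_A\Rightarrow w_iu_i$ and 2-cells $\beta_i:w_iv_i\Rightarrow w_B$ ($i=1,2$) such that, in $FD$,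 $$F(\beta_1)_y\circ F(w_1)(\xi_1)\circ F(\alpha_1)_x=F(\beta_2)_y\circ F(w_2)(\xi_2)\circ F(\alpha_2)_x .$$ The relation $\sim$ is an equivalence relation. **Composition.** Given premorphisms $(u,\xi,v):(x,A)\to(y,B)$ with $v:B\to C$ and $(u',\zeta,v'):(y,B)\to(z,B')$ with $u':B\to C'$, and a 2-cell $\gamma:rv\Rightarrow su'$ with $r:C\to D$, $s:C'\to D$ in $\Sigma$ (such a $\gamma$ always exists), set $\zeta\circ_\gamma\xi=(ru,\;F(s)(\zeta)\circ F(\gamma)_y\circ F(r)(\xi),\;sv'):(x,A)\to(z,B')$. The class of $\zeta\circ_\gamma\xi$ does not depend on $\gamma$ nor on the representatives; this is the composition of the category $\mathcal{L}_\sigma(F)$, with identities $[(\mathrm{id}_A,\mathrm{id}_x,\mathrm{id}_A)]$. Brackets denote $\sim$-classes. *)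

theory Defs
  imports Main "HOL-Library.FuncSet"
begin

section \<open>Categories, functors, natural transformations\<close>

text \<open>The operations of a category are only meaningful on its objects and arrows.\<close>

record ('o, 'm) cat =
  Obj :: "'o set"
  Arr :: "'m set"
  Dom :: "'m \<Rightarrow> 'o"
  Cod :: "'m \<Rightarrow> 'o"
  Ide :: "'o \<Rightarrow> 'm"
  Comp :: "'m \<Rightarrow> 'm \<Rightarrow> 'm"

abbreviation cat_comp :: "'m \<Rightarrow> ('o, 'm) cat \<Rightarrow> 'm \<Rightarrow> 'm"  ("(_ \<cdot>\<^bsub>_\<^esub>/ _)" [56, 0, 55] 55)
  where "g \<cdot>\<^bsub>C\<^esub> f \<equiv> Comp C g f"

definition hom :: "('o, 'm) cat \<Rightarrow> 'o \<Rightarrow> 'o \<Rightarrow> 'm set"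
  where "hom C a b = {f \<in> Arr C. Dom C f = a \<and> Cod C f = b}"

locale category =
  fixes C :: "('o, 'm) cat"
  assumes Dom_in: "f \<in> Arr C \<Longrightarrow> Dom C f \<in> Obj C"
    and Cod_in: "f \<in> Arr C \<Longrightarrow> Cod C f \<in> Obj C"
    and Ide_in: "a \<in> Obj C \<Longrightarrow> Ide C a \<in> hom C a a"
    and Comp_in: "\<lbrakk>f \<in> hom C a b; g \<in> hom C b c\<rbrakk> \<Longrightarrow> g \<cdot>\<^bsub>C\<^esub> f \<in> hom C a c"
    and Comp_Ide_left: "f \<in> hom C a b \<Longrightarrow> Ide C b \<cdot>\<^bsub>C\<^esub> f = f"
    and Comp_Ide_right: "f \<in> hom C a b \<Longrightarrow> f \<cdot>\<^bsub>C\<^esub> Ide C a = f"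
    and Comp_assoc: "\<lbrakk>f \<in> hom C a b; g \<in> hom C b c; h \<in> hom C c d\<rbrakk>
      \<Longrightarrow> (h \<cdot>\<^bsub>C\<^esub> g) \<cdot>\<^bsub>C\<^esub> f = h \<cdot>\<^bsub>C\<^esub> (g \<cdot>\<^bsub>C\<^esub> f)"

definition invertible_arr :: "('o, 'm) cat \<Rightarrow> 'm \<Rightarrow> bool"
  where "invertible_arr C f \<longleftrightarrow> f \<in> Arr C \<and>
    (\<exists>g \<in> hom C (Cod C f) (Dom C f).
      g \<cdot>\<^bsub>C\<^esub> f = Ide C (Dom C f) \<and> f \<cdot>\<^bsub>C\<^esub> g = Ide C (Cod C f))"

text \<open>Functors carry their source and target. The two maps are required to be \<open>undefined\<close> outside
  the source category, so that equality of functors is equality of records; likewise for the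
  components of natural transformations and for cones below.\<close>

record ('o, 'm, 'p, 'q) cfun =
  Fsrc :: "('o, 'm) cat"
  Ftgt :: "('p, 'q) cat"
  Omap :: "'o \<Rightarrow> 'p"
  Amap :: "'m \<Rightarrow> 'q"

definition is_functor :: "('o, 'm, 'p, 'q) cfun \<Rightarrow> bool"
  where "is_functor F \<longleftrightarrow>
    category (Fsrc F) \<and> category (Ftgt F) \<and>
    Omap F \<in> Obj (Fsrc F) \<rightarrow>\<^sub>E Obj (Ftgt F) \<and>
    Amap F \<in> Arr (Fsrc F) \<rightarrow>\<^sub>E Arr (Ftgt F) \<and>
    (\<forall>f \<in> Arr (Fsrc F). Dom (Ftgt F) (Amap F f) = Omap F (Dom (Fsrc F) f) \<and>
                        Cod (Ftgt F) (Amap F f) = Omap F (Cod (Fsrc F) f)) \<and>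
    (\<forall>a \<in> Obj (Fsrc F). Amap F (Ide (Fsrc F) a) = Ide (Ftgt F) (Omap F a)) \<and>
    (\<forall>f \<in> Arr (Fsrc F). \<forall>g \<in> Arr (Fsrc F). Cod (Fsrc F) f = Dom (Fsrc F) g \<longrightarrow>
      Amap F (g \<cdot>\<^bsub>Fsrc F\<^esub> f) = Amap F g \<cdot>\<^bsub>Ftgt F\<^esub> Amap F f)"

definition functors :: "('o, 'm) cat \<Rightarrow> ('p, 'q) cat \<Rightarrow> ('o, 'm, 'p, 'q) cfun set"
  where "functors C D = {F. is_functor F \<and> Fsrc F = C \<and> Ftgt F = D}"

definition functor_id :: "('o, 'm) cat \<Rightarrow> ('o, 'm, 'o, 'm) cfun"
  where "functor_id C = \<lparr>Fsrc = C, Ftgt = C, Omap = (\<lambda>a\<in>Obj C. a), Amap = (\<lambda>f\<in>Arr C. f)\<rparr>"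

definition functor_comp ::
  "('p, 'q, 'r, 's) cfun \<Rightarrow> ('o, 'm, 'p, 'q) cfun \<Rightarrow> ('o, 'm, 'r, 's) cfun"
  where "functor_comp G F = \<lparr>Fsrc = Fsrc F, Ftgt = Ftgt G,
    Omap = (\<lambda>a\<in>Obj (Fsrc F). Omap G (Omap F a)),
    Amap = (\<lambda>f\<in>Arr (Fsrc F). Amap G (Amap F f))\<rparr>"

definition is_cat_isomorphism :: "('o, 'm, 'p, 'q) cfun \<Rightarrow> bool"
  where "is_cat_isomorphism F \<longleftrightarrow> is_functor F \<and>
    (\<exists>G \<in> functors (Ftgt F) (Fsrc F).
      functor_comp G F = functor_id (Fsrc F) \<and> functor_comp F G = functor_id (Ftgt F))"

record ('o, 'm, 'p, 'q) ntrans =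
  Nsrc :: "('o, 'm, 'p, 'q) cfun"
  Ntgt :: "('o, 'm, 'p, 'q) cfun"
  Ncmp :: "'o \<Rightarrow> 'q"

definition is_nat_trans :: "('o, 'm, 'p, 'q) ntrans \<Rightarrow> bool"
  where "is_nat_trans \<alpha> \<longleftrightarrow>
    (let F = Nsrc \<alpha>; G = Ntgt \<alpha>; C = Fsrc F; D = Ftgt F in
      F \<in> functors C D \<and> G \<in> functors C D \<and>
      Ncmp \<alpha> \<in> extensional (Obj C) \<and>
      (\<forall>a \<in> Obj C. Ncmp \<alpha> a \<in> hom D (Omap F a) (Omap G a)) \<and>
      (\<forall>f \<in> Arr C. Ncmp \<alpha> (Cod C f) \<cdot>\<^bsub>D\<^esub> Amap F f = Amap G f \<cdot>\<^bsub>D\<^esub> Ncmp \<alpha> (Dom C f)))"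

definition nat_id :: "('o, 'm, 'p, 'q) cfun \<Rightarrow> ('o, 'm, 'p, 'q) ntrans"
  where "nat_id F = \<lparr>Nsrc = F, Ntgt = F, Ncmp = (\<lambda>a\<in>Obj (Fsrc F). Ide (Ftgt F) (Omap F a))\<rparr>"

definition nat_vcomp ::
  "('o, 'm, 'p, 'q) ntrans \<Rightarrow> ('o, 'm, 'p, 'q) ntrans \<Rightarrow> ('o, 'm, 'p, 'q) ntrans"
  where "nat_vcomp \<beta> \<alpha> = \<lparr>Nsrc = Nsrc \<alpha>, Ntgt = Ntgt \<beta>,
    Ncmp = (\<lambda>a\<in>Obj (Fsrc (Nsrc \<alpha>)). Ncmp \<beta> a \<cdot>\<^bsub>Ftgt (Nsrc \<alpha>)\<^esub> Ncmp \<alpha> a)\<rparr>"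

definition nat_hcomp ::
  "('p, 'q, 'r, 's) ntrans \<Rightarrow> ('o, 'm, 'p, 'q) ntrans \<Rightarrow> ('o, 'm, 'r, 's) ntrans"
  where "nat_hcomp \<beta> \<alpha> = \<lparr>Nsrc = functor_comp (Nsrc \<beta>) (Nsrc \<alpha>),
    Ntgt = functor_comp (Ntgt \<beta>) (Ntgt \<alpha>),
    Ncmp = (\<lambda>a\<in>Obj (Fsrc (Nsrc \<alpha>)).
      Ncmp \<beta> (Omap (Ntgt \<alpha>) a) \<cdot>\<^bsub>Ftgt (Nsrc \<beta>)\<^esub> Amap (Nsrc \<beta>) (Ncmp \<alpha> a))\<rparr>"

definition functor_cat :: "('o, 'm) cat \<Rightarrow> ('p, 'q) cat
    \<Rightarrow> (('o, 'm, 'p, 'q) cfun, ('o, 'm, 'p, 'q) ntrans) cat"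
  where "functor_cat C D = \<lparr>Obj = functors C D,
    Arr = {\<alpha>. is_nat_trans \<alpha> \<and> Nsrc \<alpha> \<in> functors C D},
    Dom = Nsrc, Cod = Ntgt, Ide = nat_id, Comp = nat_vcomp\<rparr>"


section \<open>Strict 2-categories and 2-functors\<close>

text \<open>\<open>Und\<close> is the category of objects and arrows; \<open>Vert\<close> has the arrows of \<open>Und\<close> as its objects,
  the 2-cells as its arrows, and vertical composition as its composition. A 2-cell
  \<open>\<alpha> : f \<Rightarrow> g\<close> is an element of \<open>hom (Vert A) f g\<close>.\<close>

record ('a, 'f, 'c) two_cat =
  Und :: "('a, 'f) cat"
  Vert :: "('f, 'c) cat"
  HComp :: "'c \<Rightarrow> 'c \<Rightarrow> 'c"

locale two_category =
  fixes A :: "('a, 'f, 'c) two_cat"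
  assumes category_Und: "category (Und A)"
    and category_Vert: "category (Vert A)"
    and Obj_Vert: "Obj (Vert A) = Arr (Und A)"
    and cell_parallel: "\<alpha> \<in> hom (Vert A) f g
      \<Longrightarrow> Dom (Und A) f = Dom (Und A) g \<and> Cod (Und A) f = Cod (Und A) g"
    and HComp_in: "\<lbrakk>\<alpha> \<in> hom (Vert A) f f'; \<beta> \<in> hom (Vert A) g g'; Cod (Und A) f = Dom (Und A) g\<rbrakk>
      \<Longrightarrow> HComp A \<beta> \<alpha> \<in> hom (Vert A) (g \<cdot>\<^bsub>Und A\<^esub> f) (g' \<cdot>\<^bsub>Und A\<^esub> f')"
    and HComp_Ide: "\<lbrakk>f \<in> hom (Und A) a b; g \<in> hom (Und A) b c\<rbrakk>
      \<Longrightarrow> HComp A (Ide (Vert A) g) (Ide (Vert A) f) = Ide (Vert A) (g \<cdot>\<^bsub>Und A\<^esub> f)"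
    and interchange: "\<lbrakk>\<alpha> \<in> hom (Vert A) f f'; \<alpha>' \<in> hom (Vert A) f' f'';
        \<beta> \<in> hom (Vert A) g g'; \<beta>' \<in> hom (Vert A) g' g''; Cod (Und A) f = Dom (Und A) g\<rbrakk>
      \<Longrightarrow> HComp A (\<beta>' \<cdot>\<^bsub>Vert A\<^esub> \<beta>) (\<alpha>' \<cdot>\<^bsub>Vert A\<^esub> \<alpha>) = HComp A \<beta>' \<alpha>' \<cdot>\<^bsub>Vert A\<^esub> HComp A \<beta> \<alpha>"
    and HComp_unit_left: "\<lbrakk>\<alpha> \<in> hom (Vert A) f g; Cod (Und A) f = b\<rbrakk>
      \<Longrightarrow> HComp A (Ide (Vert A) (Ide (Und A) b)) \<alpha> = \<alpha>"
    and HComp_unit_right: "\<lbrakk>\<alpha> \<in> hom (Vert A) f g; Dom (Und A) f = a\<rbrakk>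
      \<Longrightarrow> HComp A \<alpha> (Ide (Vert A) (Ide (Und A) a)) = \<alpha>"
    and HComp_assoc: "\<lbrakk>\<alpha> \<in> hom (Vert A) f f'; \<beta> \<in> hom (Vert A) g g'; \<gamma> \<in> hom (Vert A) h h';
        Cod (Und A) f = Dom (Und A) g; Cod (Und A) g = Dom (Und A) h\<rbrakk>
      \<Longrightarrow> HComp A (HComp A \<gamma> \<beta>) \<alpha> = HComp A \<gamma> (HComp A \<beta> \<alpha>)"

text \<open>\<open>whisker_left A h \<alpha>\<close> is the 2-cell \<open>h\<alpha>\<close>.\<close>

definition whisker_left :: "('a, 'f, 'c) two_cat \<Rightarrow> 'f \<Rightarrow> 'c \<Rightarrow> 'c"
  where "whisker_left A h \<alpha> = HComp A (Ide (Vert A) h) \<alpha>"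

record ('a, 'f, 'c, 'b, 'g, 'd) two_fun =
  F0 :: "'a \<Rightarrow> 'b"
  F1 :: "'f \<Rightarrow> 'g"
  F2 :: "'c \<Rightarrow> 'd"

locale two_functor =
  fixes A :: "('a, 'f, 'c) two_cat"
    and B :: "('b, 'g, 'd) two_cat"
    and F :: "('a, 'f, 'c, 'b, 'g, 'd) two_fun"
  assumes src_two_category: "two_category A"
    and tgt_two_category: "two_category B"
    and F0_in: "a \<in> Obj (Und A) \<Longrightarrow> F0 F a \<in> Obj (Und B)"
    and F1_in: "f \<in> hom (Und A) a b \<Longrightarrow> F1 F f \<in> hom (Und B) (F0 F a) (F0 F b)"
    and F1_Ide: "a \<in> Obj (Und A) \<Longrightarrow> F1 F (Ide (Und A) a) = Ide (Und B) (F0 F a)"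
    and F1_Comp: "\<lbrakk>f \<in> hom (Und A) a b; g \<in> hom (Und A) b c\<rbrakk>
      \<Longrightarrow> F1 F (g \<cdot>\<^bsub>Und A\<^esub> f) = F1 F g \<cdot>\<^bsub>Und B\<^esub> F1 F f"
    and F2_in: "\<alpha> \<in> hom (Vert A) f g \<Longrightarrow> F2 F \<alpha> \<in> hom (Vert B) (F1 F f) (F1 F g)"
    and F2_Ide: "f \<in> Arr (Und A) \<Longrightarrow> F2 F (Ide (Vert A) f) = Ide (Vert B) (F1 F f)"
    and F2_Comp: "\<lbrakk>\<alpha> \<in> hom (Vert A) f g; \<beta> \<in> hom (Vert A) g h\<rbrakk>
      \<Longrightarrow> F2 F (\<beta> \<cdot>\<^bsub>Vert A\<^esub> \<alpha>) = F2 F \<beta> \<cdot>\<^bsub>Vert B\<^esub> F2 F \<alpha>"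
    and F2_HComp: "\<lbrakk>\<alpha> \<in> hom (Vert A) f f'; \<beta> \<in> hom (Vert A) g g'; Cod (Und A) f = Dom (Und A) g\<rbrakk>
      \<Longrightarrow> F2 F (HComp A \<beta> \<alpha>) = HComp B (F2 F \<beta>) (F2 F \<alpha>)"

text \<open>For given types of objects and arrows, \<open>CAT\<close> is the 2-category of all categories carried by
  subsets of these types.\<close>

definition CAT :: "(('o, 'm) cat, ('o, 'm, 'o, 'm) cfun, ('o, 'm, 'o, 'm) ntrans) two_cat"
  where "CAT = \<lparr>
    Und = \<lparr>Obj = {C. category C}, Arr = {F. is_functor F}, Dom = Fsrc, Cod = Ftgt,
           Ide = functor_id, Comp = functor_comp\<rparr>,
    Vert = \<lparr>Obj = {F. is_functor F}, Arr = {\<alpha>. is_nat_trans \<alpha>}, Dom = Nsrc, Cod = Ntgt,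
            Ide = nat_id, Comp = nat_vcomp\<rparr>,
    HComp = nat_hcomp\<rparr>"

type_synonym ('a, 'f, 'c, 'o, 'm) cat_valued =
  "('a, 'f, 'c, ('o, 'm) cat, ('o, 'm, 'o, 'm) cfun, ('o, 'm, 'o, 'm) ntrans) two_fun"


section \<open>Pairs and \<open>\<sigma>\<close>-filteredness\<close>

locale sigma_pair = two_category A
  for A :: "('a, 'f, 'c) two_cat" +
  fixes \<Sigma> :: "'f set"
  assumes Sigma_Arr: "\<Sigma> \<subseteq> Arr (Und A)"
    and Sigma_Ide: "a \<in> Obj (Und A) \<Longrightarrow> Ide (Und A) a \<in> \<Sigma>"
    and Sigma_Comp: "\<lbrakk>f \<in> \<Sigma>; g \<in> \<Sigma>; Cod (Und A) f = Dom (Und A) g\<rbrakk> \<Longrightarrow> g \<cdot>\<^bsub>Und A\<^esub> f \<in> \<Sigma>"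

locale sigma_filtered = sigma_pair +
  assumes nonempty: "Obj (Und A) \<noteq> {}"
    and sigmaF0: "\<lbrakk>a \<in> Obj (Und A); b \<in> Obj (Und A)\<rbrakk>
      \<Longrightarrow> \<exists>e \<in> Obj (Und A). (\<exists>f \<in> hom (Und A) a e. f \<in> \<Sigma>) \<and> (\<exists>g \<in> hom (Und A) b e. g \<in> \<Sigma>)"
    and sigmaF1: "\<lbrakk>f \<in> hom (Und A) a b; g \<in> hom (Und A) a b; g \<in> \<Sigma>\<rbrakk>
      \<Longrightarrow> \<exists>e \<in> Obj (Und A). \<exists>h \<in> hom (Und A) b e. h \<in> \<Sigma> \<and>
            (\<exists>\<alpha> \<in> hom (Vert A) (h \<cdot>\<^bsub>Und A\<^esub> f) (h \<cdot>\<^bsub>Und A\<^esub> g). f \<in> \<Sigma> \<longrightarrow> invertible_arr (Vert A) \<alpha>)"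
    and sigmaF2: "\<lbrakk>f \<in> hom (Und A) a b; g \<in> hom (Und A) a b; g \<in> \<Sigma>;
        \<alpha> \<in> hom (Vert A) f g; \<beta> \<in> hom (Vert A) f g\<rbrakk>
      \<Longrightarrow> \<exists>e \<in> Obj (Und A). \<exists>h \<in> hom (Und A) b e. h \<in> \<Sigma> \<and>
            whisker_left A h \<alpha> = whisker_left A h \<beta>"


section \<open>\<open>\<sigma>\<close>-cones and \<open>\<sigma>\<close>-colimits in the 2-category of categories\<close>

text \<open>These are the \<open>\<sigma>\<close>-cones of a 2-functor valued in categories. The vertex is a category whose
  objects and arrows may have types different from those of the categories \<open>F0 F a\<close>; hence the
  definitions are spelled out with functors and natural transformations, and not for an arbitrary
  target 2-category.\<close>

record ('a, 'f, 'o, 'm, 'p, 'q) cone =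
  Leg :: "'a \<Rightarrow> ('o, 'm, 'p, 'q) cfun"
  Cell :: "'f \<Rightarrow> ('o, 'm, 'p, 'q) ntrans"

definition is_sigma_cone :: "('a, 'f, 'c) two_cat \<Rightarrow> 'f set \<Rightarrow> ('a, 'f, 'c, 'o, 'm) cat_valued
    \<Rightarrow> ('p, 'q) cat \<Rightarrow> ('a, 'f, 'o, 'm, 'p, 'q) cone \<Rightarrow> bool"
  where "is_sigma_cone A \<Sigma> F E \<theta> \<longleftrightarrow>
    category E \<and>
    Leg \<theta> \<in> extensional (Obj (Und A)) \<and>
    Cell \<theta> \<in> extensional (Arr (Und A)) \<and>
    (\<forall>a \<in> Obj (Und A). Leg \<theta> a \<in> functors (F0 F a) E) \<and>
    (\<forall>a b. \<forall>f \<in> hom (Und A) a b.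
      Cell \<theta> f \<in> hom (functor_cat (F0 F a) E) (functor_comp (Leg \<theta> b) (F1 F f)) (Leg \<theta> a)) \<and>
    (\<forall>a \<in> Obj (Und A). Cell \<theta> (Ide (Und A) a) = nat_id (Leg \<theta> a)) \<and>
    (\<forall>a b c. \<forall>f \<in> hom (Und A) a b. \<forall>g \<in> hom (Und A) b c.
      Cell \<theta> (g \<cdot>\<^bsub>Und A\<^esub> f) = nat_vcomp (Cell \<theta> f) (nat_hcomp (Cell \<theta> g) (nat_id (F1 F f)))) \<and>
    (\<forall>a b. \<forall>f \<in> hom (Und A) a b. \<forall>g \<in> hom (Und A) a b. \<forall>\<gamma> \<in> hom (Vert A) f g.
      Cell \<theta> f = nat_vcomp (Cell \<theta> g) (nat_hcomp (nat_id (Leg \<theta> b)) (F2 F \<gamma>))) \<and>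
    (\<forall>a b. \<forall>f \<in> hom (Und A) a b. f \<in> \<Sigma> \<longrightarrow>
      invertible_arr (functor_cat (F0 F a) E) (Cell \<theta> f))"

definition is_cone_morphism :: "('a, 'f, 'c) two_cat \<Rightarrow> ('a, 'f, 'c, 'o, 'm) cat_valued
    \<Rightarrow> ('p, 'q) cat \<Rightarrow> ('a, 'f, 'o, 'm, 'p, 'q) cone \<Rightarrow> ('a, 'f, 'o, 'm, 'p, 'q) cone
    \<Rightarrow> ('a \<Rightarrow> ('o, 'm, 'p, 'q) ntrans) \<Rightarrow> bool"
  where "is_cone_morphism A F E \<theta> \<theta>' \<phi> \<longleftrightarrow>
    \<phi> \<in> extensional (Obj (Und A)) \<and>
    (\<forall>a \<in> Obj (Und A). \<phi> a \<in> hom (functor_cat (F0 F a) E) (Leg \<theta> a) (Leg \<theta>' a)) \<and>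
    (\<forall>a b. \<forall>f \<in> hom (Und A) a b.
      nat_vcomp (Cell \<theta>' f) (nat_hcomp (\<phi> b) (nat_id (F1 F f))) = nat_vcomp (\<phi> a) (Cell \<theta> f))"

definition sigma_cones :: "('a, 'f, 'c) two_cat \<Rightarrow> 'f set \<Rightarrow> ('a, 'f, 'c, 'o, 'm) cat_valued
    \<Rightarrow> ('p, 'q) cat
    \<Rightarrow> (('a, 'f, 'o, 'm, 'p, 'q) cone,
        ('a, 'f, 'o, 'm, 'p, 'q) cone \<times> ('a \<Rightarrow> ('o, 'm, 'p, 'q) ntrans)
          \<times> ('a, 'f, 'o, 'm, 'p, 'q) cone) cat"
  where "sigma_cones A \<Sigma> F E = \<lparr>
    Obj = {\<theta>. is_sigma_cone A \<Sigma> F E \<theta>},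
    Arr = {(\<theta>, \<phi>, \<theta>'). is_sigma_cone A \<Sigma> F E \<theta> \<and> is_sigma_cone A \<Sigma> F E \<theta>' \<and>
                       is_cone_morphism A F E \<theta> \<theta>' \<phi>},
    Dom = (\<lambda>(\<theta>, \<phi>, \<theta>'). \<theta>),
    Cod = (\<lambda>(\<theta>, \<phi>, \<theta>'). \<theta>'),
    Ide = (\<lambda>\<theta>. (\<theta>, (\<lambda>a\<in>Obj (Und A). nat_id (Leg \<theta> a)), \<theta>)),
    Comp = (\<lambda>(\<theta>\<^sub>1, \<psi>, \<theta>\<^sub>2) (\<theta>\<^sub>0, \<phi>, _). (\<theta>\<^sub>0, (\<lambda>a\<in>Obj (Und A). nat_vcomp (\<psi> a) (\<phi> a)), \<theta>\<^sub>2))\<rparr>"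

definition postcompose_cone :: "('a, 'f, 'c) two_cat \<Rightarrow> ('p, 'q, 'r, 's) cfun
    \<Rightarrow> ('a, 'f, 'o, 'm, 'p, 'q) cone \<Rightarrow> ('a, 'f, 'o, 'm, 'r, 's) cone"
  where "postcompose_cone A H \<kappa> = \<lparr>
    Leg = (\<lambda>a\<in>Obj (Und A). functor_comp H (Leg \<kappa> a)),
    Cell = (\<lambda>f\<in>Arr (Und A). nat_hcomp (nat_id H) (Cell \<kappa> f))\<rparr>"

text \<open>The functor \<open>\<lambda>\<^sup>* : Cat(L, E) \<rightarrow> Cones\<^sub>\<sigma>(F, E)\<close>.\<close>

definition cone_pullback :: "('a, 'f, 'c) two_cat \<Rightarrow> 'f set \<Rightarrow> ('a, 'f, 'c, 'o, 'm) cat_valued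
    \<Rightarrow> ('p, 'q) cat \<Rightarrow> ('a, 'f, 'o, 'm, 'p, 'q) cone \<Rightarrow> ('r, 's) cat
    \<Rightarrow> (('p, 'q, 'r, 's) cfun, ('p, 'q, 'r, 's) ntrans, ('a, 'f, 'o, 'm, 'r, 's) cone,
        ('a, 'f, 'o, 'm, 'r, 's) cone \<times> ('a \<Rightarrow> ('o, 'm, 'r, 's) ntrans)
          \<times> ('a, 'f, 'o, 'm, 'r, 's) cone) cfun"
  where "cone_pullback A \<Sigma> F L \<kappa> E = \<lparr>
    Fsrc = functor_cat L E,
    Ftgt = sigma_cones A \<Sigma> F E,
    Omap = (\<lambda>H\<in>Obj (functor_cat L E). postcompose_cone A H \<kappa>),
    Amap = (\<lambda>\<eta>\<in>Arr (functor_cat L E).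
      (postcompose_cone A (Nsrc \<eta>) \<kappa>,
       (\<lambda>a\<in>Obj (Und A). nat_hcomp \<eta> (nat_id (Leg \<kappa> a))),
       postcompose_cone A (Ntgt \<eta>) \<kappa>))\<rparr>"

text \<open>The type argument fixes the types of the objects and arrows of the test categories \<open>E\<close>; a
  theorem in which it is a pair of type variables covers test categories of all types.\<close>

definition is_sigma_colimit :: "('r \<times> 's) itself \<Rightarrow> ('a, 'f, 'c) two_cat \<Rightarrow> 'f set
    \<Rightarrow> ('a, 'f, 'c, 'o, 'm) cat_valued \<Rightarrow> ('p, 'q) cat
    \<Rightarrow> ('a, 'f, 'o, 'm, 'p, 'q) cone \<Rightarrow> bool"
  where "is_sigma_colimit _ A \<Sigma> F L \<kappa> \<longleftrightarrow> is_sigma_cone A \<Sigma> F L \<kappa> \<and>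
    (\<forall>E :: ('r, 's) cat. category E \<longrightarrow> is_cat_isomorphism (cone_pullback A \<Sigma> F L \<kappa> E))"


section \<open>The category \<open>\<L>\<^sub>\<sigma>(F)\<close>\<close>

text \<open>A premorphism is a triple \<open>(u, \<xi>, v)\<close>; its source and target \<open>(x, A)\<close>, \<open>(y, B)\<close> are not
  determined by the triple and are passed as separate arguments.\<close>

definition premorphisms :: "('a, 'f, 'c) two_cat \<Rightarrow> 'f set \<Rightarrow> ('a, 'f, 'c, 'o, 'm) cat_valued
    \<Rightarrow> 'o \<times> 'a \<Rightarrow> 'o \<times> 'a \<Rightarrow> ('f \<times> 'm \<times> 'f) set"
  where "premorphisms A \<Sigma> F = (\<lambda>(x, a) (y, b).
    {(u, \<xi>, v). \<exists>c \<in> Obj (Und A). u \<in> hom (Und A) a c \<and> u \<in> \<Sigma> \<and> v \<in> hom (Und A) b c \<and>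
      \<xi> \<in> hom (F0 F c) (Omap (F1 F u) x) (Omap (F1 F v) y)})"

definition homotopical :: "('a, 'f, 'c) two_cat \<Rightarrow> 'f set \<Rightarrow> ('a, 'f, 'c, 'o, 'm) cat_valued
    \<Rightarrow> 'o \<times> 'a \<Rightarrow> 'o \<times> 'a \<Rightarrow> 'f \<times> 'm \<times> 'f \<Rightarrow> 'f \<times> 'm \<times> 'f \<Rightarrow> bool"
  where "homotopical A \<Sigma> F = (\<lambda>(x, a) (y, b) (u\<^sub>1, \<xi>\<^sub>1, v\<^sub>1) (u\<^sub>2, \<xi>\<^sub>2, v\<^sub>2).
    \<exists>d \<in> Obj (Und A).
    \<exists>w\<^sub>A \<in> hom (Und A) a d. \<exists>w\<^sub>B \<in> hom (Und A) b d.
    \<exists>w\<^sub>1 \<in> hom (Und A) (Cod (Und A) u\<^sub>1) d. \<exists>w\<^sub>2 \<in> hom (Und A) (Cod (Und A) u\<^sub>2) d.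
    \<exists>\<alpha>\<^sub>1 \<in> hom (Vert A) w\<^sub>A (w\<^sub>1 \<cdot>\<^bsub>Und A\<^esub> u\<^sub>1). \<exists>\<alpha>\<^sub>2 \<in> hom (Vert A) w\<^sub>A (w\<^sub>2 \<cdot>\<^bsub>Und A\<^esub> u\<^sub>2).
    \<exists>\<beta>\<^sub>1 \<in> hom (Vert A) (w\<^sub>1 \<cdot>\<^bsub>Und A\<^esub> v\<^sub>1) w\<^sub>B. \<exists>\<beta>\<^sub>2 \<in> hom (Vert A) (w\<^sub>2 \<cdot>\<^bsub>Und A\<^esub> v\<^sub>2) w\<^sub>B.
      {w\<^sub>A, w\<^sub>B, w\<^sub>1, w\<^sub>2} \<subseteq> \<Sigma> \<and>
      invertible_arr (Vert A) \<alpha>\<^sub>1 \<and> invertible_arr (Vert A) \<alpha>\<^sub>2 \<and>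
      Ncmp (F2 F \<beta>\<^sub>1) y \<cdot>\<^bsub>F0 F d\<^esub> (Amap (F1 F w\<^sub>1) \<xi>\<^sub>1 \<cdot>\<^bsub>F0 F d\<^esub> Ncmp (F2 F \<alpha>\<^sub>1) x) =
      Ncmp (F2 F \<beta>\<^sub>2) y \<cdot>\<^bsub>F0 F d\<^esub> (Amap (F1 F w\<^sub>2) \<xi>\<^sub>2 \<cdot>\<^bsub>F0 F d\<^esub> Ncmp (F2 F \<alpha>\<^sub>2) x))"

definition homotopy_rel :: "('a, 'f, 'c) two_cat \<Rightarrow> 'f set \<Rightarrow> ('a, 'f, 'c, 'o, 'm) cat_valued
    \<Rightarrow> 'o \<times> 'a \<Rightarrow> 'o \<times> 'a \<Rightarrow> ('f \<times> 'm \<times> 'f) rel"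
  where "homotopy_rel A \<Sigma> F X Y = {(p, q). p \<in> premorphisms A \<Sigma> F X Y \<and>
    q \<in> premorphisms A \<Sigma> F X Y \<and> homotopical A \<Sigma> F X Y p q}"

definition homotopy_class :: "('a, 'f, 'c) two_cat \<Rightarrow> 'f set \<Rightarrow> ('a, 'f, 'c, 'o, 'm) cat_valued
    \<Rightarrow> 'o \<times> 'a \<Rightarrow> 'o \<times> 'a \<Rightarrow> 'f \<times> 'm \<times> 'f \<Rightarrow> ('f \<times> 'm \<times> 'f) set"
  where "homotopy_class A \<Sigma> F X Y p = homotopy_rel A \<Sigma> F X Y `` {p}"

text \<open>\<open>premor_comp A F y r s \<gamma> \<zeta> \<xi>\<close> is \<open>\<zeta> \<circ>\<^sub>\<gamma> \<xi>\<close>, where \<open>y\<close> is the first component of the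
  intermediate object \<open>(y, B)\<close> and \<open>\<gamma> : r v \<Rightarrow> s u'\<close>.\<close>

definition composable_via :: "('a, 'f, 'c) two_cat \<Rightarrow> 'f set
    \<Rightarrow> 'f \<Rightarrow> 'f \<Rightarrow> 'c \<Rightarrow> 'f \<times> 'm \<times> 'f \<Rightarrow> 'f \<times> 'm \<times> 'f \<Rightarrow> bool"
  where "composable_via A \<Sigma> r s \<gamma> = (\<lambda>(u', \<zeta>, v') (u, \<xi>, v).
    r \<in> \<Sigma> \<and> s \<in> \<Sigma> \<and>
    (\<exists>d \<in> Obj (Und A). r \<in> hom (Und A) (Cod (Und A) v) d \<and> s \<in> hom (Und A) (Cod (Und A) u') d) \<and>
    \<gamma> \<in> hom (Vert A) (r \<cdot>\<^bsub>Und A\<^esub> v) (s \<cdot>\<^bsub>Und A\<^esub> u'))"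

definition premor_comp :: "('a, 'f, 'c) two_cat \<Rightarrow> ('a, 'f, 'c, 'o, 'm) cat_valued
    \<Rightarrow> 'o \<Rightarrow> 'f \<Rightarrow> 'f \<Rightarrow> 'c \<Rightarrow> 'f \<times> 'm \<times> 'f \<Rightarrow> 'f \<times> 'm \<times> 'f \<Rightarrow> 'f \<times> 'm \<times> 'f"
  where "premor_comp A F y r s \<gamma> = (\<lambda>(u', \<zeta>, v') (u, \<xi>, v).
    let D = F0 F (Cod (Und A) r) in
    (r \<cdot>\<^bsub>Und A\<^esub> u,
     Amap (F1 F s) \<zeta> \<cdot>\<^bsub>D\<^esub> (Ncmp (F2 F \<gamma>) y \<cdot>\<^bsub>D\<^esub> Amap (F1 F r) \<xi>),
     s \<cdot>\<^bsub>Und A\<^esub> v'))"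

text \<open>The composite of two homotopy classes is the union of the classes of all composites of
  representatives. As all of these classes coincide, the union is this common class.\<close>

definition class_comp :: "('a, 'f, 'c) two_cat \<Rightarrow> 'f set \<Rightarrow> ('a, 'f, 'c, 'o, 'm) cat_valued
    \<Rightarrow> 'o \<times> 'a \<Rightarrow> 'o \<times> 'a \<Rightarrow> 'o \<times> 'a
    \<Rightarrow> ('f \<times> 'm \<times> 'f) set \<Rightarrow> ('f \<times> 'm \<times> 'f) set \<Rightarrow> ('f \<times> 'm \<times> 'f) set"
  where "class_comp A \<Sigma> F X Y Z Q P =
    \<Union> {homotopy_class A \<Sigma> F X Z (premor_comp A F (fst Y) r s \<gamma> q p) | r s \<gamma> q p.
        q \<in> Q \<and> p \<in> P \<and> composable_via A \<Sigma> r s \<gamma> q p}"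

text \<open>An arrow of \<open>\<L>\<^sub>\<sigma>(F)\<close> is a homotopy class together with its source and target.\<close>

definition L_sigma :: "('a, 'f, 'c) two_cat \<Rightarrow> 'f set \<Rightarrow> ('a, 'f, 'c, 'o, 'm) cat_valued
    \<Rightarrow> ('o \<times> 'a, ('o \<times> 'a) \<times> ('f \<times> 'm \<times> 'f) set \<times> ('o \<times> 'a)) cat"
  where "L_sigma A \<Sigma> F =
    (let Ob = {(x, a). a \<in> Obj (Und A) \<and> x \<in> Obj (F0 F a)} in \<lparr>
    Obj = Ob,
    Arr = {(X, P, Y). X \<in> Ob \<and> Y \<in> Ob \<and> P \<in> premorphisms A \<Sigma> F X Y // homotopy_rel A \<Sigma> F X Y},
    Dom = (\<lambda>(X, P, Y). X),
    Cod = (\<lambda>(X, P, Y). Y),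
    Ide = (\<lambda>(x, a). ((x, a),
      homotopy_class A \<Sigma> F (x, a) (x, a) (Ide (Und A) a, Ide (F0 F a) x, Ide (Und A) a), (x, a))),
    Comp = (\<lambda>(Y, Q, Z) (X, P, _). (X, class_comp A \<Sigma> F X Y Z Q P, Z))\<rparr>)"

definition lambda_leg :: "('a, 'f, 'c) two_cat \<Rightarrow> 'f set \<Rightarrow> ('a, 'f, 'c, 'o, 'm) cat_valued
    \<Rightarrow> 'a \<Rightarrow> ('o, 'm, 'o \<times> 'a, ('o \<times> 'a) \<times> ('f \<times> 'm \<times> 'f) set \<times> ('o \<times> 'a)) cfun"
  where "lambda_leg A \<Sigma> F a = \<lparr>
    Fsrc = F0 F a,
    Ftgt = L_sigma A \<Sigma> F,
    Omap = (\<lambda>x\<in>Obj (F0 F a). (x, a)),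
    Amap = (\<lambda>\<xi>\<in>Arr (F0 F a).
      let X = (Dom (F0 F a) \<xi>, a); Y = (Cod (F0 F a) \<xi>, a) in
      (X, homotopy_class A \<Sigma> F X Y (Ide (Und A) a, \<xi>, Ide (Und A) a), Y))\<rparr>"

definition lambda_cell :: "('a, 'f, 'c) two_cat \<Rightarrow> 'f set \<Rightarrow> ('a, 'f, 'c, 'o, 'm) cat_valued
    \<Rightarrow> 'f \<Rightarrow> ('o, 'm, 'o \<times> 'a, ('o \<times> 'a) \<times> ('f \<times> 'm \<times> 'f) set \<times> ('o \<times> 'a)) ntrans"
  where "lambda_cell A \<Sigma> F u =
    (let a = Dom (Und A) u; b = Cod (Und A) u in \<lparr>
    Nsrc = functor_comp (lambda_leg A \<Sigma> F b) (F1 F u),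
    Ntgt = lambda_leg A \<Sigma> F a,
    Ncmp = (\<lambda>x\<in>Obj (F0 F a).
      let X = (Omap (F1 F u) x, b); Y = (x, a) in
      (X, homotopy_class A \<Sigma> F X Y (Ide (Und A) b, Ide (F0 F b) (Omap (F1 F u) x), u), Y))\<rparr>)"

definition lambda_cone :: "('a, 'f, 'c) two_cat \<Rightarrow> 'f set \<Rightarrow> ('a, 'f, 'c, 'o, 'm) cat_valued
    \<Rightarrow> ('a, 'f, 'o, 'm, 'o \<times> 'a, ('o \<times> 'a) \<times> ('f \<times> 'm \<times> 'f) set \<times> ('o \<times> 'a)) cone"
  where "lambda_cone A \<Sigma> F = \<lparr>
    Leg = (\<lambda>a\<in>Obj (Und A). lambda_leg A \<Sigma> F a),
    Cell = (\<lambda>u\<in>Arr (Und A). lambda_cell A \<Sigma> F u)\<rparr>"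

end

theory Submission
  imports Defs
begin

text \<open>Everything rests on one elementary operation on premorphisms. A premorphism \<open>(u, \<xi>, v)\<close> with
\<open>u : A \<rightarrow> C\<close> and \<open>v : B \<rightarrow> C\<close> is \<^emph>\<open>refined\<close> by pushing it along some \<open>w : C \<rightarrow> D\<close> in \<open>\<Sigma>\<close>, replacing \<open>w u\<close>
by an isomorphic arrow, and continuing along a 2-cell out of \<open>w v\<close>. Two premorphisms are
homotopical exactly when they have a common refinement whose third arrow lies in \<open>\<Sigma>\<close>
(\<open>homotopical_iff\<close>). In a \<open>\<sigma>\<close>-filtered pair refinement is confluent (\<open>refines_confluent\<close>), so homotopy
is the equivalence relation generated by refinement, and an equality of classes can be
established by exhibiting a single refinement.

Two composites of the same premorphisms become equal after a refinement (\<open>premor_comp_indep\<close>), and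
every composite of refinements is a refinement of a composite (\<open>premor_comp_refines\<close>). Hence classes
compose. Associativity holds for representatives, if the 2-cells are chosen coherently. Most
other identities in \<open>\<L>\<^sub>\<sigma>(F)\<close> are instances of a formula for the composite with a premorphism whose
first arrow is an identity (\<open>L_Comp_post\<close>); in particular, \<open>\<lambda>\<close> is a \<open>\<sigma>\<close>-cone, and
\<open>[(u, \<xi>, v)] = (\<lambda>\<^sub>v)\<^sub>y \<circ> \<lambda>\<^sub>C(\<xi>) \<circ> ((\<lambda>\<^sub>u)\<^sub>x)\<^sup>-\<^sup>1\<close>
(\<open>mor_decomposition\<close>). By this decomposition, functors out of \<open>\<L>\<^sub>\<sigma>(F)\<close>, and natural transformations
between them, are determined by their composites with \<open>\<lambda>\<close>, and naturality can be tested on \<open>\<lambda>\<close>.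
Conversely, for a \<open>\<sigma>\<close>-cone \<open>\<theta>\<close> the expression \<open>\<theta>\<^sub>v \<circ> \<theta>\<^sub>C(\<xi>) \<circ> \<theta>\<^sub>u\<^sup>-\<^sup>1\<close> does not change under
refinement (\<open>cone_value_refines\<close>) and turns composites into composites (\<open>cone_value_comp\<close>), so it
defines a functor that factorizes \<open>\<theta>\<close> through \<open>\<lambda>\<close>. Therefore \<open>\<lambda>\<^sup>*\<close> is bijective on objects and on
arrows, and a functor with this property is an isomorphism of categories.\<close>

section \<open>Categories, functors and natural transformations\<close>

text \<open>The rewrite rules below are stated with \<open>Arr\<close>, \<open>Dom\<close> and \<open>Cod\<close> instead of \<open>hom\<close>, so that no variable
occurs in their premises only: in this form the simplifier verifies composability by itself and
brings composites to a normal form.\<close>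

lemma hom_iff:
  "category C \<Longrightarrow> f \<in> hom C a b \<longleftrightarrow>
    f \<in> Arr C \<and> Dom C f = a \<and> Cod C f = b \<and> a \<in> Obj C \<and> b \<in> Obj C"
  by (auto simp: hom_def category.Dom_in category.Cod_in)

lemma cat_Ide [simp]:
  assumes "category C" "a \<in> Obj C"
  shows "Ide C a \<in> Arr C" "Dom C (Ide C a) = a" "Cod C (Ide C a) = a"
  using category.Ide_in[OF assms] by (auto simp: hom_def)

lemma cat_Comp [simp]:
  assumes "category C" "f \<in> Arr C" "g \<in> Arr C" "Cod C f = Dom C g"
  shows "g \<cdot>\<^bsub>C\<^esub> f \<in> Arr C" "Dom C (g \<cdot>\<^bsub>C\<^esub> f) = Dom C f" "Cod C (g \<cdot>\<^bsub>C\<^esub> f) = Cod C g"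
  using category.Comp_in[OF assms(1), of f "Dom C f" "Cod C f" g "Cod C g"] assms
  by (auto simp: hom_def)

lemma cat_Obj [simp]:
  assumes "category C" "f \<in> Arr C"
  shows "Dom C f \<in> Obj C" "Cod C f \<in> Obj C"
  using assms by (simp_all add: category.Dom_in category.Cod_in)

lemma cat_unit [simp]:
  assumes "category C" "f \<in> Arr C"
  shows "Cod C f = b \<Longrightarrow> Ide C b \<cdot>\<^bsub>C\<^esub> f = f" "Dom C f = a \<Longrightarrow> f \<cdot>\<^bsub>C\<^esub> Ide C a = f"
  using assms category.Comp_Ide_left[OF assms(1), of f] category.Comp_Ide_right[OF assms(1), of f]
  by (auto simp: hom_def)

lemma cat_assoc [simp]:
  assumes "category C" "f \<in> Arr C" "g \<in> Arr C" "h \<in> Arr C" "Cod C f = Dom C g" "Cod C g = Dom C h"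
  shows "(h \<cdot>\<^bsub>C\<^esub> g) \<cdot>\<^bsub>C\<^esub> f = h \<cdot>\<^bsub>C\<^esub> (g \<cdot>\<^bsub>C\<^esub> f)"
  using category.Comp_assoc[OF assms(1), of f _ _ g _ h] assms by (auto simp: hom_def)

definition Inv :: "('o, 'm) cat \<Rightarrow> 'm \<Rightarrow> 'm"
  where "Inv C f = (SOME g. g \<in> hom C (Cod C f) (Dom C f) \<and>
      g \<cdot>\<^bsub>C\<^esub> f = Ide C (Dom C f) \<and> f \<cdot>\<^bsub>C\<^esub> g = Ide C (Cod C f))"

lemma Inv_props:
  assumes "invertible_arr C f"
  shows "Inv C f \<in> hom C (Cod C f) (Dom C f) \<and>
      Inv C f \<cdot>\<^bsub>C\<^esub> f = Ide C (Dom C f) \<and> f \<cdot>\<^bsub>C\<^esub> Inv C f = Ide C (Cod C f)"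
  unfolding Inv_def by (rule someI_ex) (use assms in \<open>auto simp: invertible_arr_def\<close>)

lemma Inv_simps [simp]:
  assumes "invertible_arr C f"
  shows "Inv C f \<in> Arr C" "Dom C (Inv C f) = Cod C f" "Cod C (Inv C f) = Dom C f"
    "Inv C f \<cdot>\<^bsub>C\<^esub> f = Ide C (Dom C f)" "f \<cdot>\<^bsub>C\<^esub> Inv C f = Ide C (Cod C f)"
  using Inv_props[OF assms] by (auto simp: hom_def)

lemma invertible_in_Arr: "invertible_arr C f \<Longrightarrow> f \<in> Arr C"
  by (simp add: invertible_arr_def)

lemma Inv_cancel [simp]:
  assumes "category C" "invertible_arr C f" "g \<in> Arr C"
  shows "Cod C g = Dom C f \<Longrightarrow> Inv C f \<cdot>\<^bsub>C\<^esub> (f \<cdot>\<^bsub>C\<^esub> g) = g"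
    "Cod C g = Cod C f \<Longrightarrow> f \<cdot>\<^bsub>C\<^esub> (Inv C f \<cdot>\<^bsub>C\<^esub> g) = g"
  using assms invertible_in_Arr[OF assms(2)] by (simp_all flip: cat_assoc)

lemma invertible_arrI:
  assumes "category C" "f \<in> Arr C" "g \<in> Arr C" "Dom C g = Cod C f" "Cod C g = Dom C f"
    "g \<cdot>\<^bsub>C\<^esub> f = Ide C (Dom C f)" "f \<cdot>\<^bsub>C\<^esub> g = Ide C (Cod C f)"
  shows "invertible_arr C f"
  using assms by (auto simp: invertible_arr_def hom_def)

lemma Inv_unique:
  assumes "category C" "f \<in> Arr C" "g \<in> Arr C" "Dom C g = Cod C f" "Cod C g = Dom C f"
    "g \<cdot>\<^bsub>C\<^esub> f = Ide C (Dom C f)" "f \<cdot>\<^bsub>C\<^esub> g = Ide C (Cod C f)"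
  shows "Inv C f = g"
proof -
  have inv: "invertible_arr C f" by (rule invertible_arrI[OF assms])
  have "g = g \<cdot>\<^bsub>C\<^esub> (f \<cdot>\<^bsub>C\<^esub> Inv C f)" using inv assms by simp
  also have "\<dots> = (g \<cdot>\<^bsub>C\<^esub> f) \<cdot>\<^bsub>C\<^esub> Inv C f" using inv assms by (subst cat_assoc) auto
  also have "\<dots> = Inv C f" using inv assms by simp
  finally show ?thesis ..
qed

lemma Inv_Ide [simp]: "\<lbrakk>category C; a \<in> Obj C\<rbrakk> \<Longrightarrow> Inv C (Ide C a) = Ide C a"
  by (rule Inv_unique) simp_all

lemma right_inverse_eq_Inv:
  assumes "category C" "invertible_arr C f" "g \<in> Arr C" "Cod C g = Dom C f" "f \<cdot>\<^bsub>C\<^esub> g = Ide C (Cod C f)"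
  shows "g = Inv C f"
proof -
  have "g = Inv C f \<cdot>\<^bsub>C\<^esub> (f \<cdot>\<^bsub>C\<^esub> g)" using assms(1-4) by simp
  also have "\<dots> = Inv C f" using assms by simp
  finally show ?thesis .
qed

lemma invertible_Ide: "\<lbrakk>category C; a \<in> Obj C\<rbrakk> \<Longrightarrow> invertible_arr C (Ide C a)"
  by (rule invertible_arrI[of _ _ "Ide C a"]) auto

lemma invertible_Inv: "\<lbrakk>category C; invertible_arr C f\<rbrakk> \<Longrightarrow> invertible_arr C (Inv C f)"
  by (rule invertible_arrI[of _ _ f]) (auto simp: invertible_in_Arr)

lemma invertible_Comp:
  assumes "category C" "invertible_arr C f" "invertible_arr C g" "Cod C f = Dom C g"
  shows "invertible_arr C (g \<cdot>\<^bsub>C\<^esub> f)"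
  using assms invertible_in_Arr[OF assms(2)] invertible_in_Arr[OF assms(3)]
  by (intro invertible_arrI[of _ _ "Inv C f \<cdot>\<^bsub>C\<^esub> Inv C g"]) (auto)

lemma Inv_Comp:
  assumes "category C" "invertible_arr C f" "invertible_arr C g" "Cod C f = Dom C g"
  shows "Inv C (g \<cdot>\<^bsub>C\<^esub> f) = Inv C f \<cdot>\<^bsub>C\<^esub> Inv C g"
  using assms invertible_in_Arr[OF assms(2)] invertible_in_Arr[OF assms(3)]
  by (intro Inv_unique) (auto)

lemma square_comp:
  assumes "category C" "f \<in> Arr C" "f' \<in> Arr C" "g \<in> Arr C" "g' \<in> Arr C" "h \<in> Arr C" "k \<in> Arr C" "l \<in> Arr C"
    "Cod C f = Dom C k" "Dom C f' = Cod C h" "Dom C f = Dom C h" "Cod C f' = Cod C k"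
    "Cod C g = Dom C l" "Dom C g' = Cod C k" "Dom C g = Dom C k" "Cod C g' = Cod C l"
    "k \<cdot>\<^bsub>C\<^esub> f = f' \<cdot>\<^bsub>C\<^esub> h" "l \<cdot>\<^bsub>C\<^esub> g = g' \<cdot>\<^bsub>C\<^esub> k"
  shows "l \<cdot>\<^bsub>C\<^esub> (g \<cdot>\<^bsub>C\<^esub> f) = (g' \<cdot>\<^bsub>C\<^esub> f') \<cdot>\<^bsub>C\<^esub> h"
proof -
  have "l \<cdot>\<^bsub>C\<^esub> (g \<cdot>\<^bsub>C\<^esub> f) = (l \<cdot>\<^bsub>C\<^esub> g) \<cdot>\<^bsub>C\<^esub> f" using assms(1-16) by simp
  also have "\<dots> = g' \<cdot>\<^bsub>C\<^esub> (k \<cdot>\<^bsub>C\<^esub> f)" unfolding assms(18) using assms(1-16) by simp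
  also have "\<dots> = (g' \<cdot>\<^bsub>C\<^esub> f') \<cdot>\<^bsub>C\<^esub> h" unfolding assms(17) using assms(1-16) by simp
  finally show ?thesis .
qed

lemma square_Inv:
  assumes "category C" "invertible_arr C f" "invertible_arr C f'" "h \<in> Arr C" "k \<in> Arr C"
    "Cod C f = Dom C k" "Dom C f' = Cod C h" "Dom C f = Dom C h" "Cod C f' = Cod C k"
    "k \<cdot>\<^bsub>C\<^esub> f = f' \<cdot>\<^bsub>C\<^esub> h"
  shows "h \<cdot>\<^bsub>C\<^esub> Inv C f = Inv C f' \<cdot>\<^bsub>C\<^esub> k"
proof -
  have f: "f \<in> Arr C" "f' \<in> Arr C" using assms(2,3) by (simp_all add: invertible_in_Arr)
  have "h \<cdot>\<^bsub>C\<^esub> Inv C f = Inv C f' \<cdot>\<^bsub>C\<^esub> ((f' \<cdot>\<^bsub>C\<^esub> h) \<cdot>\<^bsub>C\<^esub> Inv C f)" using assms(1-9) f by simp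
  also have "\<dots> = Inv C f' \<cdot>\<^bsub>C\<^esub> k" unfolding assms(10)[symmetric] using assms(1-9) f by simp
  finally show ?thesis .
qed

lemma Ball_hom: "(\<forall>a b. \<forall>f \<in> hom C a b. P a b f) \<longleftrightarrow> (\<forall>f \<in> Arr C. P (Dom C f) (Cod C f) f)"
  by (auto simp: hom_def)

lemma Ball_hom2: "(\<forall>a b c. \<forall>f \<in> hom C a b. \<forall>g \<in> hom C b c. P a b c f g) \<longleftrightarrow>
  (\<forall>f \<in> Arr C. \<forall>g \<in> Arr C. Cod C f = Dom C g \<longrightarrow> P (Dom C f) (Cod C f) (Cod C g) f g)"
proof (intro iffI ballI impI allI)
  fix f g assume *: "\<forall>a b c. \<forall>f \<in> hom C a b. \<forall>g \<in> hom C b c. P a b c f g"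
    and "f \<in> Arr C" "g \<in> Arr C" "Cod C f = Dom C g"
  then have "f \<in> hom C (Dom C f) (Cod C f)" "g \<in> hom C (Cod C f) (Cod C g)"
    by (simp_all add: hom_def)
  with * show "P (Dom C f) (Cod C f) (Cod C g) f g" by blast
next
  fix a b c f g assume *: "\<forall>f \<in> Arr C. \<forall>g \<in> Arr C. Cod C f = Dom C g \<longrightarrow>
      P (Dom C f) (Cod C f) (Cod C g) f g"
    and "f \<in> hom C a b" "g \<in> hom C b c"
  then have "f \<in> Arr C" "g \<in> Arr C" "a = Dom C f" "b = Cod C f" "c = Cod C g" "Cod C f = Dom C g"
    by (simp_all add: hom_def)
  with * show "P a b c f g" by blast
qed

lemma functorD [simp]:
  assumes "is_functor H"
  shows "category (Fsrc H)" "category (Ftgt H)"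
    "a \<in> Obj (Fsrc H) \<Longrightarrow> Ftgt H = D \<Longrightarrow> Omap H a \<in> Obj D"
    "f \<in> Arr (Fsrc H) \<Longrightarrow> Ftgt H = D \<Longrightarrow> Amap H f \<in> Arr D"
    "f \<in> Arr (Fsrc H) \<Longrightarrow> Ftgt H = D \<Longrightarrow> Dom D (Amap H f) = Omap H (Dom (Fsrc H) f)"
    "f \<in> Arr (Fsrc H) \<Longrightarrow> Ftgt H = D \<Longrightarrow> Cod D (Amap H f) = Omap H (Cod (Fsrc H) f)"
    "a \<in> Obj (Fsrc H) \<Longrightarrow> Fsrc H = C \<Longrightarrow> Amap H (Ide C a) = Ide (Ftgt H) (Omap H a)"
    "f \<in> Arr (Fsrc H) \<Longrightarrow> g \<in> Arr (Fsrc H) \<Longrightarrow> Cod (Fsrc H) f = Dom (Fsrc H) g \<Longrightarrow> Fsrc H = C \<Longrightarrow>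
      Amap H (g \<cdot>\<^bsub>C\<^esub> f) = Amap H g \<cdot>\<^bsub>Ftgt H\<^esub> Amap H f"
  using assms by (auto simp: is_functor_def PiE_def Pi_def)

lemma functorI:
  assumes "category (Fsrc H)" "category (Ftgt H)"
    "Omap H \<in> extensional (Obj (Fsrc H))" "Amap H \<in> extensional (Arr (Fsrc H))"
    "\<And>a. a \<in> Obj (Fsrc H) \<Longrightarrow> Omap H a \<in> Obj (Ftgt H)"
    "\<And>f. f \<in> Arr (Fsrc H) \<Longrightarrow> Amap H f \<in> Arr (Ftgt H)"
    "\<And>f. f \<in> Arr (Fsrc H) \<Longrightarrow> Dom (Ftgt H) (Amap H f) = Omap H (Dom (Fsrc H) f)"
    "\<And>f. f \<in> Arr (Fsrc H) \<Longrightarrow> Cod (Ftgt H) (Amap H f) = Omap H (Cod (Fsrc H) f)"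
    "\<And>a. a \<in> Obj (Fsrc H) \<Longrightarrow> Amap H (Ide (Fsrc H) a) = Ide (Ftgt H) (Omap H a)"
    "\<And>f g. \<lbrakk>f \<in> Arr (Fsrc H); g \<in> Arr (Fsrc H); Cod (Fsrc H) f = Dom (Fsrc H) g\<rbrakk> \<Longrightarrow>
      Amap H (g \<cdot>\<^bsub>Fsrc H\<^esub> f) = Amap H g \<cdot>\<^bsub>Ftgt H\<^esub> Amap H f"
  shows "is_functor H"
  using assms unfolding is_functor_def by (simp add: PiE_def Pi_def del: functorD)

lemma functor_extensional:
  assumes "is_functor H"
  shows "Omap H \<in> extensional (Obj (Fsrc H))" "Amap H \<in> extensional (Arr (Fsrc H))"
  using assms unfolding is_functor_def by (simp_all add: PiE_def del: functorD)

lemma functor_eqI: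
  assumes "is_functor H" "is_functor K" "Fsrc H = Fsrc K" "Ftgt H = Ftgt K"
    "\<And>a. a \<in> Obj (Fsrc K) \<Longrightarrow> Omap H a = Omap K a"
    "\<And>f. f \<in> Arr (Fsrc K) \<Longrightarrow> Amap H f = Amap K f"
  shows "H = K"
proof -
  have "Omap H = Omap K"
    using functor_extensional(1)[OF assms(1)] functor_extensional(1)[OF assms(2)] assms(3,5)
    by (intro extensionalityI[of _ "Obj (Fsrc K)"]) auto
  moreover have "Amap H = Amap K"
    using functor_extensional(2)[OF assms(1)] functor_extensional(2)[OF assms(2)] assms(3,6)
    by (intro extensionalityI[of _ "Arr (Fsrc K)"]) auto
  ultimately show ?thesis using assms by (intro cfun.equality) auto
qed

lemma functors_iff: "H \<in> functors C D \<longleftrightarrow> is_functor H \<and> Fsrc H = C \<and> Ftgt H = D"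
  by (simp add: functors_def)

lemma functor_comp_simps [simp]:
  "Fsrc (functor_comp G H) = Fsrc H" "Ftgt (functor_comp G H) = Ftgt G"
  "a \<in> Obj (Fsrc H) \<Longrightarrow> Omap (functor_comp G H) a = Omap G (Omap H a)"
  "f \<in> Arr (Fsrc H) \<Longrightarrow> Amap (functor_comp G H) f = Amap G (Amap H f)"
  by (simp_all add: functor_comp_def)

lemma functor_id_simps [simp]:
  "Fsrc (functor_id C) = C" "Ftgt (functor_id C) = C"
  "a \<in> Obj C \<Longrightarrow> Omap (functor_id C) a = a"
  "f \<in> Arr C \<Longrightarrow> Amap (functor_id C) f = f"
  by (simp_all add: functor_id_def)

lemma functor_comp [simp]:
  assumes "is_functor G" "is_functor H" "Ftgt H = Fsrc G"
  shows "is_functor (functor_comp G H)"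
  using assms by (intro functorI) (auto simp: functor_comp_def)

lemma functor_id [simp]: "category C \<Longrightarrow> is_functor (functor_id C)"
  by (intro functorI) (auto simp: functor_id_def)

lemma functor_invertible [simp]:
  assumes "is_functor H" "Fsrc H = C" "Ftgt H = D" "invertible_arr C f"
  shows "invertible_arr D (Amap H f)" and "Amap H (Inv C f) = Inv D (Amap H f)"
proof -
  have C: "category C" "category D" and f: "f \<in> Arr C" using assms invertible_in_Arr functorD(1,2)[of H] by auto
  have 1: "Amap H (Inv C f) \<cdot>\<^bsub>D\<^esub> Amap H f = Ide D (Omap H (Dom C f))"
    using assms C f functorD(8)[of H f "Inv C f" C] by simp
  have 2: "Amap H f \<cdot>\<^bsub>D\<^esub> Amap H (Inv C f) = Ide D (Omap H (Cod C f))"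
    using assms C f functorD(8)[of H "Inv C f" f C] by simp
  show "invertible_arr D (Amap H f)"
    by (rule invertible_arrI[of _ _ "Amap H (Inv C f)"]) (use 1 2 C f assms in simp_all)
  show "Amap H (Inv C f) = Inv D (Amap H f)"
    by (rule Inv_unique[symmetric]) (use 1 2 C f assms in simp_all)
qed

lemma cat_isomorphismI:
  assumes K: "is_functor K"
    and obj: "bij_betw (Omap K) (Obj (Fsrc K)) (Obj (Ftgt K))"
    and arr: "bij_betw (Amap K) (Arr (Fsrc K)) (Arr (Ftgt K))"
  shows "is_cat_isomorphism K"
proof -
  let ?C = "Fsrc K" and ?D = "Ftgt K"
  define o' where "o' = restrict (inv_into (Obj ?C) (Omap K)) (Obj ?D)"
  define a' where "a' = restrict (inv_into (Arr ?C) (Amap K)) (Arr ?D)"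
  define G where "G = \<lparr>Fsrc = ?D, Ftgt = ?C, Omap = o', Amap = a'\<rparr>"
  have o1: "o' b \<in> Obj ?C" "Omap K (o' b) = b" if "b \<in> Obj ?D" for b
    using that obj by (auto simp: o'_def bij_betw_def inv_into_into f_inv_into_f)
  have o2: "o' (Omap K a) = a" if "a \<in> Obj ?C" for a
    using that obj K by (simp add: o'_def bij_betw_def)
  have a1: "a' b \<in> Arr ?C" "Amap K (a' b) = b" if "b \<in> Arr ?D" for b
    using that arr by (auto simp: a'_def bij_betw_def inv_into_into f_inv_into_f)
  have a2: "a' (Amap K a) = a" if "a \<in> Arr ?C" for a
    using that arr K by (simp add: a'_def bij_betw_def)
  \<comment> \<open>Functoriality of the inverse maps follows from that of \<open>K\<close> and the injectivity of \<open>K\<close>.\<close>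
  have dom: "Dom ?C (a' f) = o' (Dom ?D f)" "Cod ?C (a' f) = o' (Cod ?D f)"
    if f: "f \<in> Arr ?D" for f
    using o2[of "Dom ?C (a' f)"] o2[of "Cod ?C (a' f)"] functorD(5,6)[OF K a1(1)[OF f] refl] a1[OF f] K
    by auto
  have G: "is_functor G"
  proof (rule functorI)
    fix b assume "b \<in> Obj (Fsrc G)"
    then have b: "b \<in> Obj ?D" by (simp add: G_def)
    have "Amap K (Ide ?C (o' b)) = Ide ?D b" using o1[OF b] K by simp
    then have "a' (Ide ?D b) = Ide ?C (o' b)" using a2[of "Ide ?C (o' b)"] o1[OF b] K by simp
    then show "Amap G (Ide (Fsrc G) b) = Ide (Ftgt G) (Omap G b)" by (simp add: G_def)
  next
    fix f g assume "f \<in> Arr (Fsrc G)" "g \<in> Arr (Fsrc G)" "Cod (Fsrc G) f = Dom (Fsrc G) g"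
    then have fg: "f \<in> Arr ?D" "g \<in> Arr ?D" "Cod ?D f = Dom ?D g" by (simp_all add: G_def)
    have "Amap K (a' g \<cdot>\<^bsub>?C\<^esub> a' f) = g \<cdot>\<^bsub>?D\<^esub> f" using a1 dom fg K by simp
    then have "a' (g \<cdot>\<^bsub>?D\<^esub> f) = a' g \<cdot>\<^bsub>?C\<^esub> a' f"
      using a2[of "a' g \<cdot>\<^bsub>?C\<^esub> a' f"] a1 dom fg K by simp
    then show "Amap G (g \<cdot>\<^bsub>Fsrc G\<^esub> f) = Amap G g \<cdot>\<^bsub>Ftgt G\<^esub> Amap G f" by (simp add: G_def)
  qed (use K o1 a1 dom in \<open>auto simp: G_def o'_def a'_def\<close>)
  moreover have "functor_comp G K = functor_id ?C"
    by (rule functor_eqI) (use G K o2 a2 in \<open>auto simp: G_def\<close>)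
  moreover have "functor_comp K G = functor_id ?D"
    by (rule functor_eqI) (use G K o1 a1 in \<open>auto simp: G_def\<close>)
  ultimately show ?thesis using K unfolding is_cat_isomorphism_def
    by (intro conjI bexI[of _ G]) (auto simp: functors_iff G_def)
qed

lemma nat_transD [simp]:
  assumes "is_nat_trans \<alpha>"
  shows "is_functor (Nsrc \<alpha>)" "is_functor (Ntgt \<alpha>)"
    "Fsrc (Ntgt \<alpha>) = Fsrc (Nsrc \<alpha>)" "Ftgt (Ntgt \<alpha>) = Ftgt (Nsrc \<alpha>)"
    "a \<in> Obj (Fsrc (Nsrc \<alpha>)) \<Longrightarrow> Ftgt (Nsrc \<alpha>) = D \<Longrightarrow> Ncmp \<alpha> a \<in> Arr D"
    "a \<in> Obj (Fsrc (Nsrc \<alpha>)) \<Longrightarrow> Ftgt (Nsrc \<alpha>) = D \<Longrightarrow> Dom D (Ncmp \<alpha> a) = Omap (Nsrc \<alpha>) a"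
    "a \<in> Obj (Fsrc (Nsrc \<alpha>)) \<Longrightarrow> Ftgt (Nsrc \<alpha>) = D \<Longrightarrow> Cod D (Ncmp \<alpha> a) = Omap (Ntgt \<alpha>) a"
  using assms by (auto simp: is_nat_trans_def Let_def functors_iff hom_def)

lemma nat_trans_natural:
  assumes "is_nat_trans \<alpha>" "f \<in> Arr (Fsrc (Nsrc \<alpha>))"
    "Ftgt (Nsrc \<alpha>) = D" "Dom (Fsrc (Nsrc \<alpha>)) f = a" "Cod (Fsrc (Nsrc \<alpha>)) f = b"
  shows "Ncmp \<alpha> b \<cdot>\<^bsub>D\<^esub> Amap (Nsrc \<alpha>) f = Amap (Ntgt \<alpha>) f \<cdot>\<^bsub>D\<^esub> Ncmp \<alpha> a"
  using assms by (auto simp: is_nat_trans_def Let_def simp del: nat_transD functorD)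

lemma nat_transI:
  assumes "is_functor (Nsrc \<alpha>)" "is_functor (Ntgt \<alpha>)"
    "Fsrc (Ntgt \<alpha>) = Fsrc (Nsrc \<alpha>)" "Ftgt (Ntgt \<alpha>) = Ftgt (Nsrc \<alpha>)"
    "Ncmp \<alpha> \<in> extensional (Obj (Fsrc (Nsrc \<alpha>)))"
    "\<And>a. a \<in> Obj (Fsrc (Nsrc \<alpha>)) \<Longrightarrow> Ncmp \<alpha> a \<in> Arr (Ftgt (Nsrc \<alpha>))"
    "\<And>a. a \<in> Obj (Fsrc (Nsrc \<alpha>)) \<Longrightarrow> Dom (Ftgt (Nsrc \<alpha>)) (Ncmp \<alpha> a) = Omap (Nsrc \<alpha>) a"
    "\<And>a. a \<in> Obj (Fsrc (Nsrc \<alpha>)) \<Longrightarrow> Cod (Ftgt (Nsrc \<alpha>)) (Ncmp \<alpha> a) = Omap (Ntgt \<alpha>) a"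
    "\<And>f. f \<in> Arr (Fsrc (Nsrc \<alpha>)) \<Longrightarrow>
      Ncmp \<alpha> (Cod (Fsrc (Nsrc \<alpha>)) f) \<cdot>\<^bsub>Ftgt (Nsrc \<alpha>)\<^esub> Amap (Nsrc \<alpha>) f
      = Amap (Ntgt \<alpha>) f \<cdot>\<^bsub>Ftgt (Nsrc \<alpha>)\<^esub> Ncmp \<alpha> (Dom (Fsrc (Nsrc \<alpha>)) f)"
  shows "is_nat_trans \<alpha>"
  using assms unfolding is_nat_trans_def Let_def functors_iff by (simp add: hom_def del: nat_transD functorD)

lemma nat_trans_extensional:
  "is_nat_trans \<alpha> \<Longrightarrow> Ncmp \<alpha> \<in> extensional (Obj (Fsrc (Nsrc \<alpha>)))"
  by (simp add: is_nat_trans_def Let_def del: nat_transD functorD)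

lemma nat_trans_eqI:
  assumes "is_nat_trans \<alpha>" "is_nat_trans \<beta>" "Nsrc \<alpha> = Nsrc \<beta>" "Ntgt \<alpha> = Ntgt \<beta>"
    "\<And>a. a \<in> Obj (Fsrc (Nsrc \<beta>)) \<Longrightarrow> Ncmp \<alpha> a = Ncmp \<beta> a"
  shows "\<alpha> = \<beta>"
proof -
  have "Ncmp \<alpha> = Ncmp \<beta>"
    using nat_trans_extensional[OF assms(1)] nat_trans_extensional[OF assms(2)] assms(3,5)
    by (intro extensionalityI[of _ "Obj (Fsrc (Nsrc \<beta>))"]) auto
  then show ?thesis using assms by (intro ntrans.equality) auto
qed

lemma nat_trans_eq_iff:
  assumes "is_nat_trans \<alpha>" "is_nat_trans \<beta>" "Nsrc \<alpha> = Nsrc \<beta>" "Ntgt \<alpha> = Ntgt \<beta>"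
  shows "\<alpha> = \<beta> \<longleftrightarrow> (\<forall>a \<in> Obj (Fsrc (Nsrc \<beta>)). Ncmp \<alpha> a = Ncmp \<beta> a)"
  using nat_trans_eqI[OF assms] by auto

lemma nat_id_simps [simp]:
  "Nsrc (nat_id H) = H" "Ntgt (nat_id H) = H"
  "a \<in> Obj (Fsrc H) \<Longrightarrow> Ncmp (nat_id H) a = Ide (Ftgt H) (Omap H a)"
  by (simp_all add: nat_id_def)

lemma nat_vcomp_simps [simp]:
  "Nsrc (nat_vcomp \<beta> \<alpha>) = Nsrc \<alpha>" "Ntgt (nat_vcomp \<beta> \<alpha>) = Ntgt \<beta>"
  "a \<in> Obj (Fsrc (Nsrc \<alpha>)) \<Longrightarrow> Ncmp (nat_vcomp \<beta> \<alpha>) a = Ncmp \<beta> a \<cdot>\<^bsub>Ftgt (Nsrc \<alpha>)\<^esub> Ncmp \<alpha> a"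
  by (simp_all add: nat_vcomp_def)

lemma nat_hcomp_simps [simp]:
  "Nsrc (nat_hcomp \<beta> \<alpha>) = functor_comp (Nsrc \<beta>) (Nsrc \<alpha>)"
  "Ntgt (nat_hcomp \<beta> \<alpha>) = functor_comp (Ntgt \<beta>) (Ntgt \<alpha>)"
  "a \<in> Obj (Fsrc (Nsrc \<alpha>)) \<Longrightarrow> Ncmp (nat_hcomp \<beta> \<alpha>) a
    = Ncmp \<beta> (Omap (Ntgt \<alpha>) a) \<cdot>\<^bsub>Ftgt (Nsrc \<beta>)\<^esub> Amap (Nsrc \<beta>) (Ncmp \<alpha> a)"
  by (simp_all add: nat_hcomp_def)

lemma nat_id [simp]: "is_functor H \<Longrightarrow> is_nat_trans (nat_id H)"
  by (intro nat_transI) (auto simp: nat_id_def)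

lemma nat_vcomp [simp]:
  assumes "is_nat_trans \<alpha>" "is_nat_trans \<beta>" "Ntgt \<alpha> = Nsrc \<beta>"
  shows "is_nat_trans (nat_vcomp \<beta> \<alpha>)"
proof (rule nat_transI)
  have 1: "Fsrc (Nsrc \<beta>) = Fsrc (Nsrc \<alpha>)" "Ftgt (Nsrc \<beta>) = Ftgt (Nsrc \<alpha>)"
    using nat_transD(3,4)[OF assms(1)] assms by auto
  fix f assume "f \<in> Arr (Fsrc (Nsrc (nat_vcomp \<beta> \<alpha>)))"
  then have f: "f \<in> Arr (Fsrc (Nsrc \<alpha>))" by simp
  let ?C = "Fsrc (Nsrc \<alpha>)" and ?D = "Ftgt (Nsrc \<alpha>)"
  have "Ncmp \<beta> (Cod ?C f) \<cdot>\<^bsub>?D\<^esub> (Ncmp \<alpha> (Cod ?C f) \<cdot>\<^bsub>?D\<^esub> Amap (Nsrc \<alpha>) f)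
     = Ncmp \<beta> (Cod ?C f) \<cdot>\<^bsub>?D\<^esub> (Amap (Nsrc \<beta>) f \<cdot>\<^bsub>?D\<^esub> Ncmp \<alpha> (Dom ?C f))"
    using nat_trans_natural[OF assms(1) f] assms(3) by simp
  also have "\<dots> = (Ncmp \<beta> (Cod ?C f) \<cdot>\<^bsub>?D\<^esub> Amap (Nsrc \<beta>) f) \<cdot>\<^bsub>?D\<^esub> Ncmp \<alpha> (Dom ?C f)"
    using assms f 1 by (subst cat_assoc) (auto)
  also have "\<dots> = (Amap (Ntgt \<beta>) f \<cdot>\<^bsub>?D\<^esub> Ncmp \<beta> (Dom ?C f)) \<cdot>\<^bsub>?D\<^esub> Ncmp \<alpha> (Dom ?C f)"
    using nat_trans_natural[OF assms(2), of f] f 1 by simp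
  finally show "Ncmp (nat_vcomp \<beta> \<alpha>) (Cod (Fsrc (Nsrc (nat_vcomp \<beta> \<alpha>))) f)
      \<cdot>\<^bsub>Ftgt (Nsrc (nat_vcomp \<beta> \<alpha>))\<^esub> Amap (Nsrc (nat_vcomp \<beta> \<alpha>)) f
      = Amap (Ntgt (nat_vcomp \<beta> \<alpha>)) f \<cdot>\<^bsub>Ftgt (Nsrc (nat_vcomp \<beta> \<alpha>))\<^esub>
        Ncmp (nat_vcomp \<beta> \<alpha>) (Dom (Fsrc (Nsrc (nat_vcomp \<beta> \<alpha>))) f)"
    using f assms 1 by simp
qed (use assms nat_transD(3,4)[OF assms(1)] in \<open>auto simp: nat_vcomp_def\<close>)

lemma nat_hcomp [simp]:
  assumes "is_nat_trans \<alpha>" "is_nat_trans \<beta>" "Ftgt (Nsrc \<alpha>) = Fsrc (Nsrc \<beta>)"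
  shows "is_nat_trans (nat_hcomp \<beta> \<alpha>)"
proof (rule nat_transI)
  let ?C = "Fsrc (Nsrc \<alpha>)" and ?D = "Ftgt (Nsrc \<beta>)" and ?G = "Nsrc \<beta>" and ?F = "Nsrc \<alpha>"
  fix f assume "f \<in> Arr (Fsrc (Nsrc (nat_hcomp \<beta> \<alpha>)))"
  then have f: "f \<in> Arr ?C" by simp
  let ?a = "Dom ?C f" and ?b = "Cod ?C f"
  have "Amap ?G (Ncmp \<alpha> ?b) \<cdot>\<^bsub>?D\<^esub> Amap ?G (Amap ?F f)
    = Amap ?G (Ncmp \<alpha> ?b \<cdot>\<^bsub>Fsrc ?G\<^esub> Amap ?F f)"
    using f assms by (simp)
  also have "\<dots> = Amap ?G (Amap (Ntgt \<alpha>) f) \<cdot>\<^bsub>?D\<^esub> Amap ?G (Ncmp \<alpha> ?a)"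
    using f assms nat_trans_natural[OF assms(1) f] by simp
  finally have 1: "Amap ?G (Ncmp \<alpha> ?b) \<cdot>\<^bsub>?D\<^esub> Amap ?G (Amap ?F f)
    = Amap ?G (Amap (Ntgt \<alpha>) f) \<cdot>\<^bsub>?D\<^esub> Amap ?G (Ncmp \<alpha> ?a)" .
  have 2: "Ncmp \<beta> (Omap (Ntgt \<alpha>) ?b) \<cdot>\<^bsub>?D\<^esub> Amap ?G (Amap (Ntgt \<alpha>) f)
    = Amap (Ntgt \<beta>) (Amap (Ntgt \<alpha>) f) \<cdot>\<^bsub>?D\<^esub> Ncmp \<beta> (Omap (Ntgt \<alpha>) ?a)"
    using f assms by (intro nat_trans_natural) auto
  have "(Ncmp \<beta> (Omap (Ntgt \<alpha>) ?b) \<cdot>\<^bsub>?D\<^esub> Amap ?G (Ncmp \<alpha> ?b)) \<cdot>\<^bsub>?D\<^esub> Amap ?G (Amap ?F f)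
    = Ncmp \<beta> (Omap (Ntgt \<alpha>) ?b) \<cdot>\<^bsub>?D\<^esub> (Amap ?G (Ncmp \<alpha> ?b) \<cdot>\<^bsub>?D\<^esub> Amap ?G (Amap ?F f))"
    using f assms by (subst cat_assoc) auto
  also have "\<dots> = (Ncmp \<beta> (Omap (Ntgt \<alpha>) ?b) \<cdot>\<^bsub>?D\<^esub> Amap ?G (Amap (Ntgt \<alpha>) f)) \<cdot>\<^bsub>?D\<^esub> Amap ?G (Ncmp \<alpha> ?a)"
    unfolding 1 using f assms by (subst cat_assoc) auto
  also have "\<dots> = Amap (Ntgt \<beta>) (Amap (Ntgt \<alpha>) f) \<cdot>\<^bsub>?D\<^esub>
      (Ncmp \<beta> (Omap (Ntgt \<alpha>) ?a) \<cdot>\<^bsub>?D\<^esub> Amap ?G (Ncmp \<alpha> ?a))"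
    unfolding 2 using f assms by (subst cat_assoc) auto
  finally show "Ncmp (nat_hcomp \<beta> \<alpha>) (Cod (Fsrc (Nsrc (nat_hcomp \<beta> \<alpha>))) f)
      \<cdot>\<^bsub>Ftgt (Nsrc (nat_hcomp \<beta> \<alpha>))\<^esub> Amap (Nsrc (nat_hcomp \<beta> \<alpha>)) f
      = Amap (Ntgt (nat_hcomp \<beta> \<alpha>)) f \<cdot>\<^bsub>Ftgt (Nsrc (nat_hcomp \<beta> \<alpha>))\<^esub>
        Ncmp (nat_hcomp \<beta> \<alpha>) (Dom (Fsrc (Nsrc (nat_hcomp \<beta> \<alpha>))) f)"
    using f assms by simp
qed (use assms in \<open>auto simp: nat_hcomp_def\<close>)

lemma functor_cat_simps [simp]:
  "Obj (functor_cat C D) = functors C D" "Dom (functor_cat C D) = Nsrc"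
  "Cod (functor_cat C D) = Ntgt" "Ide (functor_cat C D) = nat_id"
  "Comp (functor_cat C D) = nat_vcomp"
  "\<alpha> \<in> Arr (functor_cat C D) \<longleftrightarrow> is_nat_trans \<alpha> \<and> Fsrc (Nsrc \<alpha>) = C \<and> Ftgt (Nsrc \<alpha>) = D"
  by (auto simp: functor_cat_def functors_iff)

lemma nat_vcomp_assoc:
  assumes "is_nat_trans \<alpha>" "is_nat_trans \<beta>" "is_nat_trans \<gamma>"
    "Ntgt \<alpha> = Nsrc \<beta>" "Ntgt \<beta> = Nsrc \<gamma>"
  shows "nat_vcomp (nat_vcomp \<gamma> \<beta>) \<alpha> = nat_vcomp \<gamma> (nat_vcomp \<beta> \<alpha>)"
  by (rule nat_trans_eqI)
    (use assms nat_transD(3,4)[OF assms(1)] nat_transD(3,4)[OF assms(2)] in auto)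

lemma nat_vcomp_unit:
  assumes "is_nat_trans \<alpha>"
  shows "nat_vcomp (nat_id (Ntgt \<alpha>)) \<alpha> = \<alpha>" "nat_vcomp \<alpha> (nat_id (Nsrc \<alpha>)) = \<alpha>"
  by (rule nat_trans_eqI; use assms in auto)+

lemma functor_cat_category:
  assumes "category C" "category D"
  shows "category (functor_cat C D)"
  by (unfold_locales) (auto simp: functors_iff hom_def nat_vcomp_assoc nat_vcomp_unit)

text \<open>The inverses of the components of a natural transformation are natural again.\<close>
lemma functor_cat_invertible_iff:
  assumes \<alpha>: "is_nat_trans \<alpha>" and C: "Fsrc (Nsrc \<alpha>) = C" and D: "Ftgt (Nsrc \<alpha>) = D"
  shows "invertible_arr (functor_cat C D) \<alpha> \<longleftrightarrow> (\<forall>a \<in> Obj C. invertible_arr D (Ncmp \<alpha> a))"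
proof
  assume inv: "invertible_arr (functor_cat C D) \<alpha>"
  let ?\<beta> = "Inv (functor_cat C D) \<alpha>"
  have b: "is_nat_trans ?\<beta>" "Nsrc ?\<beta> = Ntgt \<alpha>" "Ntgt ?\<beta> = Nsrc \<alpha>"
    "nat_vcomp ?\<beta> \<alpha> = nat_id (Nsrc \<alpha>)" "nat_vcomp \<alpha> ?\<beta> = nat_id (Ntgt \<alpha>)"
    using Inv_simps[OF inv] by simp_all
  show "\<forall>a \<in> Obj C. invertible_arr D (Ncmp \<alpha> a)"
  proof
    fix a assume a: "a \<in> Obj C"
    have "Ncmp ?\<beta> a \<cdot>\<^bsub>D\<^esub> Ncmp \<alpha> a = Ide D (Omap (Nsrc \<alpha>) a)"
      using arg_cong[OF b(4), of "\<lambda>\<gamma>. Ncmp \<gamma> a"] a C D by simp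
    moreover have "Ncmp \<alpha> a \<cdot>\<^bsub>D\<^esub> Ncmp ?\<beta> a = Ide D (Omap (Ntgt \<alpha>) a)"
      using arg_cong[OF b(5), of "\<lambda>\<gamma>. Ncmp \<gamma> a"] a C D \<alpha> b(1-3) by simp
    moreover have "category D" using functorD(2)[of "Nsrc \<alpha>"] \<alpha> D by simp
    ultimately show "invertible_arr D (Ncmp \<alpha> a)"
      using a C D \<alpha> b by (intro invertible_arrI[of _ _ "Ncmp ?\<beta> a"]) simp_all
  qed
next
  assume inv: "\<forall>a \<in> Obj C. invertible_arr D (Ncmp \<alpha> a)"
  have cat: "category C" "category D" using functorD(1,2)[of "Nsrc \<alpha>"] \<alpha> C D by simp_all
  define \<beta> where "\<beta> = \<lparr>Nsrc = Ntgt \<alpha>, Ntgt = Nsrc \<alpha>, Ncmp = (\<lambda>a\<in>Obj C. Inv D (Ncmp \<alpha> a))\<rparr>"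
  have b: "is_nat_trans \<beta>"
  proof (rule nat_transI)
    fix f assume "f \<in> Arr (Fsrc (Nsrc \<beta>))"
    then have f: "f \<in> Arr C" using \<alpha> C by (simp add: \<beta>_def)
    let ?i = "\<lambda>a. Inv D (Ncmp \<alpha> a)"
    have "?i (Cod C f) \<cdot>\<^bsub>D\<^esub> Amap (Ntgt \<alpha>) f
      = ?i (Cod C f) \<cdot>\<^bsub>D\<^esub> ((Amap (Ntgt \<alpha>) f \<cdot>\<^bsub>D\<^esub> Ncmp \<alpha> (Dom C f)) \<cdot>\<^bsub>D\<^esub> ?i (Dom C f))"
      using f C D \<alpha> inv cat by simp
    also have "\<dots> = Amap (Nsrc \<alpha>) f \<cdot>\<^bsub>D\<^esub> ?i (Dom C f)"
      using f C D \<alpha> inv cat nat_trans_natural[OF \<alpha>, of f, symmetric] by simp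
    finally show "Ncmp \<beta> (Cod (Fsrc (Nsrc \<beta>)) f) \<cdot>\<^bsub>Ftgt (Nsrc \<beta>)\<^esub> Amap (Nsrc \<beta>) f
      = Amap (Ntgt \<beta>) f \<cdot>\<^bsub>Ftgt (Nsrc \<beta>)\<^esub> Ncmp \<beta> (Dom (Fsrc (Nsrc \<beta>)) f)"
      using f C D \<alpha> cat by (simp add: \<beta>_def)
  qed (use \<alpha> C D inv in \<open>auto simp: \<beta>_def\<close>)
  show "invertible_arr (functor_cat C D) \<alpha>"
  proof (rule invertible_arrI[of _ _ \<beta>])
    show "Comp (functor_cat C D) \<beta> \<alpha> = Ide (functor_cat C D) (Dom (functor_cat C D) \<alpha>)"
      unfolding functor_cat_simps
      by (rule nat_trans_eqI) (use \<alpha> b C D inv in \<open>auto simp: \<beta>_def\<close>)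
    show "Comp (functor_cat C D) \<alpha> \<beta> = Ide (functor_cat C D) (Cod (functor_cat C D) \<alpha>)"
      unfolding functor_cat_simps
      by (rule nat_trans_eqI) (use \<alpha> b C D inv in \<open>auto simp: \<beta>_def\<close>)
  qed (use \<alpha> b C D in \<open>auto simp: functor_cat_category \<beta>_def\<close>)
qed

section \<open>Diagrams of categories over a pair\<close>

locale sigma_diagram = sigma_pair A \<Sigma> + two_functor A CAT F
  for A :: "('a, 'f, 'c) two_cat" and \<Sigma> :: "'f set" and F :: "('a, 'f, 'c, 'o, 'm) cat_valued"
begin

abbreviation "U \<equiv> Und A"

abbreviation "V \<equiv> Vert A"

lemma two_cat_simps [simp]:
  "category U" "category V" "Obj V = Arr U"
  by (simp_all add: category_Und category_Vert Obj_Vert)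

lemma cell_boundary [simp]:
  assumes "\<alpha> \<in> Arr V"
  shows "Dom U (Cod V \<alpha>) = Dom U (Dom V \<alpha>)" "Cod U (Cod V \<alpha>) = Cod U (Dom V \<alpha>)"
  using cell_parallel[of \<alpha> "Dom V \<alpha>" "Cod V \<alpha>"] assms by (auto simp: hom_def)

lemma cell_arrows [simp]:
  assumes "\<alpha> \<in> Arr V"
  shows "Dom V \<alpha> \<in> Arr U" "Cod V \<alpha> \<in> Arr U"
  using cat_Obj[of V \<alpha>] assms by auto

lemma HComp_simps [simp]:
  assumes "\<alpha> \<in> Arr V" "\<beta> \<in> Arr V" "Cod U (Dom V \<alpha>) = Dom U (Dom V \<beta>)"
  shows "HComp A \<beta> \<alpha> \<in> Arr V"
    "Dom V (HComp A \<beta> \<alpha>) = Dom V \<beta> \<cdot>\<^bsub>U\<^esub> Dom V \<alpha>"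
    "Cod V (HComp A \<beta> \<alpha>) = Cod V \<beta> \<cdot>\<^bsub>U\<^esub> Cod V \<alpha>"
  using HComp_in[of \<alpha> "Dom V \<alpha>" "Cod V \<alpha>" \<beta> "Dom V \<beta>" "Cod V \<beta>"] assms by (auto simp: hom_def)

abbreviation whisker_l (infixr "\<triangleright>" 60) where "h \<triangleright> \<alpha> \<equiv> HComp A (Ide V h) \<alpha>"

abbreviation whisker_r (infixl "\<triangleleft>" 60) where "\<alpha> \<triangleleft> f \<equiv> HComp A \<alpha> (Ide V f)"

lemma whisker_l_vcomp:
  assumes "h \<in> Arr U" "\<alpha> \<in> Arr V" "\<beta> \<in> Arr V" "Cod V \<alpha> = Dom V \<beta>" "Cod U (Dom V \<alpha>) = Dom U h"
  shows "h \<triangleright> (\<beta> \<cdot>\<^bsub>V\<^esub> \<alpha>) = (h \<triangleright> \<beta>) \<cdot>\<^bsub>V\<^esub> (h \<triangleright> \<alpha>)"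
  using interchange[of \<alpha> "Dom V \<alpha>" "Dom V \<beta>" \<beta> "Cod V \<beta>" "Ide V h" h h "Ide V h" h] assms
  by (simp add: hom_def)

lemma whisker_r_vcomp:
  assumes "h \<in> Arr U" "\<alpha> \<in> Arr V" "\<beta> \<in> Arr V" "Cod V \<alpha> = Dom V \<beta>" "Dom U (Dom V \<alpha>) = Cod U h"
  shows "(\<beta> \<cdot>\<^bsub>V\<^esub> \<alpha>) \<triangleleft> h = (\<beta> \<triangleleft> h) \<cdot>\<^bsub>V\<^esub> (\<alpha> \<triangleleft> h)"
  using interchange[of "Ide V h" h h "Ide V h" h \<alpha> "Dom V \<alpha>" "Dom V \<beta>" \<beta> "Cod V \<beta>"] assms
  by (simp add: hom_def)

lemma whisker_Ide [simp]:
  assumes "h \<in> Arr U" "f \<in> Arr U" "Cod U f = Dom U h"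
  shows "h \<triangleright> Ide V f = Ide V (h \<cdot>\<^bsub>U\<^esub> f)"
  using HComp_Ide[of f "Dom U f" "Cod U f" h "Cod U h"] assms by (simp add: hom_def)

lemma invertible_whisker_l:
  assumes "h \<in> Arr U" "invertible_arr V \<alpha>" "Cod U (Dom V \<alpha>) = Dom U h"
  shows "invertible_arr V (h \<triangleright> \<alpha>)"
  using assms invertible_in_Arr[OF assms(2)]
  by (intro invertible_arrI[of _ _ "h \<triangleright> Inv V \<alpha>"]) (simp_all flip: whisker_l_vcomp)

lemma invertible_whisker_r:
  assumes "h \<in> Arr U" "invertible_arr V \<alpha>" "Dom U (Dom V \<alpha>) = Cod U h"
  shows "invertible_arr V (\<alpha> \<triangleleft> h)"
  using assms invertible_in_Arr[OF assms(2)]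
  by (intro invertible_arrI[of _ _ "Inv V \<alpha> \<triangleleft> h"]) (simp_all flip: whisker_r_vcomp)

lemma Sigma_in_Arr [simp]: "f \<in> \<Sigma> \<Longrightarrow> f \<in> Arr U"
  using Sigma_Arr by auto

lemma Sigma_closed [simp]:
  "a \<in> Obj U \<Longrightarrow> Ide U a \<in> \<Sigma>"
  "\<lbrakk>f \<in> \<Sigma>; g \<in> \<Sigma>; Cod U f = Dom U g\<rbrakk> \<Longrightarrow> g \<cdot>\<^bsub>U\<^esub> f \<in> \<Sigma>"
  by (simp_all add: Sigma_Ide Sigma_Comp)

text \<open>The 2-functor \<open>F\<close> and the compositions of \<open>CAT\<close> are unfolded into \<open>functor_comp\<close>, \<open>nat_vcomp\<close> and
\<open>nat_hcomp\<close>, whose component rules then reduce every expression over a composite of \<open>A\<close> to its parts.\<close>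

lemma F0_category [simp]: "a \<in> Obj U \<Longrightarrow> category (F0 F a)"
  using F0_in[of a] by (simp add: CAT_def)

lemma F1_simps [simp]:
  assumes "f \<in> Arr U"
  shows "is_functor (F1 F f)" "Fsrc (F1 F f) = F0 F (Dom U f)" "Ftgt (F1 F f) = F0 F (Cod U f)"
  using F1_in[of f "Dom U f" "Cod U f"] assms by (simp_all add: CAT_def hom_def)

lemma F1_of_Ide [simp]: "a \<in> Obj U \<Longrightarrow> F1 F (Ide U a) = functor_id (F0 F a)"
  using F1_Ide[of a] by (simp add: CAT_def)

lemma F1_of_Comp [simp]:
  "\<lbrakk>f \<in> Arr U; g \<in> Arr U; Cod U f = Dom U g\<rbrakk> \<Longrightarrow> F1 F (g \<cdot>\<^bsub>U\<^esub> f) = functor_comp (F1 F g) (F1 F f)"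
  using F1_Comp[of f "Dom U f" "Cod U f" g "Cod U g"] by (simp add: CAT_def hom_def)

lemma F2_simps [simp]:
  assumes "\<alpha> \<in> Arr V"
  shows "is_nat_trans (F2 F \<alpha>)" "Nsrc (F2 F \<alpha>) = F1 F (Dom V \<alpha>)" "Ntgt (F2 F \<alpha>) = F1 F (Cod V \<alpha>)"
  using F2_in[of \<alpha> "Dom V \<alpha>" "Cod V \<alpha>"] assms by (simp_all add: CAT_def hom_def)

lemma F2_of_Ide [simp]: "f \<in> Arr U \<Longrightarrow> F2 F (Ide V f) = nat_id (F1 F f)"
  using F2_Ide[of f] by (simp add: CAT_def)

lemma F2_of_Comp [simp]:
  "\<lbrakk>\<alpha> \<in> Arr V; \<beta> \<in> Arr V; Cod V \<alpha> = Dom V \<beta>\<rbrakk> \<Longrightarrow> F2 F (\<beta> \<cdot>\<^bsub>V\<^esub> \<alpha>) = nat_vcomp (F2 F \<beta>) (F2 F \<alpha>)"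
  using F2_Comp[of \<alpha> "Dom V \<alpha>" "Cod V \<alpha>" \<beta> "Cod V \<beta>"] by (simp add: CAT_def hom_def)

lemma F2_of_HComp [simp]:
  "\<lbrakk>\<alpha> \<in> Arr V; \<beta> \<in> Arr V; Cod U (Dom V \<alpha>) = Dom U (Dom V \<beta>)\<rbrakk> \<Longrightarrow>
    F2 F (HComp A \<beta> \<alpha>) = nat_hcomp (F2 F \<beta>) (F2 F \<alpha>)"
  using F2_HComp[of \<alpha> "Dom V \<alpha>" "Cod V \<alpha>" \<beta> "Dom V \<beta>" "Cod V \<beta>"] by (simp add: CAT_def hom_def)

text \<open>The suffixes \<open>o\<close>, \<open>a\<close>, \<open>c\<close> stand for objects, arrows and components of 2-cells.\<close>

abbreviation Fo where "Fo w x \<equiv> Omap (F1 F w) x"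

abbreviation Fa where "Fa w \<xi> \<equiv> Amap (F1 F w) \<xi>"

abbreviation Fc where "Fc \<alpha> x \<equiv> Ncmp (F2 F \<alpha>) x"

lemma Fc_natural:
  assumes "\<alpha> \<in> Arr V" "Dom U (Dom V \<alpha>) = a" "Cod U (Dom V \<alpha>) = b" "\<xi> \<in> Arr (F0 F a)"
    "Dom (F0 F a) \<xi> = x" "Cod (F0 F a) \<xi> = y"
  shows "Fc \<alpha> y \<cdot>\<^bsub>F0 F b\<^esub> Fa (Dom V \<alpha>) \<xi> = Fa (Cod V \<alpha>) \<xi> \<cdot>\<^bsub>F0 F b\<^esub> Fc \<alpha> x"
  using nat_trans_natural[of "F2 F \<alpha>" \<xi> "F0 F b" x y] assms by simp

lemma Fc_natural_chain:
  assumes "\<alpha> \<in> Arr V" "Dom U (Dom V \<alpha>) = a" "Cod U (Dom V \<alpha>) = b" "\<xi> \<in> Arr (F0 F a)"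
    "Dom (F0 F a) \<xi> = x" "Cod (F0 F a) \<xi> = y" "\<zeta> \<in> Arr (F0 F b)" "Cod (F0 F b) \<zeta> = Fo (Dom V \<alpha>) x"
  shows "Fc \<alpha> y \<cdot>\<^bsub>F0 F b\<^esub> (Fa (Dom V \<alpha>) \<xi> \<cdot>\<^bsub>F0 F b\<^esub> \<zeta>) = Fa (Cod V \<alpha>) \<xi> \<cdot>\<^bsub>F0 F b\<^esub> (Fc \<alpha> x \<cdot>\<^bsub>F0 F b\<^esub> \<zeta>)"
proof -
  have [simp]: "a \<in> Obj U" "b \<in> Obj U" using assms by auto
  have [simp]: "x \<in> Obj (F0 F a)" "y \<in> Obj (F0 F a)"
    using cat_Obj[of "F0 F a" \<xi>] assms by auto
  have "Fc \<alpha> y \<cdot>\<^bsub>F0 F b\<^esub> (Fa (Dom V \<alpha>) \<xi> \<cdot>\<^bsub>F0 F b\<^esub> \<zeta>) = (Fc \<alpha> y \<cdot>\<^bsub>F0 F b\<^esub> Fa (Dom V \<alpha>) \<xi>) \<cdot>\<^bsub>F0 F b\<^esub> \<zeta>"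
    using assms by simp
  also have "\<dots> = (Fa (Cod V \<alpha>) \<xi> \<cdot>\<^bsub>F0 F b\<^esub> Fc \<alpha> x) \<cdot>\<^bsub>F0 F b\<^esub> \<zeta>"
    using Fc_natural[OF assms(1-6)] by (simp del: cat_assoc)
  also have "\<dots> = Fa (Cod V \<alpha>) \<xi> \<cdot>\<^bsub>F0 F b\<^esub> (Fc \<alpha> x \<cdot>\<^bsub>F0 F b\<^esub> \<zeta>)"
    using assms by simp
  finally show ?thesis .
qed

lemma Fc_Inv:
  assumes "invertible_arr V \<alpha>" "w \<in> Arr U" "Dom U w = Cod U (Dom V \<alpha>)"
    "x \<in> Obj (F0 F (Dom U (Dom V \<alpha>)))"
  shows "Fa w (Fc \<alpha> x) \<cdot>\<^bsub>F0 F (Cod U w)\<^esub> Fa w (Fc (Inv V \<alpha>) x)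
    = Ide (F0 F (Cod U w)) (Fo w (Fo (Cod V \<alpha>) x))"
proof -
  have [simp]: "\<alpha> \<in> Arr V" using assms(1) by (rule invertible_in_Arr)
  have "Fc \<alpha> x \<cdot>\<^bsub>F0 F (Dom U w)\<^esub> Fc (Inv V \<alpha>) x = Fc (\<alpha> \<cdot>\<^bsub>V\<^esub> Inv V \<alpha>) x"
    using assms by (simp del: Inv_simps(5))
  also have "\<dots> = Ide (F0 F (Dom U w)) (Fo (Cod V \<alpha>) x)" using assms by simp
  finally have "Fa w (Fc \<alpha> x \<cdot>\<^bsub>F0 F (Dom U w)\<^esub> Fc (Inv V \<alpha>) x) = Fa w (Ide (F0 F (Dom U w)) (Fo (Cod V \<alpha>) x))"
    by simp
  then show ?thesis using assms by simp
qed

end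

section \<open>Refinement and homotopy of premorphisms\<close>

context sigma_diagram
begin

text \<open>The homotopy relation compares premorphisms after they have both been transported to a third one.
Here one such transport is isolated. It has a direction, and whiskering shows that it is reflexive and
transitive; thereby the transitivity of homotopy becomes a question of confluence. The third arrow of
the result is arbitrary, so that a refinement may be as small as an isomorphism of the first arrow or
a single 2-cell.\<close>
definition refines :: "'o \<times> 'a \<Rightarrow> 'o \<times> 'a \<Rightarrow> 'f \<times> 'm \<times> 'f \<Rightarrow> 'f \<times> 'm \<times> 'f \<Rightarrow> bool"
  where "refines = (\<lambda>(x, a) (y, b) (u, \<xi>, v) (u', \<xi>', v').
    \<exists>w \<in> hom U (Cod U u) (Cod U u'). \<exists>\<alpha> \<in> hom V u' (w \<cdot>\<^bsub>U\<^esub> u). \<exists>\<beta> \<in> hom V (w \<cdot>\<^bsub>U\<^esub> v) v'.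
      w \<in> \<Sigma> \<and> invertible_arr V \<alpha> \<and>
      \<xi>' = Fc \<beta> y \<cdot>\<^bsub>F0 F (Cod U u')\<^esub> (Fa w \<xi> \<cdot>\<^bsub>F0 F (Cod U u')\<^esub> Fc \<alpha> x))"

definition Ob where "Ob = {(x, a). a \<in> Obj U \<and> x \<in> Obj (F0 F a)}"

abbreviation "Pre \<equiv> premorphisms A \<Sigma> F"

lemma Ob_iff [simp]: "(x, a) \<in> Ob \<longleftrightarrow> a \<in> Obj U \<and> x \<in> Obj (F0 F a)"
  by (simp add: Ob_def)

lemma Pre_iff:
  "(u, \<xi>, v) \<in> Pre (x, a) (y, b) \<longleftrightarrow> u \<in> \<Sigma> \<and> Dom U u = a \<and> v \<in> Arr U \<and> Dom U v = b \<and>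
    Cod U v = Cod U u \<and> \<xi> \<in> Arr (F0 F (Cod U u)) \<and> Dom (F0 F (Cod U u)) \<xi> = Fo u x \<and>
    Cod (F0 F (Cod U u)) \<xi> = Fo v y"
  by (auto simp: premorphisms_def hom_def)

lemma refinesI:
  assumes "w \<in> \<Sigma>" "Dom U w = Cod U u" "Cod U w = Cod U u'"
    "\<alpha> \<in> Arr V" "Dom V \<alpha> = u'" "Cod V \<alpha> = w \<cdot>\<^bsub>U\<^esub> u"
    "\<beta> \<in> Arr V" "Dom V \<beta> = w \<cdot>\<^bsub>U\<^esub> v" "Cod V \<beta> = v'"
    "invertible_arr V \<alpha>"
    "\<xi>' = Fc \<beta> y \<cdot>\<^bsub>F0 F (Cod U u')\<^esub> (Fa w \<xi> \<cdot>\<^bsub>F0 F (Cod U u')\<^esub> Fc \<alpha> x)"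
  shows "refines (x, a) (y, b) (u, \<xi>, v) (u', \<xi>', v')"
  unfolding refines_def prod.case
  by (rule bexI[of _ w], rule bexI[of _ \<alpha>], rule bexI[of _ \<beta>]) (use assms in \<open>simp_all add: hom_def\<close>)

lemma refinesE:
  assumes "refines (x, a) (y, b) (u, \<xi>, v) (u', \<xi>', v')"
  obtains w \<alpha> \<beta> where "w \<in> \<Sigma>" "Dom U w = Cod U u" "Cod U w = Cod U u'"
    "\<alpha> \<in> Arr V" "Dom V \<alpha> = u'" "Cod V \<alpha> = w \<cdot>\<^bsub>U\<^esub> u"
    "\<beta> \<in> Arr V" "Dom V \<beta> = w \<cdot>\<^bsub>U\<^esub> v" "Cod V \<beta> = v'"
    "invertible_arr V \<alpha>"
    "\<xi>' = Fc \<beta> y \<cdot>\<^bsub>F0 F (Cod U u')\<^esub> (Fa w \<xi> \<cdot>\<^bsub>F0 F (Cod U u')\<^esub> Fc \<alpha> x)"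
  using assms unfolding refines_def prod.case hom_def by blast

lemma refines_refl:
  assumes "(u, \<xi>, v) \<in> Pre (x, a) (y, b)" "(x, a) \<in> Ob" "(y, b) \<in> Ob"
  shows "refines (x, a) (y, b) (u, \<xi>, v) (u, \<xi>, v)"
  by (rule refinesI[of "Ide U (Cod U u)" _ _ "Ide V u" "Ide V v"])
    (use assms in \<open>auto simp: Pre_iff invertible_Ide\<close>)

lemma refines_trans:
  assumes "refines X Y p q" "refines X Y q r" "p \<in> Pre X Y" "q \<in> Pre X Y" "X \<in> Ob" "Y \<in> Ob"
  shows "refines X Y p r"
proof -
  obtain x a y b u \<xi> v u' \<xi>' v' u'' \<xi>'' v'' where
    eq [simp]: "X = (x, a)" "Y = (y, b)" "p = (u, \<xi>, v)" "q = (u', \<xi>', v')" "r = (u'', \<xi>'', v'')"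
    by (metis prod.exhaust)
  have pr: "u \<in> \<Sigma>" "Dom U u = a" "v \<in> Arr U" "Dom U v = b" "Cod U v = Cod U u"
     "\<xi> \<in> Arr (F0 F (Cod U u))" "Dom (F0 F (Cod U u)) \<xi> = Fo u x" "Cod (F0 F (Cod U u)) \<xi> = Fo v y"
     "u' \<in> \<Sigma>" "Dom U u' = a" "v' \<in> Arr U" "Dom U v' = b" "Cod U v' = Cod U u'"
     "a \<in> Obj U" "x \<in> Obj (F0 F a)" "b \<in> Obj U" "y \<in> Obj (F0 F b)"
    using assms by (simp_all add: Pre_iff)
  obtain w \<alpha> \<beta> where w: "w \<in> \<Sigma>" "Dom U w = Cod U u" "Cod U w = Cod U u'"
    and \<alpha>: "\<alpha> \<in> Arr V" "Dom V \<alpha> = u'" "Cod V \<alpha> = w \<cdot>\<^bsub>U\<^esub> u" "invertible_arr V \<alpha>"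
    and \<beta>: "\<beta> \<in> Arr V" "Dom V \<beta> = w \<cdot>\<^bsub>U\<^esub> v" "Cod V \<beta> = v'"
    and \<xi>': "\<xi>' = Fc \<beta> y \<cdot>\<^bsub>F0 F (Cod U u')\<^esub> (Fa w \<xi> \<cdot>\<^bsub>F0 F (Cod U u')\<^esub> Fc \<alpha> x)"
    using assms(1) by (auto elim: refinesE)
  obtain w' \<alpha>' \<beta>' where w': "w' \<in> \<Sigma>" "Dom U w' = Cod U u'" "Cod U w' = Cod U u''"
    and \<alpha>': "\<alpha>' \<in> Arr V" "Dom V \<alpha>' = u''" "Cod V \<alpha>' = w' \<cdot>\<^bsub>U\<^esub> u'" "invertible_arr V \<alpha>'"
    and \<beta>': "\<beta>' \<in> Arr V" "Dom V \<beta>' = w' \<cdot>\<^bsub>U\<^esub> v'" "Cod V \<beta>' = v''"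
    and \<xi>'': "\<xi>'' = Fc \<beta>' y \<cdot>\<^bsub>F0 F (Cod U u'')\<^esub> (Fa w' \<xi>' \<cdot>\<^bsub>F0 F (Cod U u'')\<^esub> Fc \<alpha>' x)"
    using assms(2) by (auto elim: refinesE)
  have d: "u'' \<in> Arr U" "Dom U u'' = a" "v'' \<in> Arr U" "Dom U v'' = b" "Cod U v'' = Cod U u''"
    using cell_arrows[OF \<alpha>'(1)] cell_boundary[OF \<alpha>'(1)] cell_arrows[OF \<beta>'(1)] cell_boundary[OF \<beta>'(1)]
      \<alpha>' \<beta>' w' pr by simp_all
  show ?thesis unfolding eq
    by (rule refinesI[of "w' \<cdot>\<^bsub>U\<^esub> w" _ _ "(w' \<triangleright> \<alpha>) \<cdot>\<^bsub>V\<^esub> \<alpha>'" "\<beta>' \<cdot>\<^bsub>V\<^esub> (w' \<triangleright> \<beta>)"])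
     (use pr d w w' \<alpha> \<alpha>' \<beta> \<beta>' \<xi>' \<xi>'' in \<open>simp_all add: invertible_Comp invertible_whisker_l\<close>)
qed

lemma homotopical_iff:
  assumes "p \<in> Pre X Y" "q \<in> Pre X Y" "X \<in> Ob" "Y \<in> Ob"
  shows "homotopical A \<Sigma> F X Y p q \<longleftrightarrow>
    (\<exists>r \<in> Pre X Y. snd (snd r) \<in> \<Sigma> \<and> refines X Y p r \<and> refines X Y q r)"
    (is "?L \<longleftrightarrow> ?R")
proof -
  obtain x a y b u1 \<xi>1 v1 u2 \<xi>2 v2 where
    eq [simp]: "X = (x, a)" "Y = (y, b)" "p = (u1, \<xi>1, v1)" "q = (u2, \<xi>2, v2)"
    by (metis prod.exhaust)
  have pr: "u1 \<in> \<Sigma>" "Dom U u1 = a" "v1 \<in> Arr U" "Dom U v1 = b" "Cod U v1 = Cod U u1"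
     "\<xi>1 \<in> Arr (F0 F (Cod U u1))" "Dom (F0 F (Cod U u1)) \<xi>1 = Fo u1 x" "Cod (F0 F (Cod U u1)) \<xi>1 = Fo v1 y"
     "u2 \<in> \<Sigma>" "Dom U u2 = a" "v2 \<in> Arr U" "Dom U v2 = b" "Cod U v2 = Cod U u2"
     "a \<in> Obj U" "x \<in> Obj (F0 F a)" "b \<in> Obj U" "y \<in> Obj (F0 F b)"
    using assms by (simp_all add: Pre_iff)
  show ?thesis
  proof
    assume ?L
    then obtain d wa wb w1 w2 \<alpha>1 \<alpha>2 \<beta>1 \<beta>2 where
      w: "d \<in> Obj U" "wa \<in> hom U a d" "wb \<in> hom U b d" "w1 \<in> hom U (Cod U u1) d" "w2 \<in> hom U (Cod U u2) d"
      "{wa, wb, w1, w2} \<subseteq> \<Sigma>"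
      and c: "\<alpha>1 \<in> hom V wa (w1 \<cdot>\<^bsub>U\<^esub> u1)" "\<alpha>2 \<in> hom V wa (w2 \<cdot>\<^bsub>U\<^esub> u2)"
        "\<beta>1 \<in> hom V (w1 \<cdot>\<^bsub>U\<^esub> v1) wb" "\<beta>2 \<in> hom V (w2 \<cdot>\<^bsub>U\<^esub> v2) wb"
        "invertible_arr V \<alpha>1" "invertible_arr V \<alpha>2"
      and e: "Fc \<beta>1 y \<cdot>\<^bsub>F0 F d\<^esub> (Fa w1 \<xi>1 \<cdot>\<^bsub>F0 F d\<^esub> Fc \<alpha>1 x) =
        Fc \<beta>2 y \<cdot>\<^bsub>F0 F d\<^esub> (Fa w2 \<xi>2 \<cdot>\<^bsub>F0 F d\<^esub> Fc \<alpha>2 x)"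
      unfolding eq homotopical_def prod.case by (elim bexE conjE) (rule that; assumption)
    let ?r = "(wa, Fc \<beta>1 y \<cdot>\<^bsub>F0 F d\<^esub> (Fa w1 \<xi>1 \<cdot>\<^bsub>F0 F d\<^esub> Fc \<alpha>1 x), wb)"
    show ?R
    proof (intro bexI[of _ ?r] conjI)
      show "?r \<in> Pre X Y" "snd (snd ?r) \<in> \<Sigma>"
        using pr w c by (simp_all add: Pre_iff hom_def)
      show "refines X Y p ?r" unfolding eq
        by (rule refinesI[of w1 _ _ \<alpha>1 \<beta>1]) (use pr w c in \<open>simp_all add: hom_def\<close>)
      show "refines X Y q ?r" unfolding eq e
        by (rule refinesI[of w2 _ _ \<alpha>2 \<beta>2]) (use pr w c in \<open>simp_all add: hom_def\<close>)
    qed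
  next
    assume ?R
    then obtain u \<xi> v where r: "(u, \<xi>, v) \<in> Pre X Y" "v \<in> \<Sigma>" "refines X Y p (u, \<xi>, v)" "refines X Y q (u, \<xi>, v)"
      by auto
    obtain w1 \<alpha>1 \<beta>1 where w1: "w1 \<in> \<Sigma>" "Dom U w1 = Cod U u1" "Cod U w1 = Cod U u"
      and \<alpha>1: "\<alpha>1 \<in> Arr V" "Dom V \<alpha>1 = u" "Cod V \<alpha>1 = w1 \<cdot>\<^bsub>U\<^esub> u1" "invertible_arr V \<alpha>1"
      and \<beta>1: "\<beta>1 \<in> Arr V" "Dom V \<beta>1 = w1 \<cdot>\<^bsub>U\<^esub> v1" "Cod V \<beta>1 = v"
      and \<xi>1: "\<xi> = Fc \<beta>1 y \<cdot>\<^bsub>F0 F (Cod U u)\<^esub> (Fa w1 \<xi>1 \<cdot>\<^bsub>F0 F (Cod U u)\<^esub> Fc \<alpha>1 x)"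
      using r(3) by (auto elim: refinesE)
    obtain w2 \<alpha>2 \<beta>2 where w2: "w2 \<in> \<Sigma>" "Dom U w2 = Cod U u2" "Cod U w2 = Cod U u"
      and \<alpha>2: "\<alpha>2 \<in> Arr V" "Dom V \<alpha>2 = u" "Cod V \<alpha>2 = w2 \<cdot>\<^bsub>U\<^esub> u2" "invertible_arr V \<alpha>2"
      and \<beta>2: "\<beta>2 \<in> Arr V" "Dom V \<beta>2 = w2 \<cdot>\<^bsub>U\<^esub> v2" "Cod V \<beta>2 = v"
      and \<xi>2: "\<xi> = Fc \<beta>2 y \<cdot>\<^bsub>F0 F (Cod U u)\<^esub> (Fa w2 \<xi>2 \<cdot>\<^bsub>F0 F (Cod U u)\<^esub> Fc \<alpha>2 x)"
      using r(4) by (auto elim: refinesE)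
    show ?L
      unfolding eq homotopical_def prod.case
      apply (rule bexI[of _ "Cod U u"])
       apply (rule bexI[of _ u], rule bexI[of _ v], rule bexI[of _ w1], rule bexI[of _ w2])
           apply (rule bexI[of _ \<alpha>1], rule bexI[of _ \<alpha>2], rule bexI[of _ \<beta>1], rule bexI[of _ \<beta>2])
      using r(1,2) w1 w2 \<alpha>1 \<alpha>2 \<beta>1 \<beta>2 \<xi>1 \<xi>2 by (auto simp: Pre_iff hom_def)
  qed
qed

abbreviation "hrel \<equiv> homotopy_rel A \<Sigma> F"

abbreviation "cls \<equiv> homotopy_class A \<Sigma> F"

end

locale filtered_diagram = sigma_diagram A \<Sigma> F + sigma_filtered A \<Sigma>
  for A :: "('a, 'f, 'c) two_cat" and \<Sigma> :: "'f set" and F :: "('a, 'f, 'c, 'o, 'm) cat_valued"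
begin

text \<open>The first two axioms combine to an Ore condition up to a 2-cell.\<close>
lemma sigma_square:
  assumes "v \<in> Arr U" "u \<in> \<Sigma>" "Dom U v = Dom U u"
  obtains d r s \<gamma> where "r \<in> \<Sigma>" "Dom U r = Cod U v" "Cod U r = d" "d \<in> Obj U"
    "s \<in> \<Sigma>" "Dom U s = Cod U u" "Cod U s = d"
    "\<gamma> \<in> Arr V" "Dom V \<gamma> = r \<cdot>\<^bsub>U\<^esub> v" "Cod V \<gamma> = s \<cdot>\<^bsub>U\<^esub> u" "v \<in> \<Sigma> \<longrightarrow> invertible_arr V \<gamma>"
proof -
  obtain e p q where p: "p \<in> Arr U" "Dom U p = Cod U v" "Cod U p = e" "p \<in> \<Sigma>"
    and q: "q \<in> Arr U" "Dom U q = Cod U u" "Cod U q = e" "q \<in> \<Sigma>"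
    using sigmaF0[of "Cod U v" "Cod U u"] assms by (auto simp: hom_iff)
  obtain d h \<gamma> where h: "h \<in> Arr U" "Dom U h = e" "Cod U h = d" "h \<in> \<Sigma>"
    and \<gamma>: "\<gamma> \<in> hom V (h \<cdot>\<^bsub>U\<^esub> (p \<cdot>\<^bsub>U\<^esub> v)) (h \<cdot>\<^bsub>U\<^esub> (q \<cdot>\<^bsub>U\<^esub> u))"
      "p \<cdot>\<^bsub>U\<^esub> v \<in> \<Sigma> \<longrightarrow> invertible_arr V \<gamma>"
    using sigmaF1[of "p \<cdot>\<^bsub>U\<^esub> v" "Dom U u" e "q \<cdot>\<^bsub>U\<^esub> u"] p q assms by (auto simp: hom_iff)
  show thesis
    by (rule that[of "h \<cdot>\<^bsub>U\<^esub> p" d "h \<cdot>\<^bsub>U\<^esub> q" \<gamma>]) (use assms p q h \<gamma> in \<open>auto simp: hom_iff\<close>)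
qed

lemma sigma_parallel:
  assumes "f \<in> Arr U" "g \<in> \<Sigma>" "Dom U f = Dom U g" "Cod U f = Cod U g"
  obtains d h \<gamma> where "h \<in> \<Sigma>" "Dom U h = Cod U g" "Cod U h = d" "d \<in> Obj U"
    "\<gamma> \<in> Arr V" "Dom V \<gamma> = h \<cdot>\<^bsub>U\<^esub> f" "Cod V \<gamma> = h \<cdot>\<^bsub>U\<^esub> g" "f \<in> \<Sigma> \<longrightarrow> invertible_arr V \<gamma>"
  using sigmaF1[of f "Dom U g" "Cod U g" g] assms by (auto simp: hom_iff)

lemma sigma_equalize:
  assumes "\<alpha> \<in> Arr V" "\<beta> \<in> Arr V" "Dom V \<alpha> = Dom V \<beta>" "Cod V \<alpha> = Cod V \<beta>" "Cod V \<beta> \<in> \<Sigma>"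
  obtains d h where "h \<in> \<Sigma>" "Dom U h = Cod U (Dom V \<beta>)" "Cod U h = d" "d \<in> Obj U" "h \<triangleright> \<alpha> = h \<triangleright> \<beta>"
  using sigmaF2[of "Dom V \<beta>" "Dom U (Dom V \<beta>)" "Cod U (Dom V \<beta>)" "Cod V \<beta>" \<alpha> \<beta>] assms
  by (auto simp: hom_iff whisker_left_def)

text \<open>All three axioms of \<open>\<sigma>\<close>-filteredness enter: the squares of arrows are completed with the first two, and
the 2-cells that compare the third arrows are made equal with the last one, which applies because the
common third arrow has been moved into \<open>\<Sigma>\<close> before.\<close>
lemma refines_confluent:
  assumes "refines X Y p q1" "refines X Y p q2" "p \<in> Pre X Y" "q1 \<in> Pre X Y" "q2 \<in> Pre X Y"
    "X \<in> Ob" "Y \<in> Ob"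
  obtains r where "r \<in> Pre X Y" "snd (snd r) \<in> \<Sigma>" "refines X Y q1 r" "refines X Y q2 r"
proof -
  obtain x a y b u \<xi> v u1 \<xi>1 v1 u2 \<xi>2 v2 where
    eq [simp]: "X = (x, a)" "Y = (y, b)" "p = (u, \<xi>, v)" "q1 = (u1, \<xi>1, v1)" "q2 = (u2, \<xi>2, v2)"
    by (metis prod.exhaust)
  have pr: "u \<in> \<Sigma>" "Dom U u = a" "v \<in> Arr U" "Dom U v = b" "Cod U v = Cod U u"
     "\<xi> \<in> Arr (F0 F (Cod U u))" "Dom (F0 F (Cod U u)) \<xi> = Fo u x" "Cod (F0 F (Cod U u)) \<xi> = Fo v y"
     "u1 \<in> \<Sigma>" "Dom U u1 = a" "v1 \<in> Arr U" "Dom U v1 = b" "Cod U v1 = Cod U u1"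
     "u2 \<in> \<Sigma>" "Dom U u2 = a" "v2 \<in> Arr U" "Dom U v2 = b" "Cod U v2 = Cod U u2"
     "a \<in> Obj U" "x \<in> Obj (F0 F a)" "b \<in> Obj U" "y \<in> Obj (F0 F b)"
    using assms by (simp_all add: Pre_iff)
  obtain w1 \<alpha>1 \<beta>1 where w1: "w1 \<in> \<Sigma>" "Dom U w1 = Cod U u" "Cod U w1 = Cod U u1"
    and \<alpha>1: "\<alpha>1 \<in> Arr V" "Dom V \<alpha>1 = u1" "Cod V \<alpha>1 = w1 \<cdot>\<^bsub>U\<^esub> u" "invertible_arr V \<alpha>1"
    and \<beta>1: "\<beta>1 \<in> Arr V" "Dom V \<beta>1 = w1 \<cdot>\<^bsub>U\<^esub> v" "Cod V \<beta>1 = v1"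
    and \<xi>1: "\<xi>1 = Fc \<beta>1 y \<cdot>\<^bsub>F0 F (Cod U u1)\<^esub> (Fa w1 \<xi> \<cdot>\<^bsub>F0 F (Cod U u1)\<^esub> Fc \<alpha>1 x)"
    using assms(1) by (auto elim: refinesE)
  obtain w2 \<alpha>2 \<beta>2 where w2: "w2 \<in> \<Sigma>" "Dom U w2 = Cod U u" "Cod U w2 = Cod U u2"
    and \<alpha>2: "\<alpha>2 \<in> Arr V" "Dom V \<alpha>2 = u2" "Cod V \<alpha>2 = w2 \<cdot>\<^bsub>U\<^esub> u" "invertible_arr V \<alpha>2"
    and \<beta>2: "\<beta>2 \<in> Arr V" "Dom V \<beta>2 = w2 \<cdot>\<^bsub>U\<^esub> v" "Cod V \<beta>2 = v2"
    and \<xi>2: "\<xi>2 = Fc \<beta>2 y \<cdot>\<^bsub>F0 F (Cod U u2)\<^esub> (Fa w2 \<xi> \<cdot>\<^bsub>F0 F (Cod U u2)\<^esub> Fc \<alpha>2 x)"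
    using assms(2) by (auto elim: refinesE)
  \<comment> \<open>The two refinements are brought to a common stage \<open>d\<close>, where \<open>k1 w1\<close> and \<open>k2 w2\<close> are isomorphic.\<close>
  obtain d k1 k2 \<delta> where k1: "k1 \<in> \<Sigma>" "Dom U k1 = Cod U u1" "Cod U k1 = d" "d \<in> Obj U"
    and k2: "k2 \<in> \<Sigma>" "Dom U k2 = Cod U u2" "Cod U k2 = d"
    and \<delta>: "\<delta> \<in> Arr V" "Dom V \<delta> = k1 \<cdot>\<^bsub>U\<^esub> w1" "Cod V \<delta> = k2 \<cdot>\<^bsub>U\<^esub> w2" "invertible_arr V \<delta>"
    by (rule sigma_square[of w1 w2]) (use w1 w2 in auto)
  \<comment> \<open>The third arrows \<open>v1\<close> and \<open>v2\<close> need not lie in \<open>\<Sigma>\<close>; both receive a 2-cell into the same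
    arrow of \<open>\<Sigma>\<close>, first \<open>v1\<close> and then, after one more step, \<open>v2\<close>.\<close>
  obtain d' r s \<epsilon>1 where r: "r \<in> \<Sigma>" "Dom U r = d" "Cod U r = d'" "d' \<in> Obj U"
    and s: "s \<in> \<Sigma>" "Dom U s = b" "Cod U s = d'"
    and \<epsilon>1: "\<epsilon>1 \<in> Arr V" "Dom V \<epsilon>1 = r \<cdot>\<^bsub>U\<^esub> (k1 \<cdot>\<^bsub>U\<^esub> v1)" "Cod V \<epsilon>1 = s"
    by (rule sigma_square[of "k1 \<cdot>\<^bsub>U\<^esub> v1" "Ide U b"]) (use pr k1 in auto)
  obtain d'' h \<epsilon>2 where h: "h \<in> \<Sigma>" "Dom U h = d'" "Cod U h = d''" "d'' \<in> Obj U"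
    and \<epsilon>2: "\<epsilon>2 \<in> Arr V" "Dom V \<epsilon>2 = h \<cdot>\<^bsub>U\<^esub> (r \<cdot>\<^bsub>U\<^esub> (k2 \<cdot>\<^bsub>U\<^esub> v2))" "Cod V \<epsilon>2 = h \<cdot>\<^bsub>U\<^esub> s"
    by (rule sigma_parallel[of "r \<cdot>\<^bsub>U\<^esub> (k2 \<cdot>\<^bsub>U\<^esub> v2)" s]) (use pr k2 r s in auto)
  \<comment> \<open>The two resulting 2-cells out of \<open>k1 w1 v\<close> have a target in \<open>\<Sigma>\<close>, so some arrow of \<open>\<Sigma>\<close>
    makes them equal.\<close>
  obtain e g where g: "g \<in> \<Sigma>" "Dom U g = d''" "Cod U g = e" "e \<in> Obj U"
    and eqz: "g \<triangleright> (((h \<triangleright> \<epsilon>1) \<cdot>\<^bsub>V\<^esub> ((h \<cdot>\<^bsub>U\<^esub> (r \<cdot>\<^bsub>U\<^esub> k1)) \<triangleright> \<beta>1)))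
      = g \<triangleright> (\<epsilon>2 \<cdot>\<^bsub>V\<^esub> (((h \<cdot>\<^bsub>U\<^esub> (r \<cdot>\<^bsub>U\<^esub> k2)) \<triangleright> \<beta>2) \<cdot>\<^bsub>V\<^esub> (((h \<cdot>\<^bsub>U\<^esub> r) \<triangleright> \<delta>) \<triangleleft> v)))"
    by (rule sigma_equalize[of "(h \<triangleright> \<epsilon>1) \<cdot>\<^bsub>V\<^esub> ((h \<cdot>\<^bsub>U\<^esub> (r \<cdot>\<^bsub>U\<^esub> k1)) \<triangleright> \<beta>1)"
      "\<epsilon>2 \<cdot>\<^bsub>V\<^esub> (((h \<cdot>\<^bsub>U\<^esub> (r \<cdot>\<^bsub>U\<^esub> k2)) \<triangleright> \<beta>2) \<cdot>\<^bsub>V\<^esub> (((h \<cdot>\<^bsub>U\<^esub> r) \<triangleright> \<delta>) \<triangleleft> v))"])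
      (use pr w1 w2 k1 k2 r s h \<delta> \<epsilon>1 \<epsilon>2 \<beta>1 \<beta>2 in auto)
  note typed = pr w1 w2 \<alpha>1 \<alpha>2 k1 k2 r s h \<delta> \<epsilon>1 \<epsilon>2 \<beta>1 \<beta>2 g
  define G where "G = g \<cdot>\<^bsub>U\<^esub> (h \<cdot>\<^bsub>U\<^esub> r)"
  have G: "G \<in> \<Sigma>" "Dom U G = d" "Cod U G = e" using typed by (simp_all add: G_def)
  \<comment> \<open>This is what \<open>q1\<close> becomes at the last stage; by \<open>eqz\<close> and the naturality of \<open>F(\<delta>)\<close>, \<open>q2\<close> becomes the same.\<close>
  define \<zeta> where "\<zeta> = Fc (g \<triangleright> ((h \<triangleright> \<epsilon>1) \<cdot>\<^bsub>V\<^esub> ((h \<cdot>\<^bsub>U\<^esub> (r \<cdot>\<^bsub>U\<^esub> k1)) \<triangleright> \<beta>1))) y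
    \<cdot>\<^bsub>F0 F e\<^esub> Fa (G \<cdot>\<^bsub>U\<^esub> (k1 \<cdot>\<^bsub>U\<^esub> w1)) \<xi>"
  let ?r = "(G \<cdot>\<^bsub>U\<^esub> (k1 \<cdot>\<^bsub>U\<^esub> (w1 \<cdot>\<^bsub>U\<^esub> u)), \<zeta>, g \<cdot>\<^bsub>U\<^esub> (h \<cdot>\<^bsub>U\<^esub> s))"
  have c1: "Fa (G \<cdot>\<^bsub>U\<^esub> k1) (Fc \<alpha>1 x) \<cdot>\<^bsub>F0 F e\<^esub> Fa (G \<cdot>\<^bsub>U\<^esub> k1) (Fc (Inv V \<alpha>1) x)
    = Ide (F0 F e) (Fo (G \<cdot>\<^bsub>U\<^esub> k1) (Fo (w1 \<cdot>\<^bsub>U\<^esub> u) x))"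
    using Fc_Inv[of \<alpha>1 "G \<cdot>\<^bsub>U\<^esub> k1" x] typed G by simp
  have c2: "Fa (G \<cdot>\<^bsub>U\<^esub> k2) (Fc \<alpha>2 x) \<cdot>\<^bsub>F0 F e\<^esub> (Fa (G \<cdot>\<^bsub>U\<^esub> k2) (Fc (Inv V \<alpha>2) x) \<cdot>\<^bsub>F0 F e\<^esub> Fc ((G \<triangleright> \<delta>) \<triangleleft> u) x)
    = Fc ((G \<triangleright> \<delta>) \<triangleleft> u) x"
    using Fc_Inv[of \<alpha>2 "G \<cdot>\<^bsub>U\<^esub> k2" x] typed G by (simp flip: cat_assoc)
  have n: "Fc (G \<triangleright> \<delta>) (Fo v y) \<cdot>\<^bsub>F0 F e\<^esub> Fa (G \<cdot>\<^bsub>U\<^esub> (k1 \<cdot>\<^bsub>U\<^esub> w1)) \<xi>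
    = Fa (G \<cdot>\<^bsub>U\<^esub> (k2 \<cdot>\<^bsub>U\<^esub> w2)) \<xi> \<cdot>\<^bsub>F0 F e\<^esub> Fc (G \<triangleright> \<delta>) (Fo u x)"
    using Fc_natural[of "G \<triangleright> \<delta>" "Cod U u" e \<xi> "Fo u x" "Fo v y"] typed G by simp
  show thesis
  proof (rule that[of ?r])
    show "?r \<in> Pre X Y" using typed by (simp add: Pre_iff \<zeta>_def G_def)
    show "snd (snd ?r) \<in> \<Sigma>" using typed by simp
    show "refines X Y q1 ?r" unfolding eq
      by (rule refinesI[of "G \<cdot>\<^bsub>U\<^esub> k1" _ _ "(G \<cdot>\<^bsub>U\<^esub> k1) \<triangleright> Inv V \<alpha>1" "(g \<cdot>\<^bsub>U\<^esub> h) \<triangleright> \<epsilon>1"])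
       (use typed \<xi>1 c1 in \<open>simp_all add: \<zeta>_def G_def invertible_whisker_l invertible_Inv\<close>)
    show "refines X Y q2 ?r" unfolding eq
      by (rule refinesI[of "G \<cdot>\<^bsub>U\<^esub> k2" _ _
            "((G \<cdot>\<^bsub>U\<^esub> k2) \<triangleright> Inv V \<alpha>2) \<cdot>\<^bsub>V\<^esub> ((G \<triangleright> \<delta>) \<triangleleft> u)" "g \<triangleright> \<epsilon>2"])
       (use typed \<xi>2 eqz c2 n in \<open>simp_all add: \<zeta>_def G_def invertible_Comp invertible_whisker_r invertible_whisker_l invertible_Inv\<close>)
  qed
qed

lemma refines_imp_homotopical:
  assumes "refines X Y p q" "p \<in> Pre X Y" "q \<in> Pre X Y" "X \<in> Ob" "Y \<in> Ob"
  shows "homotopical A \<Sigma> F X Y p q"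
proof -
  have "refines X Y p p" using assms refines_refl by (cases X, cases Y, cases p) auto
  from refines_confluent[OF this assms(1,2,2,3,4,5)] show ?thesis
    unfolding homotopical_iff[OF assms(2-5)] by auto
qed

text \<open>Transitivity is confluence at the middle premorphism.\<close>
lemma homotopical_trans:
  assumes "homotopical A \<Sigma> F X Y p q" "homotopical A \<Sigma> F X Y q r"
    "p \<in> Pre X Y" "q \<in> Pre X Y" "r \<in> Pre X Y" "X \<in> Ob" "Y \<in> Ob"
  shows "homotopical A \<Sigma> F X Y p r"
proof -
  obtain s where s: "s \<in> Pre X Y" "refines X Y p s" "refines X Y q s"
    using assms(1) homotopical_iff[OF assms(3,4,6,7)] by auto
  obtain t where t: "t \<in> Pre X Y" "refines X Y q t" "refines X Y r t"
    using assms(2) homotopical_iff[OF assms(4,5,6,7)] by auto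
  obtain z where z: "z \<in> Pre X Y" "snd (snd z) \<in> \<Sigma>" "refines X Y s z" "refines X Y t z"
    by (rule refines_confluent[OF s(3) t(2) assms(4) s(1) t(1) assms(6,7)])
  have "refines X Y p z" "refines X Y r z"
    using refines_trans[OF s(2) z(3)] refines_trans[OF t(3) z(4)] assms s t by auto
  then show ?thesis using z homotopical_iff[OF assms(3,5,6,7)] by auto
qed

lemma equiv_homotopy_rel:
  assumes "X \<in> Ob" "Y \<in> Ob"
  shows "equiv (Pre X Y) (hrel X Y)"
proof (rule equivI)
  show "hrel X Y \<subseteq> Pre X Y \<times> Pre X Y" by (auto simp: homotopy_rel_def)
  show "refl_on (Pre X Y) (hrel X Y)"
    using assms refines_refl refines_imp_homotopical
    by (cases X, cases Y) (auto simp: refl_on_def homotopy_rel_def)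
  show "sym (hrel X Y)"
    using assms by (auto simp: sym_def homotopy_rel_def homotopical_iff)
  show "trans (hrel X Y)"
    using assms by (auto intro!: transI simp: homotopy_rel_def intro: homotopical_trans)
qed

lemma cls_eq_iff:
  assumes "X \<in> Ob" "Y \<in> Ob" "p \<in> Pre X Y" "q \<in> Pre X Y"
  shows "cls X Y p = cls X Y q \<longleftrightarrow> homotopical A \<Sigma> F X Y p q"
  using eq_equiv_class_iff[OF equiv_homotopy_rel[OF assms(1,2)] assms(3,4)] assms(3,4)
  by (simp add: homotopy_class_def homotopy_rel_def)

lemma cls_eqI:
  assumes "refines X Y p q" "p \<in> Pre X Y" "q \<in> Pre X Y" "X \<in> Ob" "Y \<in> Ob"
  shows "cls X Y p = cls X Y q"
  using refines_imp_homotopical[OF assms] assms by (simp add: cls_eq_iff)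

lemma cls_subset: "p' \<in> cls X Y p \<Longrightarrow> p' \<in> Pre X Y"
  by (simp add: homotopy_class_def homotopy_rel_def)

lemma cls_member:
  assumes "p' \<in> cls X Y p" "X \<in> Ob" "Y \<in> Ob" "p \<in> Pre X Y"
  shows "cls X Y p' = cls X Y p"
  using assms cls_subset[OF assms(1)] equiv_class_eq[OF equiv_homotopy_rel[OF assms(2,3)]]
  by (simp add: homotopy_class_def)

lemma cls_self: "\<lbrakk>X \<in> Ob; Y \<in> Ob; p \<in> Pre X Y\<rbrakk> \<Longrightarrow> p \<in> cls X Y p"
  unfolding homotopy_class_def by (rule equiv_class_self[OF equiv_homotopy_rel])

end

section \<open>Composition of homotopy classes\<close>

context sigma_diagram
begin

abbreviation "composable \<equiv> composable_via A \<Sigma>"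

lemma composable_iff:
  "composable r s \<gamma> (u', \<zeta>, v') (u, \<xi>, v) \<longleftrightarrow> r \<in> \<Sigma> \<and> s \<in> \<Sigma> \<and>
    Dom U r = Cod U v \<and> Dom U s = Cod U u' \<and> Cod U s = Cod U r \<and>
    \<gamma> \<in> Arr V \<and> Dom V \<gamma> = r \<cdot>\<^bsub>U\<^esub> v \<and> Cod V \<gamma> = s \<cdot>\<^bsub>U\<^esub> u'"
  by (auto simp: composable_via_def hom_def)

lemma premor_comp_eq:
  "premor_comp A F y r s \<gamma> (u', \<zeta>, v') (u, \<xi>, v) =
    (r \<cdot>\<^bsub>U\<^esub> u, Fa s \<zeta> \<cdot>\<^bsub>F0 F (Cod U r)\<^esub> (Fc \<gamma> y \<cdot>\<^bsub>F0 F (Cod U r)\<^esub> Fa r \<xi>), s \<cdot>\<^bsub>U\<^esub> v')"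
  by (simp add: premor_comp_def Let_def)

lemma premor_comp_in_Pre:
  assumes "p \<in> Pre X Y" "q \<in> Pre Y Z" "composable r s \<gamma> q p" "X \<in> Ob" "Y \<in> Ob" "Z \<in> Ob"
  shows "premor_comp A F (fst Y) r s \<gamma> q p \<in> Pre X Z"
proof -
  obtain x a y b z c u \<xi> v u' \<zeta> v' where
    eq [simp]: "X = (x, a)" "Y = (y, b)" "Z = (z, c)" "p = (u, \<xi>, v)" "q = (u', \<zeta>, v')"
    by (metis prod.exhaust)
  show ?thesis
    using assms by (simp add: premor_comp_eq Pre_iff composable_iff)
qed

text \<open>If \<open>w\<close>, \<open>\<alpha>\<close>, \<open>\<beta>\<close> refine \<open>p\<close> to \<open>p'\<close> and \<open>w'\<close>, \<open>\<alpha>'\<close>, \<open>\<beta>'\<close> refine \<open>q\<close> to \<open>q'\<close>, then a 2-cell \<open>\<gamma>\<close> that composes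
\<open>p'\<close> and \<open>q'\<close> gives a 2-cell for \<open>p\<close> and \<open>q\<close>, by precomposition with \<open>r\<beta>\<close> and postcomposition with
\<open>s\<alpha>'\<close>; what is left over, \<open>\<alpha>\<close> and \<open>\<beta>'\<close>, is a refinement of the composite.\<close>
lemma premor_comp_refines:
  assumes "refines X Y p p'" "refines Y Z q q'" "composable r s \<gamma> q' p'"
    "p \<in> Pre X Y" "p' \<in> Pre X Y" "q \<in> Pre Y Z" "q' \<in> Pre Y Z" "X \<in> Ob" "Y \<in> Ob" "Z \<in> Ob"
  obtains r' s' \<gamma>' where "composable r' s' \<gamma>' q p"
    "refines X Z (premor_comp A F (fst Y) r' s' \<gamma>' q p) (premor_comp A F (fst Y) r s \<gamma> q' p')"
proof -
  obtain x a y b z c u \<xi> v i \<zeta> j u1 \<xi>1 v1 i1 \<zeta>1 j1 where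
    eq [simp]: "X = (x, a)" "Y = (y, b)" "Z = (z, c)" "p = (u, \<xi>, v)" "q = (i, \<zeta>, j)"
      "p' = (u1, \<xi>1, v1)" "q' = (i1, \<zeta>1, j1)"
    by (metis prod.exhaust)
  have pr: "u \<in> \<Sigma>" "Dom U u = a" "v \<in> Arr U" "Dom U v = b" "Cod U v = Cod U u"
     "\<xi> \<in> Arr (F0 F (Cod U u))" "Dom (F0 F (Cod U u)) \<xi> = Fo u x" "Cod (F0 F (Cod U u)) \<xi> = Fo v y"
     "i \<in> \<Sigma>" "Dom U i = b" "j \<in> Arr U" "Dom U j = c" "Cod U j = Cod U i"
     "\<zeta> \<in> Arr (F0 F (Cod U i))" "Dom (F0 F (Cod U i)) \<zeta> = Fo i y" "Cod (F0 F (Cod U i)) \<zeta> = Fo j z"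
     "u1 \<in> \<Sigma>" "Dom U u1 = a" "v1 \<in> Arr U" "Dom U v1 = b" "Cod U v1 = Cod U u1"
     "i1 \<in> \<Sigma>" "Dom U i1 = b" "j1 \<in> Arr U" "Dom U j1 = c" "Cod U j1 = Cod U i1"
     "a \<in> Obj U" "x \<in> Obj (F0 F a)" "b \<in> Obj U" "y \<in> Obj (F0 F b)" "c \<in> Obj U" "z \<in> Obj (F0 F c)"
    and r: "r \<in> \<Sigma>" "s \<in> \<Sigma>" "Dom U r = Cod U u1" "Dom U s = Cod U i1" "Cod U s = Cod U r"
      "\<gamma> \<in> Arr V" "Dom V \<gamma> = r \<cdot>\<^bsub>U\<^esub> v1" "Cod V \<gamma> = s \<cdot>\<^bsub>U\<^esub> i1"
    using assms by (simp_all add: Pre_iff composable_iff)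
  obtain w \<alpha> \<beta> where w: "w \<in> \<Sigma>" "Dom U w = Cod U u" "Cod U w = Cod U u1"
    and \<alpha>: "\<alpha> \<in> Arr V" "Dom V \<alpha> = u1" "Cod V \<alpha> = w \<cdot>\<^bsub>U\<^esub> u" "invertible_arr V \<alpha>"
    and \<beta>: "\<beta> \<in> Arr V" "Dom V \<beta> = w \<cdot>\<^bsub>U\<^esub> v" "Cod V \<beta> = v1"
    and \<xi>1: "\<xi>1 = Fc \<beta> y \<cdot>\<^bsub>F0 F (Cod U u1)\<^esub> (Fa w \<xi> \<cdot>\<^bsub>F0 F (Cod U u1)\<^esub> Fc \<alpha> x)"
    using assms(1) by (auto elim: refinesE)
  obtain w' \<alpha>' \<beta>' where w': "w' \<in> \<Sigma>" "Dom U w' = Cod U i" "Cod U w' = Cod U i1"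
    and \<alpha>': "\<alpha>' \<in> Arr V" "Dom V \<alpha>' = i1" "Cod V \<alpha>' = w' \<cdot>\<^bsub>U\<^esub> i" "invertible_arr V \<alpha>'"
    and \<beta>': "\<beta>' \<in> Arr V" "Dom V \<beta>' = w' \<cdot>\<^bsub>U\<^esub> j" "Cod V \<beta>' = j1"
    and \<zeta>1: "\<zeta>1 = Fc \<beta>' z \<cdot>\<^bsub>F0 F (Cod U i1)\<^esub> (Fa w' \<zeta> \<cdot>\<^bsub>F0 F (Cod U i1)\<^esub> Fc \<alpha>' y)"
    using assms(2) by (auto elim: refinesE)
  note typed = pr r w \<alpha> \<beta> w' \<alpha>' \<beta>'
  show thesis
  proof (rule that[of "r \<cdot>\<^bsub>U\<^esub> w" "s \<cdot>\<^bsub>U\<^esub> w'" "(s \<triangleright> \<alpha>') \<cdot>\<^bsub>V\<^esub> (\<gamma> \<cdot>\<^bsub>V\<^esub> (r \<triangleright> \<beta>))"])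
    show "composable (r \<cdot>\<^bsub>U\<^esub> w) (s \<cdot>\<^bsub>U\<^esub> w') ((s \<triangleright> \<alpha>') \<cdot>\<^bsub>V\<^esub> (\<gamma> \<cdot>\<^bsub>V\<^esub> (r \<triangleright> \<beta>))) q p"
      using typed by (simp add: composable_iff)
    show "refines X Z (premor_comp A F (fst Y) (r \<cdot>\<^bsub>U\<^esub> w) (s \<cdot>\<^bsub>U\<^esub> w')
        ((s \<triangleright> \<alpha>') \<cdot>\<^bsub>V\<^esub> (\<gamma> \<cdot>\<^bsub>V\<^esub> (r \<triangleright> \<beta>))) q p) (premor_comp A F (fst Y) r s \<gamma> q' p')"
      unfolding eq premor_comp_eq
      by (rule refinesI[of "Ide U (Cod U r)" _ _ "r \<triangleright> \<alpha>" "s \<triangleright> \<beta>'"])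
        (use typed \<xi>1 \<zeta>1 in \<open>simp_all add: invertible_whisker_l\<close>)
  qed
qed

end

context filtered_diagram
begin

lemma composable_exists:
  assumes "p \<in> Pre X Y" "q \<in> Pre Y Z"
  obtains r s \<gamma> where "composable r s \<gamma> q p"
proof -
  obtain x a y b z c u \<xi> v u' \<zeta> v' where
    eq [simp]: "X = (x, a)" "Y = (y, b)" "Z = (z, c)" "p = (u, \<xi>, v)" "q = (u', \<zeta>, v')"
    by (metis prod.exhaust)
  show thesis
    by (rule sigma_square[of v u']) (use assms that in \<open>auto simp: Pre_iff composable_iff\<close>)
qed

text \<open>Two choices of \<open>(r, s, \<gamma>)\<close> are transported to a common stage. There the first and third arrows agree up
to isomorphism, and the two 2-cells can be made equal because their target \<open>s u'\<close> lies in \<open>\<Sigma>\<close>.\<close>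
lemma premor_comp_indep:
  assumes "p \<in> Pre X Y" "q \<in> Pre Y Z" "X \<in> Ob" "Y \<in> Ob" "Z \<in> Ob"
    "composable r s \<gamma> q p" "composable r1 s1 \<gamma>1 q p"
  shows "cls X Z (premor_comp A F (fst Y) r s \<gamma> q p) = cls X Z (premor_comp A F (fst Y) r1 s1 \<gamma>1 q p)"
proof -
  obtain x a y b z c u \<xi> v u' \<zeta> v' where
    eq [simp]: "X = (x, a)" "Y = (y, b)" "Z = (z, c)" "p = (u, \<xi>, v)" "q = (u', \<zeta>, v')"
    by (metis prod.exhaust)
  have pr: "u \<in> \<Sigma>" "Dom U u = a" "v \<in> Arr U" "Dom U v = b" "Cod U v = Cod U u"
     "\<xi> \<in> Arr (F0 F (Cod U u))" "Dom (F0 F (Cod U u)) \<xi> = Fo u x" "Cod (F0 F (Cod U u)) \<xi> = Fo v y"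
     "u' \<in> \<Sigma>" "Dom U u' = b" "v' \<in> Arr U" "Dom U v' = c" "Cod U v' = Cod U u'"
     "\<zeta> \<in> Arr (F0 F (Cod U u'))" "Dom (F0 F (Cod U u')) \<zeta> = Fo u' y" "Cod (F0 F (Cod U u')) \<zeta> = Fo v' z"
     "a \<in> Obj U" "x \<in> Obj (F0 F a)" "b \<in> Obj U" "y \<in> Obj (F0 F b)" "c \<in> Obj U" "z \<in> Obj (F0 F c)"
    and r: "r \<in> \<Sigma>" "s \<in> \<Sigma>" "Dom U r = Cod U u" "Dom U s = Cod U u'" "Cod U s = Cod U r"
      "\<gamma> \<in> Arr V" "Dom V \<gamma> = r \<cdot>\<^bsub>U\<^esub> v" "Cod V \<gamma> = s \<cdot>\<^bsub>U\<^esub> u'"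
    and r1: "r1 \<in> \<Sigma>" "s1 \<in> \<Sigma>" "Dom U r1 = Cod U u" "Dom U s1 = Cod U u'" "Cod U s1 = Cod U r1"
      "\<gamma>1 \<in> Arr V" "Dom V \<gamma>1 = r1 \<cdot>\<^bsub>U\<^esub> v" "Cod V \<gamma>1 = s1 \<cdot>\<^bsub>U\<^esub> u'"
    using assms by (simp_all add: Pre_iff composable_iff)
  \<comment> \<open>First \<open>r\<close> and \<open>r1\<close>, then \<open>s\<close> and \<open>s1\<close> are made isomorphic.\<close>
  obtain d k k1 \<delta> where k: "k \<in> \<Sigma>" "Dom U k = Cod U r" "Cod U k = d" "d \<in> Obj U"
    and k1: "k1 \<in> \<Sigma>" "Dom U k1 = Cod U r1" "Cod U k1 = d"
    and \<delta>: "\<delta> \<in> Arr V" "Dom V \<delta> = k \<cdot>\<^bsub>U\<^esub> r" "Cod V \<delta> = k1 \<cdot>\<^bsub>U\<^esub> r1" "invertible_arr V \<delta>"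
    by (rule sigma_square[of r r1]) (use r r1 in auto)
  obtain e h \<epsilon> where h: "h \<in> \<Sigma>" "Dom U h = d" "Cod U h = e" "e \<in> Obj U"
    and \<epsilon>: "\<epsilon> \<in> Arr V" "Dom V \<epsilon> = h \<cdot>\<^bsub>U\<^esub> (k1 \<cdot>\<^bsub>U\<^esub> s1)" "Cod V \<epsilon> = h \<cdot>\<^bsub>U\<^esub> (k \<cdot>\<^bsub>U\<^esub> s)" "invertible_arr V \<epsilon>"
    by (rule sigma_parallel[of "k1 \<cdot>\<^bsub>U\<^esub> s1" "k \<cdot>\<^bsub>U\<^esub> s"]) (use r r1 k k1 in auto)
  \<comment> \<open>Now \<open>\<gamma>\<close> and the transported \<open>\<gamma>1\<close> are parallel 2-cells whose target lies in \<open>\<Sigma>\<close>.\<close>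
  obtain e' g where g: "g \<in> \<Sigma>" "Dom U g = e" "Cod U g = e'" "e' \<in> Obj U"
    and eqz: "g \<triangleright> ((h \<cdot>\<^bsub>U\<^esub> k) \<triangleright> \<gamma>)
      = g \<triangleright> ((\<epsilon> \<triangleleft> u') \<cdot>\<^bsub>V\<^esub> (((h \<cdot>\<^bsub>U\<^esub> k1) \<triangleright> \<gamma>1) \<cdot>\<^bsub>V\<^esub> ((h \<triangleright> \<delta>) \<triangleleft> v)))"
    by (rule sigma_equalize[of "(h \<cdot>\<^bsub>U\<^esub> k) \<triangleright> \<gamma>"
      "(\<epsilon> \<triangleleft> u') \<cdot>\<^bsub>V\<^esub> (((h \<cdot>\<^bsub>U\<^esub> k1) \<triangleright> \<gamma>1) \<cdot>\<^bsub>V\<^esub> ((h \<triangleright> \<delta>) \<triangleleft> v))"])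
      (use pr r r1 k k1 h \<delta> \<epsilon> in auto)
  note typed = pr r r1 k k1 h \<delta> \<epsilon> g
  define K where "K = g \<cdot>\<^bsub>U\<^esub> (h \<cdot>\<^bsub>U\<^esub> k)"
  define K1 where "K1 = g \<cdot>\<^bsub>U\<^esub> (h \<cdot>\<^bsub>U\<^esub> k1)"
  define \<rho> where "\<rho> = Fa (K \<cdot>\<^bsub>U\<^esub> s) \<zeta> \<cdot>\<^bsub>F0 F e'\<^esub> (Fc (K \<triangleright> \<gamma>) y \<cdot>\<^bsub>F0 F e'\<^esub> Fa (K \<cdot>\<^bsub>U\<^esub> r) \<xi>)"
  let ?t = "(K \<cdot>\<^bsub>U\<^esub> (r \<cdot>\<^bsub>U\<^esub> u), \<rho>, K \<cdot>\<^bsub>U\<^esub> (s \<cdot>\<^bsub>U\<^esub> v'))"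
  have n1: "Fc (g \<triangleright> \<epsilon>) (Fo v' z) \<cdot>\<^bsub>F0 F e'\<^esub> (Fa (K1 \<cdot>\<^bsub>U\<^esub> s1) \<zeta> \<cdot>\<^bsub>F0 F e'\<^esub> \<tau>)
    = Fa (K \<cdot>\<^bsub>U\<^esub> s) \<zeta> \<cdot>\<^bsub>F0 F e'\<^esub> (Fc (g \<triangleright> \<epsilon>) (Fo u' y) \<cdot>\<^bsub>F0 F e'\<^esub> \<tau>)"
    if "\<tau> \<in> Arr (F0 F e')" "Cod (F0 F e') \<tau> = Fo (K1 \<cdot>\<^bsub>U\<^esub> s1) (Fo u' y)" for \<tau>
    using Fc_natural_chain[of "g \<triangleright> \<epsilon>" "Cod U u'" e' \<zeta> "Fo u' y" "Fo v' z" \<tau>] that typed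
    by (simp add: K_def K1_def)
  have n2: "Fc ((g \<cdot>\<^bsub>U\<^esub> h) \<triangleright> \<delta>) (Fo v y) \<cdot>\<^bsub>F0 F e'\<^esub> Fa (K \<cdot>\<^bsub>U\<^esub> r) \<xi>
    = Fa (K1 \<cdot>\<^bsub>U\<^esub> r1) \<xi> \<cdot>\<^bsub>F0 F e'\<^esub> Fc ((g \<cdot>\<^bsub>U\<^esub> h) \<triangleright> \<delta>) (Fo u x)"
    using Fc_natural[of "(g \<cdot>\<^bsub>U\<^esub> h) \<triangleright> \<delta>" "Cod U u" e' \<xi> "Fo u x" "Fo v y"] typed
    by (simp add: K_def K1_def)
  have \<rho>: "\<rho> = Fa (K \<cdot>\<^bsub>U\<^esub> s) \<zeta> \<cdot>\<^bsub>F0 F e'\<^esub> (Fc (g \<triangleright> \<epsilon>) (Fo u' y) \<cdot>\<^bsub>F0 F e'\<^esub> (Fc (K1 \<triangleright> \<gamma>1) y \<cdot>\<^bsub>F0 F e'\<^esub>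
      (Fc ((g \<cdot>\<^bsub>U\<^esub> h) \<triangleright> \<delta>) (Fo v y) \<cdot>\<^bsub>F0 F e'\<^esub> Fa (K \<cdot>\<^bsub>U\<^esub> r) \<xi>)))"
    using arg_cong[OF eqz, of "\<lambda>\<theta>. Fc \<theta> y"] typed by (simp add: \<rho>_def K_def K1_def flip: cat_assoc)
  have t: "?t \<in> Pre X Z" using typed by (simp add: \<rho>_def K_def Pre_iff)
  have 1: "refines X Z (premor_comp A F (fst Y) r s \<gamma> q p) ?t"
    unfolding eq premor_comp_eq
    by (rule refinesI[of K _ _ "Ide V (K \<cdot>\<^bsub>U\<^esub> (r \<cdot>\<^bsub>U\<^esub> u))" "Ide V (K \<cdot>\<^bsub>U\<^esub> (s \<cdot>\<^bsub>U\<^esub> v'))"])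
      (use typed in \<open>simp_all add: \<rho>_def K_def invertible_Ide\<close>)
  have 2: "refines X Z (premor_comp A F (fst Y) r1 s1 \<gamma>1 q p) ?t"
    unfolding eq premor_comp_eq
    apply (rule refinesI[of K1 _ _ "((g \<cdot>\<^bsub>U\<^esub> h) \<triangleright> \<delta>) \<triangleleft> u" "(g \<triangleright> \<epsilon>) \<triangleleft> v'"])
              apply (use typed in \<open>simp_all add: K_def K1_def invertible_whisker_l invertible_whisker_r\<close>)[10]
    unfolding \<rho> n2 using typed n1 by (simp add: K_def K1_def)
  show ?thesis
    using cls_eqI[OF 1 premor_comp_in_Pre t] cls_eqI[OF 2 premor_comp_in_Pre t] assms by simp
qed

lemma premor_comp_cong:
  assumes "cls X Y p = cls X Y p'" "cls Y Z q = cls Y Z q'"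
    "composable r s \<gamma> q p" "composable r' s' \<gamma>' q' p'"
    "p \<in> Pre X Y" "p' \<in> Pre X Y" "q \<in> Pre Y Z" "q' \<in> Pre Y Z" "X \<in> Ob" "Y \<in> Ob" "Z \<in> Ob"
  shows "cls X Z (premor_comp A F (fst Y) r s \<gamma> q p) = cls X Z (premor_comp A F (fst Y) r' s' \<gamma>' q' p')"
proof -
  \<comment> \<open>Both pairs are compared with composites of their common refinements.\<close>
  have key: "cls X Z (premor_comp A F (fst Y) r s \<gamma> q p) = cls X Z (premor_comp A F (fst Y) r1 s1 \<gamma>1 q1 p1)"
    if prems: "refines X Y p p1" "refines Y Z q q1" "composable r s \<gamma> q p" "composable r1 s1 \<gamma>1 q1 p1"
      "p \<in> Pre X Y" "p1 \<in> Pre X Y" "q \<in> Pre Y Z" "q1 \<in> Pre Y Z" for p q p1 q1 r s \<gamma> r1 s1 \<gamma>1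
  proof -
    obtain r2 s2 \<gamma>2 where 2: "composable r2 s2 \<gamma>2 q p"
      "refines X Z (premor_comp A F (fst Y) r2 s2 \<gamma>2 q p) (premor_comp A F (fst Y) r1 s1 \<gamma>1 q1 p1)"
      by (rule premor_comp_refines[OF prems(1,2,4,5-8) assms(9-11)])
    show ?thesis
      using premor_comp_indep[OF prems(5,7) assms(9-11) prems(3) 2(1)]
        cls_eqI[OF 2(2) premor_comp_in_Pre premor_comp_in_Pre] 2 prems assms by simp
  qed
  obtain p1 where p1: "p1 \<in> Pre X Y" "refines X Y p p1" "refines X Y p' p1"
    using assms(1) unfolding cls_eq_iff[OF assms(9,10,5,6)] homotopical_iff[OF assms(5,6,9,10)] by auto
  obtain q1 where q1: "q1 \<in> Pre Y Z" "refines Y Z q q1" "refines Y Z q' q1"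
    using assms(2) unfolding cls_eq_iff[OF assms(10,11,7,8)] homotopical_iff[OF assms(7,8,10,11)] by auto
  obtain r1 s1 \<gamma>1 where c: "composable r1 s1 \<gamma>1 q1 p1" by (rule composable_exists[OF p1(1) q1(1)])
  show ?thesis
    using key[OF p1(2) q1(2) assms(3) c] key[OF p1(3) q1(3) assms(4) c] assms p1 q1 by simp
qed

lemma class_comp_cls:
  assumes "p \<in> Pre X Y" "q \<in> Pre Y Z" "X \<in> Ob" "Y \<in> Ob" "Z \<in> Ob" "composable r s \<gamma> q p"
  shows "class_comp A \<Sigma> F X Y Z (cls Y Z q) (cls X Y p) = cls X Z (premor_comp A F (fst Y) r s \<gamma> q p)"
proof -
  have "cls X Z (premor_comp A F (fst Y) r' s' \<gamma>' q' p') = cls X Z (premor_comp A F (fst Y) r s \<gamma> q p)"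
    if "q' \<in> cls Y Z q" "p' \<in> cls X Y p" "composable r' s' \<gamma>' q' p'" for q' p' r' s' \<gamma>'
    using premor_comp_cong[OF cls_member[OF that(2)] cls_member[OF that(1)] that(3) assms(6)] assms
      cls_subset[OF that(1)] cls_subset[OF that(2)] by simp
  then have "{cls X Z (premor_comp A F (fst Y) r s \<gamma> q' p') | r s \<gamma> q' p'.
        q' \<in> cls Y Z q \<and> p' \<in> cls X Y p \<and> composable r s \<gamma> q' p'} = {cls X Z (premor_comp A F (fst Y) r s \<gamma> q p)}"
    using assms cls_self[OF assms(3,4,1)] cls_self[OF assms(4,5,2)] by blast
  then show ?thesis unfolding class_comp_def by simp
qed

end

section \<open>The category of premorphisms up to homotopy\<close>

context filtered_diagram
begin

abbreviation "L \<equiv> L_sigma A \<Sigma> F"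

abbreviation mor where "mor X Y p \<equiv> (X, cls X Y p, Y)"

lemma L_Obj [simp]: "Obj L = Ob"
  by (simp add: L_sigma_def Ob_def Let_def)

lemma L_Dom [simp]: "Dom L (X, P, Y) = X" and L_Cod [simp]: "Cod L (X, P, Y) = Y"
  by (simp_all add: L_sigma_def Let_def)

lemma L_Arr: "(X, P, Y) \<in> Arr L \<longleftrightarrow> X \<in> Ob \<and> Y \<in> Ob \<and> (\<exists>p \<in> Pre X Y. P = cls X Y p)"
  by (auto simp: L_sigma_def Let_def quotient_def homotopy_class_def Ob_def)

lemma L_mor [simp]: "\<lbrakk>X \<in> Ob; Y \<in> Ob; p \<in> Pre X Y\<rbrakk> \<Longrightarrow> mor X Y p \<in> Arr L"
  by (auto simp: L_Arr)

lemma L_ArrE: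
  assumes "f \<in> Arr L"
  obtains X Y p where "X \<in> Ob" "Y \<in> Ob" "p \<in> Pre X Y" "f = mor X Y p"
  using assms by (cases f) (auto simp: L_Arr)

lemma L_Ide: "Ide L (x, a) = mor (x, a) (x, a) (Ide U a, Ide (F0 F a) x, Ide U a)"
  by (simp add: L_sigma_def Let_def)

lemma L_Comp:
  assumes "p \<in> Pre X Y" "q \<in> Pre Y Z" "X \<in> Ob" "Y \<in> Ob" "Z \<in> Ob" "composable r s \<gamma> q p"
  shows "mor Y Z q \<cdot>\<^bsub>L\<^esub> mor X Y p = mor X Z (premor_comp A F (fst Y) r s \<gamma> q p)"
  using class_comp_cls[OF assms] by (simp add: L_sigma_def Let_def)

text \<open>A premorphism out of \<open>(y, b)\<close> whose first arrow is an identity can be composed without completing a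
square: the naive composite is refined by the one formed with any \<open>\<gamma> : r v \<Rightarrow> s\<close>, by the naturality of
\<open>F(\<gamma>)\<close>. The left unit law, the functoriality of the legs of \<open>\<lambda>\<close>,
the naturality of its cells and their compatibility with composition are instances of this rule.\<close>
lemma L_Comp_post:
  assumes "(u, \<xi>, v) \<in> Pre (x, a) (y, b)" "(Ide U b, \<zeta>, f) \<in> Pre (y, b) (z, c)"
    "(x, a) \<in> Ob" "(y, b) \<in> Ob" "(z, c) \<in> Ob"
  shows "mor (y, b) (z, c) (Ide U b, \<zeta>, f) \<cdot>\<^bsub>L\<^esub> mor (x, a) (y, b) (u, \<xi>, v)
    = mor (x, a) (z, c) (u, Fa v \<zeta> \<cdot>\<^bsub>F0 F (Cod U u)\<^esub> \<xi>, v \<cdot>\<^bsub>U\<^esub> f)"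
proof -
  have pr: "u \<in> \<Sigma>" "Dom U u = a" "v \<in> Arr U" "Dom U v = b" "Cod U v = Cod U u"
     "\<xi> \<in> Arr (F0 F (Cod U u))" "Dom (F0 F (Cod U u)) \<xi> = Fo u x" "Cod (F0 F (Cod U u)) \<xi> = Fo v y"
     "f \<in> Arr U" "Dom U f = c" "Cod U f = b"
     "\<zeta> \<in> Arr (F0 F b)" "Dom (F0 F b) \<zeta> = y" "Cod (F0 F b) \<zeta> = Fo f z"
     "a \<in> Obj U" "x \<in> Obj (F0 F a)" "b \<in> Obj U" "y \<in> Obj (F0 F b)" "c \<in> Obj U" "z \<in> Obj (F0 F c)"
    using assms by (simp_all add: Pre_iff)
  obtain d r s \<gamma> where r: "r \<in> \<Sigma>" "Dom U r = Cod U u" "Cod U r = d" "d \<in> Obj U" "s \<in> \<Sigma>" "Dom U s = b" "Cod U s = d"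
      "\<gamma> \<in> Arr V" "Dom V \<gamma> = r \<cdot>\<^bsub>U\<^esub> v" "Cod V \<gamma> = s"
    by (rule sigma_square[of v "Ide U b"]) (use pr in auto)
  have comp: "composable r s \<gamma> (Ide U b, \<zeta>, f) (u, \<xi>, v)"
    using pr r by (simp add: composable_iff)
  have n: "Fc \<gamma> (Fo f z) \<cdot>\<^bsub>F0 F d\<^esub> (Fa r (Fa v \<zeta>) \<cdot>\<^bsub>F0 F d\<^esub> Fa r \<xi>)
    = Fa s \<zeta> \<cdot>\<^bsub>F0 F d\<^esub> (Fc \<gamma> y \<cdot>\<^bsub>F0 F d\<^esub> Fa r \<xi>)"
    using Fc_natural_chain[of \<gamma> b d \<zeta> y "Fo f z" "Fa r \<xi>"] pr r by simp
  have "cls (x, a) (z, c) (u, Fa v \<zeta> \<cdot>\<^bsub>F0 F (Cod U u)\<^esub> \<xi>, v \<cdot>\<^bsub>U\<^esub> f)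
     = cls (x, a) (z, c) (premor_comp A F y r s \<gamma> (Ide U b, \<zeta>, f) (u, \<xi>, v))"
    unfolding premor_comp_eq
  proof (rule cls_eqI)
    show "refines (x, a) (z, c) (u, Fa v \<zeta> \<cdot>\<^bsub>F0 F (Cod U u)\<^esub> \<xi>, v \<cdot>\<^bsub>U\<^esub> f)
     (r \<cdot>\<^bsub>U\<^esub> u, Fa s \<zeta> \<cdot>\<^bsub>F0 F (Cod U r)\<^esub> (Fc \<gamma> y \<cdot>\<^bsub>F0 F (Cod U r)\<^esub> Fa r \<xi>), s \<cdot>\<^bsub>U\<^esub> f)"
      by (rule refinesI[of r _ _ "Ide V (r \<cdot>\<^bsub>U\<^esub> u)" "\<gamma> \<triangleleft> f"]) (use pr r n in \<open>simp_all add: invertible_Ide\<close>)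
  qed (use pr r in \<open>simp_all add: Pre_iff\<close>)
  then show ?thesis using L_Comp[OF assms(1-5) comp] by simp
qed

text \<open>Here the square is completed by identities, and \<open>\<gamma>\<close> is an identity 2-cell.\<close>
lemma L_Comp_straight:
  assumes "(u, \<xi>, v) \<in> Pre (x, a) (y, b)" "(v, \<zeta>, v') \<in> Pre (y, b) (z, c)"
    "(x, a) \<in> Ob" "(y, b) \<in> Ob" "(z, c) \<in> Ob"
  shows "mor (y, b) (z, c) (v, \<zeta>, v') \<cdot>\<^bsub>L\<^esub> mor (x, a) (y, b) (u, \<xi>, v)
    = mor (x, a) (z, c) (u, \<zeta> \<cdot>\<^bsub>F0 F (Cod U u)\<^esub> \<xi>, v')"
proof -
  have pr: "u \<in> \<Sigma>" "Dom U u = a" "v \<in> Arr U" "Dom U v = b" "Cod U v = Cod U u"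
     "\<xi> \<in> Arr (F0 F (Cod U u))" "Dom (F0 F (Cod U u)) \<xi> = Fo u x" "Cod (F0 F (Cod U u)) \<xi> = Fo v y"
     "v' \<in> Arr U" "Dom U v' = c" "Cod U v' = Cod U u"
     "\<zeta> \<in> Arr (F0 F (Cod U u))" "Dom (F0 F (Cod U u)) \<zeta> = Fo v y" "Cod (F0 F (Cod U u)) \<zeta> = Fo v' z"
     "a \<in> Obj U" "x \<in> Obj (F0 F a)" "b \<in> Obj U" "y \<in> Obj (F0 F b)" "c \<in> Obj U" "z \<in> Obj (F0 F c)"
    using assms by (simp_all add: Pre_iff)
  let ?i = "Ide U (Cod U u)"
  have "composable ?i ?i (Ide V v) (v, \<zeta>, v') (u, \<xi>, v)"
    using pr by (simp add: composable_iff)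
  from L_Comp[OF assms this] show ?thesis using pr by (simp add: premor_comp_eq)
qed

lemma Pre_Ide: "(x, a) \<in> Ob \<Longrightarrow> (Ide U a, Ide (F0 F a) x, Ide U a) \<in> Pre (x, a) (x, a)"
  by (simp add: Pre_iff)

lemma L_Comp_closed:
  assumes "p \<in> Pre X Y" "q \<in> Pre Y Z" "X \<in> Ob" "Y \<in> Ob" "Z \<in> Ob"
  shows "\<exists>t \<in> Pre X Z. mor Y Z q \<cdot>\<^bsub>L\<^esub> mor X Y p = mor X Z t"
proof -
  obtain r s \<gamma> where c: "composable r s \<gamma> q p" by (rule composable_exists[OF assms(1,2)])
  show ?thesis using L_Comp[OF assms c] premor_comp_in_Pre[OF assms(1,2) c assms(3-5)] by auto
qed

lemma L_unit_left:
  assumes "p \<in> Pre X Y" "X \<in> Ob" "Y \<in> Ob"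
  shows "Ide L Y \<cdot>\<^bsub>L\<^esub> mor X Y p = mor X Y p"
proof -
  obtain x a y b u \<xi> v where [simp]: "X = (x, a)" "Y = (y, b)" "p = (u, \<xi>, v)"
    by (metis prod.exhaust)
  show ?thesis
    using L_Comp_post[of u \<xi> v x a y b "Ide (F0 F b) y" "Ide U b" y b] assms Pre_Ide[of y b]
    by (simp add: L_Ide Pre_iff)
qed

lemma L_unit_right:
  assumes "p \<in> Pre X Y" "X \<in> Ob" "Y \<in> Ob"
  shows "mor X Y p \<cdot>\<^bsub>L\<^esub> Ide L X = mor X Y p"
proof -
  obtain x a y b u \<xi> v where [simp]: "X = (x, a)" "Y = (y, b)" "p = (u, \<xi>, v)"
    by (metis prod.exhaust)
  \<comment> \<open>With \<open>u\<close> itself and an identity 2-cell, the composite is \<open>p\<close> on the nose.\<close>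
  have comp: "composable u (Ide U (Cod U u)) (Ide V u) p (Ide U a, Ide (F0 F a) x, Ide U a)"
    using assms by (simp add: composable_iff Pre_iff)
  show ?thesis
    using L_Comp[OF Pre_Ide[of x a] assms(1)[simplified] _ _ _ comp[simplified]] assms
    by (simp add: L_Ide premor_comp_eq Pre_iff)
qed

lemma L_assoc:
  assumes "p \<in> Pre W X" "q \<in> Pre X Y" "t \<in> Pre Y Z" "W \<in> Ob" "X \<in> Ob" "Y \<in> Ob" "Z \<in> Ob"
  shows "(mor Y Z t \<cdot>\<^bsub>L\<^esub> mor X Y q) \<cdot>\<^bsub>L\<^esub> mor W X p = mor Y Z t \<cdot>\<^bsub>L\<^esub> (mor X Y q \<cdot>\<^bsub>L\<^esub> mor W X p)"
proof -
  obtain w a x b y c z d u1 \<xi>1 v1 u2 \<xi>2 v2 u3 \<xi>3 v3 where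
    eq [simp]: "W = (w, a)" "X = (x, b)" "Y = (y, c)" "Z = (z, d)" "p = (u1, \<xi>1, v1)" "q = (u2, \<xi>2, v2)"
      "t = (u3, \<xi>3, v3)"
    by (metis prod.exhaust)
  \<comment> \<open>The 2-cells are chosen for \<open>q\<close> after \<open>p\<close> and for \<open>t\<close> after this composite; from them suitable
    2-cells for the other bracketing are obtained by whiskering.\<close>
  obtain r s \<gamma> where c1: "composable r s \<gamma> q p" by (rule composable_exists[OF assms(1,2)])
  let ?qp = "premor_comp A F x r s \<gamma> q p"
  have qp: "?qp \<in> Pre W Y" using premor_comp_in_Pre[OF assms(1,2) c1] assms by simp
  obtain r' s' \<gamma>' where c2: "composable r' s' \<gamma>' t ?qp" by (rule composable_exists[OF qp assms(3)])
  have c3: "composable (r' \<cdot>\<^bsub>U\<^esub> s) s' \<gamma>' t q"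
    using c1 c2 assms by (simp add: composable_iff premor_comp_eq Pre_iff)
  let ?tq = "premor_comp A F y (r' \<cdot>\<^bsub>U\<^esub> s) s' \<gamma>' t q"
  have tq: "?tq \<in> Pre X Z" using premor_comp_in_Pre[OF assms(2,3) c3] assms by simp
  have c4: "composable (r' \<cdot>\<^bsub>U\<^esub> r) (Ide U (Cod U r')) (r' \<triangleright> \<gamma>) ?tq p"
    using c1 c2 assms by (simp add: composable_iff premor_comp_eq Pre_iff)
  have "premor_comp A F x (r' \<cdot>\<^bsub>U\<^esub> r) (Ide U (Cod U r')) (r' \<triangleright> \<gamma>) ?tq p = premor_comp A F y r' s' \<gamma>' t ?qp"
    using c1 c2 assms by (simp add: composable_iff premor_comp_eq Pre_iff)
  then show ?thesis
    using L_Comp[OF assms(1,2) _ _ _ c1] L_Comp[OF qp assms(3) _ _ _ c2] L_Comp[OF assms(2,3) _ _ _ c3]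
      L_Comp[OF assms(1) tq _ _ _ c4] assms by simp
qed

lemma L_category: "category L"
proof
  fix f assume "f \<in> Arr L"
  then show "Dom L f \<in> Obj L" "Cod L f \<in> Obj L" by (auto elim: L_ArrE)
next
  fix X assume "X \<in> Obj L"
  then show "Ide L X \<in> hom L X X"
    using Pre_Ide by (cases X) (auto simp: hom_def L_Ide)
next
  fix f g X Y Z assume "f \<in> hom L X Y" "g \<in> hom L Y Z"
  then obtain p q where *: "p \<in> Pre X Y" "q \<in> Pre Y Z" "X \<in> Ob" "Y \<in> Ob" "Z \<in> Ob" "f = mor X Y p" "g = mor Y Z q"
    by (auto simp: hom_def elim!: L_ArrE)
  with L_Comp_closed[OF *(1-5)] show "g \<cdot>\<^bsub>L\<^esub> f \<in> hom L X Z" by (auto simp: hom_def)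
next
  fix f X Y assume "f \<in> hom L X Y"
  then obtain p where *: "p \<in> Pre X Y" "X \<in> Ob" "Y \<in> Ob" "f = mor X Y p"
    by (auto simp: hom_def elim!: L_ArrE)
  then show "Ide L Y \<cdot>\<^bsub>L\<^esub> f = f" "f \<cdot>\<^bsub>L\<^esub> Ide L X = f"
    using L_unit_left L_unit_right by auto
next
  fix f g h W X Y Z assume "f \<in> hom L W X" "g \<in> hom L X Y" "h \<in> hom L Y Z"
  then obtain p q t where *: "p \<in> Pre W X" "q \<in> Pre X Y" "t \<in> Pre Y Z" "W \<in> Ob" "X \<in> Ob" "Y \<in> Ob" "Z \<in> Ob"
    "f = mor W X p" "g = mor X Y q" "h = mor Y Z t"
    by (auto simp: hom_def elim!: L_ArrE)
  then show "(h \<cdot>\<^bsub>L\<^esub> g) \<cdot>\<^bsub>L\<^esub> f = h \<cdot>\<^bsub>L\<^esub> (g \<cdot>\<^bsub>L\<^esub> f)"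
    using L_assoc[OF *(1-7)] by simp
qed

end

section \<open>Cones in terms of components\<close>

context sigma_diagram
begin

definition cone_typed where
  "cone_typed E \<theta> \<longleftrightarrow> category E \<and> Leg \<theta> \<in> extensional (Obj U) \<and> Cell \<theta> \<in> extensional (Arr U) \<and>
    (\<forall>a \<in> Obj U. is_functor (Leg \<theta> a) \<and> Fsrc (Leg \<theta> a) = F0 F a \<and> Ftgt (Leg \<theta> a) = E) \<and>
    (\<forall>f \<in> Arr U. is_nat_trans (Cell \<theta> f) \<and>
      Nsrc (Cell \<theta> f) = functor_comp (Leg \<theta> (Cod U f)) (F1 F f) \<and> Ntgt (Cell \<theta> f) = Leg \<theta> (Dom U f))"

text \<open>The axioms of a \<open>\<sigma>\<close>-cone are equations between natural transformations. For families with the correct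
sources and targets they amount to equations between components, in which all identity factors
introduced by whiskering have disappeared; cones are constructed and used in this form only.\<close>
lemma sigma_cone_iff:
  "is_sigma_cone A \<Sigma> F E \<theta> \<longleftrightarrow> cone_typed E \<theta> \<and>
    (\<forall>a \<in> Obj U. \<forall>x \<in> Obj (F0 F a). Ncmp (Cell \<theta> (Ide U a)) x = Ide E (Omap (Leg \<theta> a) x)) \<and>
    (\<forall>f \<in> Arr U. \<forall>g \<in> Arr U. Cod U f = Dom U g \<longrightarrow> (\<forall>x \<in> Obj (F0 F (Dom U f)).
      Ncmp (Cell \<theta> (g \<cdot>\<^bsub>U\<^esub> f)) x = Ncmp (Cell \<theta> f) x \<cdot>\<^bsub>E\<^esub> Ncmp (Cell \<theta> g) (Fo f x))) \<and>
    (\<forall>\<gamma> \<in> Arr V. \<forall>x \<in> Obj (F0 F (Dom U (Dom V \<gamma>))).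
      Ncmp (Cell \<theta> (Dom V \<gamma>)) x = Ncmp (Cell \<theta> (Cod V \<gamma>)) x \<cdot>\<^bsub>E\<^esub> Amap (Leg \<theta> (Cod U (Dom V \<gamma>))) (Fc \<gamma> x)) \<and>
    (\<forall>f \<in> \<Sigma>. \<forall>x \<in> Obj (F0 F (Dom U f)). invertible_arr E (Ncmp (Cell \<theta> f) x))"
proof (cases "cone_typed E \<theta>")
  case True
  then have [simp]: "category E"
    and L [simp]: "\<And>a. a \<in> Obj U \<Longrightarrow> is_functor (Leg \<theta> a)" "\<And>a. a \<in> Obj U \<Longrightarrow> Fsrc (Leg \<theta> a) = F0 F a"
      "\<And>a. a \<in> Obj U \<Longrightarrow> Ftgt (Leg \<theta> a) = E"
    and C [simp]: "\<And>f. f \<in> Arr U \<Longrightarrow> is_nat_trans (Cell \<theta> f)"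
      "\<And>f. f \<in> Arr U \<Longrightarrow> Nsrc (Cell \<theta> f) = functor_comp (Leg \<theta> (Cod U f)) (F1 F f)"
      "\<And>f. f \<in> Arr U \<Longrightarrow> Ntgt (Cell \<theta> f) = Leg \<theta> (Dom U f)"
    by (simp_all add: cone_typed_def)
  have 1: "Cell \<theta> (Ide U a) = nat_id (Leg \<theta> a) \<longleftrightarrow>
      (\<forall>x \<in> Obj (F0 F a). Ncmp (Cell \<theta> (Ide U a)) x = Ide E (Omap (Leg \<theta> a) x))" if "a \<in> Obj U" for a
  proof -
    have "functor_comp (Leg \<theta> a) (functor_id (F0 F a)) = Leg \<theta> a"
      by (rule functor_eqI) (use that in auto)
    then show ?thesis using that by (subst nat_trans_eq_iff) auto
  qed
  have 2: "Cell \<theta> (g \<cdot>\<^bsub>U\<^esub> f) = nat_vcomp (Cell \<theta> f) (nat_hcomp (Cell \<theta> g) (nat_id (F1 F f))) \<longleftrightarrow>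
      (\<forall>x \<in> Obj (F0 F (Dom U f)).
        Ncmp (Cell \<theta> (g \<cdot>\<^bsub>U\<^esub> f)) x = Ncmp (Cell \<theta> f) x \<cdot>\<^bsub>E\<^esub> Ncmp (Cell \<theta> g) (Fo f x))"
    if "f \<in> Arr U" "g \<in> Arr U" "Cod U f = Dom U g" for f g
  proof -
    have "functor_comp (Leg \<theta> (Cod U g)) (functor_comp (F1 F g) (F1 F f))
      = functor_comp (functor_comp (Leg \<theta> (Cod U g)) (F1 F g)) (F1 F f)"
      by (rule functor_eqI) (use that in auto)
    then show ?thesis using that by (subst nat_trans_eq_iff) auto
  qed
  have 3: "Cell \<theta> (Dom V \<gamma>) = nat_vcomp (Cell \<theta> (Cod V \<gamma>)) (nat_hcomp (nat_id (Leg \<theta> (Cod U (Dom V \<gamma>)))) (F2 F \<gamma>)) \<longleftrightarrow>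
      (\<forall>x \<in> Obj (F0 F (Dom U (Dom V \<gamma>))).
        Ncmp (Cell \<theta> (Dom V \<gamma>)) x = Ncmp (Cell \<theta> (Cod V \<gamma>)) x \<cdot>\<^bsub>E\<^esub> Amap (Leg \<theta> (Cod U (Dom V \<gamma>))) (Fc \<gamma> x))"
    if "\<gamma> \<in> Arr V" for \<gamma>
    using that by (subst nat_trans_eq_iff) auto
  have 4: "invertible_arr (functor_cat (F0 F (Dom U f)) E) (Cell \<theta> f) \<longleftrightarrow>
      (\<forall>x \<in> Obj (F0 F (Dom U f)). invertible_arr E (Ncmp (Cell \<theta> f) x))" if "f \<in> Arr U" for f
    using that by (subst functor_cat_invertible_iff) auto
  have mod3: "(\<forall>a b. \<forall>f \<in> hom U a b. \<forall>g \<in> hom U a b. \<forall>\<gamma> \<in> hom V f g.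
      Cell \<theta> f = nat_vcomp (Cell \<theta> g) (nat_hcomp (nat_id (Leg \<theta> b)) (F2 F \<gamma>))) \<longleftrightarrow>
    (\<forall>\<gamma> \<in> Arr V. Cell \<theta> (Dom V \<gamma>) = nat_vcomp (Cell \<theta> (Cod V \<gamma>)) (nat_hcomp (nat_id (Leg \<theta> (Cod U (Dom V \<gamma>)))) (F2 F \<gamma>)))"
    by (auto simp: hom_def)
  have typed: "(\<forall>f \<in> Arr U. Cell \<theta> f \<in> hom (functor_cat (F0 F (Dom U f)) E)
        (functor_comp (Leg \<theta> (Cod U f)) (F1 F f)) (Leg \<theta> (Dom U f)))"
    "\<forall>a \<in> Obj U. Leg \<theta> a \<in> functors (F0 F a) E"
    by (auto simp: hom_def functors_iff)
  show ?thesis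
    unfolding is_sigma_cone_def mod3 unfolding Ball_hom Ball_hom2
    using True typed 1 2 3 4 Sigma_in_Arr by (auto simp: cone_typed_def)
next
  case False
  then show ?thesis by (auto simp: is_sigma_cone_def cone_typed_def functors_iff hom_def)
qed

end

locale sigma_cone = sigma_diagram A \<Sigma> F
  for A :: "('a, 'f, 'c) two_cat" and \<Sigma> :: "'f set" and F :: "('a, 'f, 'c, 'o, 'm) cat_valued" +
  fixes E :: "('p, 'q) cat" and \<theta> :: "('a, 'f, 'o, 'm, 'p, 'q) cone"
  assumes cone: "is_sigma_cone A \<Sigma> F E \<theta>"

begin

lemma cone_simps [simp]:
  "category E"
  "a \<in> Obj U \<Longrightarrow> is_functor (Leg \<theta> a)" "a \<in> Obj U \<Longrightarrow> Fsrc (Leg \<theta> a) = F0 F a"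
  "a \<in> Obj U \<Longrightarrow> Ftgt (Leg \<theta> a) = E"
  "f \<in> Arr U \<Longrightarrow> is_nat_trans (Cell \<theta> f)"
  "f \<in> Arr U \<Longrightarrow> Nsrc (Cell \<theta> f) = functor_comp (Leg \<theta> (Cod U f)) (F1 F f)"
  "f \<in> Arr U \<Longrightarrow> Ntgt (Cell \<theta> f) = Leg \<theta> (Dom U f)"
  "a \<in> Obj U \<Longrightarrow> x \<in> Obj (F0 F a) \<Longrightarrow> Ncmp (Cell \<theta> (Ide U a)) x = Ide E (Omap (Leg \<theta> a) x)"
  "f \<in> Arr U \<Longrightarrow> g \<in> Arr U \<Longrightarrow> Cod U f = Dom U g \<Longrightarrow> x \<in> Obj (F0 F (Dom U f)) \<Longrightarrow>
    Ncmp (Cell \<theta> (g \<cdot>\<^bsub>U\<^esub> f)) x = Ncmp (Cell \<theta> f) x \<cdot>\<^bsub>E\<^esub> Ncmp (Cell \<theta> g) (Fo f x)"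
  "f \<in> \<Sigma> \<Longrightarrow> x \<in> Obj (F0 F (Dom U f)) \<Longrightarrow> invertible_arr E (Ncmp (Cell \<theta> f) x)"
  using cone unfolding sigma_cone_iff cone_typed_def by blast+

lemma cone_extensional: "Leg \<theta> \<in> extensional (Obj U)" "Cell \<theta> \<in> extensional (Arr U)"
  using cone unfolding is_sigma_cone_def by blast+

lemma cone_cell:
  assumes "\<gamma> \<in> Arr V" "Dom U (Dom V \<gamma>) = a" "Cod U (Dom V \<gamma>) = b" "x \<in> Obj (F0 F a)"
  shows "Ncmp (Cell \<theta> (Cod V \<gamma>)) x \<cdot>\<^bsub>E\<^esub> Amap (Leg \<theta> b) (Fc \<gamma> x) = Ncmp (Cell \<theta> (Dom V \<gamma>)) x"
  using cone assms unfolding sigma_cone_iff by auto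

lemma cone_natural:
  assumes "f \<in> Arr U" "Dom U f = a" "Cod U f = b" "\<xi> \<in> Arr (F0 F a)" "Dom (F0 F a) \<xi> = x" "Cod (F0 F a) \<xi> = y"
  shows "Ncmp (Cell \<theta> f) y \<cdot>\<^bsub>E\<^esub> Amap (Leg \<theta> b) (Fa f \<xi>) = Amap (Leg \<theta> a) \<xi> \<cdot>\<^bsub>E\<^esub> Ncmp (Cell \<theta> f) x"
  using nat_trans_natural[of "Cell \<theta> f" \<xi> E x y] assms by auto

abbreviation "To a x \<equiv> Omap (Leg \<theta> a) x"

abbreviation "Ta a \<xi> \<equiv> Amap (Leg \<theta> a) \<xi>"

abbreviation "Tc f x \<equiv> Ncmp (Cell \<theta> f) x"

lemma postcompose_simps [simp]:
  assumes "is_functor H" "Fsrc H = E"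
  shows "a \<in> Obj U \<Longrightarrow> Leg (postcompose_cone A H \<theta>) a = functor_comp H (Leg \<theta> a)"
    "f \<in> Arr U \<Longrightarrow> Nsrc (Cell (postcompose_cone A H \<theta>) f) = functor_comp H (Nsrc (Cell \<theta> f))"
    "f \<in> Arr U \<Longrightarrow> Ntgt (Cell (postcompose_cone A H \<theta>) f) = functor_comp H (Ntgt (Cell \<theta> f))"
    "f \<in> Arr U \<Longrightarrow> x \<in> Obj (F0 F (Dom U f)) \<Longrightarrow>
      Ncmp (Cell (postcompose_cone A H \<theta>) f) x = Amap H (Ncmp (Cell \<theta> f) x)"
  using assms by (simp_all add: postcompose_cone_def)

lemma postcompose_cone:
  assumes H: "is_functor H" "Fsrc H = E" "Ftgt H = D"
  shows "is_sigma_cone A \<Sigma> F D (postcompose_cone A H \<theta>)"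
  unfolding sigma_cone_iff
proof (intro conjI ballI impI)
  have "category D" using functorD(2)[OF H(1)] H by simp
  moreover have "is_nat_trans (Cell (postcompose_cone A H \<theta>) f)" if "f \<in> Arr U" for f
    using that H by (simp add: postcompose_cone_def)
  moreover have "functor_comp H (functor_comp (Leg \<theta> (Cod U f)) (F1 F f))
    = functor_comp (functor_comp H (Leg \<theta> (Cod U f))) (F1 F f)" if "f \<in> Arr U" for f
    by (rule functor_eqI) (use that H in auto)
  moreover have "Leg (postcompose_cone A H \<theta>) \<in> extensional (Obj U)"
    "Cell (postcompose_cone A H \<theta>) \<in> extensional (Arr U)"
    by (simp_all add: postcompose_cone_def)
  ultimately show "cone_typed D (postcompose_cone A H \<theta>)"
    using H by (simp add: cone_typed_def)
next
  fix \<gamma> x assume \<gamma>: "\<gamma> \<in> Arr V" and x: "x \<in> Obj (F0 F (Dom U (Dom V \<gamma>)))"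
  show "Ncmp (Cell (postcompose_cone A H \<theta>) (Dom V \<gamma>)) x =
    Ncmp (Cell (postcompose_cone A H \<theta>) (Cod V \<gamma>)) x \<cdot>\<^bsub>D\<^esub> Amap (Leg (postcompose_cone A H \<theta>) (Cod U (Dom V \<gamma>))) (Fc \<gamma> x)"
    using H \<gamma> x arg_cong[OF cone_cell[OF \<gamma> refl refl x], of "Amap H"] by simp
qed (use H in auto)

end

context sigma_diagram
begin

lemma sigma_cone_eqI:
  assumes "is_sigma_cone A \<Sigma> F E \<theta>" "is_sigma_cone A \<Sigma> F E \<theta>'"
    "\<And>a x. a \<in> Obj U \<Longrightarrow> x \<in> Obj (F0 F a) \<Longrightarrow> Omap (Leg \<theta> a) x = Omap (Leg \<theta>' a) x"
    "\<And>a \<xi>. a \<in> Obj U \<Longrightarrow> \<xi> \<in> Arr (F0 F a) \<Longrightarrow> Amap (Leg \<theta> a) \<xi> = Amap (Leg \<theta>' a) \<xi>"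
    "\<And>f x. f \<in> Arr U \<Longrightarrow> x \<in> Obj (F0 F (Dom U f)) \<Longrightarrow> Ncmp (Cell \<theta> f) x = Ncmp (Cell \<theta>' f) x"
  shows "\<theta> = \<theta>'"
proof -
  interpret c: sigma_cone A \<Sigma> F E \<theta> by unfold_locales (rule assms(1))
  interpret c': sigma_cone A \<Sigma> F E \<theta>' by unfold_locales (rule assms(2))
  have leg: "Leg \<theta> a = Leg \<theta>' a" if "a \<in> Obj U" for a
    by (rule functor_eqI) (use that assms(3,4) in auto)
  have "Cell \<theta> f = Cell \<theta>' f" if "f \<in> Arr U" for f
    by (rule nat_trans_eqI) (use that assms(5) leg in auto)
  then show ?thesis
    using leg c.cone_extensional c'.cone_extensional
    by (intro cone.equality) (auto intro: extensionalityI)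
qed

lemma cone_morphism_iff:
  assumes "is_sigma_cone A \<Sigma> F E \<theta>" "is_sigma_cone A \<Sigma> F E \<theta>'"
  shows "is_cone_morphism A F E \<theta> \<theta>' \<phi> \<longleftrightarrow> \<phi> \<in> extensional (Obj U) \<and>
    (\<forall>a \<in> Obj U. is_nat_trans (\<phi> a) \<and> Nsrc (\<phi> a) = Leg \<theta> a \<and> Ntgt (\<phi> a) = Leg \<theta>' a) \<and>
    (\<forall>f \<in> Arr U. \<forall>x \<in> Obj (F0 F (Dom U f)).
      Ncmp (Cell \<theta>' f) x \<cdot>\<^bsub>E\<^esub> Ncmp (\<phi> (Cod U f)) (Fo f x) = Ncmp (\<phi> (Dom U f)) x \<cdot>\<^bsub>E\<^esub> Ncmp (Cell \<theta> f) x)"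
    (is "?L \<longleftrightarrow> ?ext \<and> ?ty \<and> ?nat")
proof -
  interpret c: sigma_cone A \<Sigma> F E \<theta> by unfold_locales (rule assms(1))
  interpret c': sigma_cone A \<Sigma> F E \<theta>' by unfold_locales (rule assms(2))
  have ty: "(\<forall>a \<in> Obj U. \<phi> a \<in> hom (functor_cat (F0 F a) E) (Leg \<theta> a) (Leg \<theta>' a)) \<longleftrightarrow> ?ty"
    by (auto simp: hom_def)
  have "(\<forall>f \<in> Arr U. nat_vcomp (Cell \<theta>' f) (nat_hcomp (\<phi> (Cod U f)) (nat_id (F1 F f)))
      = nat_vcomp (\<phi> (Dom U f)) (Cell \<theta> f)) \<longleftrightarrow> ?nat" if ?ty
  proof (rule ball_cong[OF refl])
    fix f assume f: "f \<in> Arr U"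
    show "nat_vcomp (Cell \<theta>' f) (nat_hcomp (\<phi> (Cod U f)) (nat_id (F1 F f))) = nat_vcomp (\<phi> (Dom U f)) (Cell \<theta> f) \<longleftrightarrow>
      (\<forall>x \<in> Obj (F0 F (Dom U f)).
      Ncmp (Cell \<theta>' f) x \<cdot>\<^bsub>E\<^esub> Ncmp (\<phi> (Cod U f)) (Fo f x) = Ncmp (\<phi> (Dom U f)) x \<cdot>\<^bsub>E\<^esub> Ncmp (Cell \<theta> f) x)"
      using f that by (subst nat_trans_eq_iff) auto
  qed
  then show ?thesis unfolding is_cone_morphism_def Ball_hom ty by blast
qed

lemma sigma_cones_simps [simp]:
  "Obj (sigma_cones A \<Sigma> F E) = {\<theta>. is_sigma_cone A \<Sigma> F E \<theta>}"
  "(\<theta>, \<phi>, \<theta>') \<in> Arr (sigma_cones A \<Sigma> F E) \<longleftrightarrow> is_sigma_cone A \<Sigma> F E \<theta> \<and> is_sigma_cone A \<Sigma> F E \<theta>' \<and>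
                       is_cone_morphism A F E \<theta> \<theta>' \<phi>"
  "Dom (sigma_cones A \<Sigma> F E) (\<theta>, \<phi>, \<theta>') = \<theta>"
  "Cod (sigma_cones A \<Sigma> F E) (\<theta>, \<phi>, \<theta>') = \<theta>'"
  "Ide (sigma_cones A \<Sigma> F E) \<theta> = (\<theta>, (\<lambda>a\<in>Obj U. nat_id (Leg \<theta> a)), \<theta>)"
  "(\<theta>\<^sub>1, \<psi>, \<theta>\<^sub>2) \<cdot>\<^bsub>sigma_cones A \<Sigma> F E\<^esub> (\<theta>\<^sub>0, \<phi>, \<theta>') = (\<theta>\<^sub>0, (\<lambda>a\<in>Obj U. nat_vcomp (\<psi> a) (\<phi> a)), \<theta>\<^sub>2)"
  by (simp_all add: sigma_cones_def)

lemma cone_morphism_id: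
  assumes "is_sigma_cone A \<Sigma> F E \<theta>"
  shows "is_cone_morphism A F E \<theta> \<theta> (\<lambda>a\<in>Obj U. nat_id (Leg \<theta> a))"
proof -
  interpret sigma_cone A \<Sigma> F E \<theta> by unfold_locales (rule assms)
  show ?thesis unfolding cone_morphism_iff[OF assms assms] by auto
qed

lemma cone_morphism_comp:
  assumes c: "is_sigma_cone A \<Sigma> F E \<theta>\<^sub>0" "is_sigma_cone A \<Sigma> F E \<theta>\<^sub>1" "is_sigma_cone A \<Sigma> F E \<theta>\<^sub>2"
    and "is_cone_morphism A F E \<theta>\<^sub>0 \<theta>\<^sub>1 \<phi>" "is_cone_morphism A F E \<theta>\<^sub>1 \<theta>\<^sub>2 \<psi>"
  shows "is_cone_morphism A F E \<theta>\<^sub>0 \<theta>\<^sub>2 (\<lambda>a\<in>Obj U. nat_vcomp (\<psi> a) (\<phi> a))"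
proof -
  interpret c0: sigma_cone A \<Sigma> F E \<theta>\<^sub>0 by unfold_locales (rule c)
  interpret c1: sigma_cone A \<Sigma> F E \<theta>\<^sub>1 by unfold_locales (rule c)
  interpret c2: sigma_cone A \<Sigma> F E \<theta>\<^sub>2 by unfold_locales (rule c)
  have \<phi>: "is_nat_trans (\<phi> a)" "Nsrc (\<phi> a) = Leg \<theta>\<^sub>0 a" "Ntgt (\<phi> a) = Leg \<theta>\<^sub>1 a"
    and \<psi>: "is_nat_trans (\<psi> a)" "Nsrc (\<psi> a) = Leg \<theta>\<^sub>1 a" "Ntgt (\<psi> a) = Leg \<theta>\<^sub>2 a" if "a \<in> Obj U" for a
    using assms(4,5) that unfolding cone_morphism_iff[OF c(1,2)] cone_morphism_iff[OF c(2,3)] by auto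
  show ?thesis unfolding cone_morphism_iff[OF c(1,3)]
  proof (intro conjI ballI)
    fix f x assume f: "f \<in> Arr U" and x: "x \<in> Obj (F0 F (Dom U f))"
    let ?a = "Dom U f" and ?b = "Cod U f"
    have *: "Ncmp (Cell \<theta>\<^sub>1 f) x \<cdot>\<^bsub>E\<^esub> Ncmp (\<phi> ?b) (Fo f x) = Ncmp (\<phi> ?a) x \<cdot>\<^bsub>E\<^esub> Ncmp (Cell \<theta>\<^sub>0 f) x"
      "Ncmp (Cell \<theta>\<^sub>2 f) x \<cdot>\<^bsub>E\<^esub> Ncmp (\<psi> ?b) (Fo f x) = Ncmp (\<psi> ?a) x \<cdot>\<^bsub>E\<^esub> Ncmp (Cell \<theta>\<^sub>1 f) x"
      using assms(4,5) f x unfolding cone_morphism_iff[OF c(1,2)] cone_morphism_iff[OF c(2,3)] by auto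
    have "Ncmp (Cell \<theta>\<^sub>2 f) x \<cdot>\<^bsub>E\<^esub> (Ncmp (\<psi> ?b) (Fo f x) \<cdot>\<^bsub>E\<^esub> Ncmp (\<phi> ?b) (Fo f x))
      = (Ncmp (\<psi> ?a) x \<cdot>\<^bsub>E\<^esub> Ncmp (\<phi> ?a) x) \<cdot>\<^bsub>E\<^esub> Ncmp (Cell \<theta>\<^sub>0 f) x"
      by (rule square_comp[OF _ _ _ _ _ _ _ _ _ _ _ _ _ _ _ _ *]) (use f x \<phi> \<psi> in simp_all)
    then show "Ncmp (Cell \<theta>\<^sub>2 f) x \<cdot>\<^bsub>E\<^esub> Ncmp ((\<lambda>a\<in>Obj U. nat_vcomp (\<psi> a) (\<phi> a)) ?b) (Fo f x)
      = Ncmp ((\<lambda>a\<in>Obj U. nat_vcomp (\<psi> a) (\<phi> a)) ?a) x \<cdot>\<^bsub>E\<^esub> Ncmp (Cell \<theta>\<^sub>0 f) x"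
      using f x \<phi> \<psi> by simp
  qed (use \<phi> \<psi> in auto)
qed

lemma cone_morphismD:
  assumes "is_cone_morphism A F E \<theta> \<theta>' \<phi>"
  shows "\<phi> \<in> extensional (Obj U)" "a \<in> Obj U \<Longrightarrow> is_nat_trans (\<phi> a)" "a \<in> Obj U \<Longrightarrow> Nsrc (\<phi> a) = Leg \<theta> a"
    "a \<in> Obj U \<Longrightarrow> Ntgt (\<phi> a) = Leg \<theta>' a"
  using assms by (auto simp: is_cone_morphism_def hom_def)

lemma sigma_cones_category: "category (sigma_cones A \<Sigma> F E)" (is "category ?S")
proof
  fix f assume f: "f \<in> Arr ?S"
  obtain t p t' where [simp]: "f = (t, p, t')" by (cases f)
  show "Dom ?S f \<in> Obj ?S" "Cod ?S f \<in> Obj ?S" using f by simp_all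
next
  fix t assume "t \<in> Obj ?S"
  then show "Ide ?S t \<in> hom ?S t t" by (simp add: hom_def cone_morphism_id)
next
  fix f g t0 t1 t2 assume f: "f \<in> hom ?S t0 t1" and g: "g \<in> hom ?S t1 t2"
  obtain p q where [simp]: "f = (t0, p, t1)" "g = (t1, q, t2)"
    using f g by (cases f, cases g) (auto simp: hom_def)
  show "g \<cdot>\<^bsub>?S\<^esub> f \<in> hom ?S t0 t2" using f g by (auto simp: hom_def intro: cone_morphism_comp)
next
  fix f t t' assume f: "f \<in> hom ?S t t'"
  obtain p where [simp]: "f = (t, p, t')" using f by (cases f) (auto simp: hom_def)
  have p: "is_cone_morphism A F E t t' p" using f by (simp add: hom_def)
  have "nat_vcomp (nat_id (Leg t' a)) (p a) = p a" "nat_vcomp (p a) (nat_id (Leg t a)) = p a" if "a \<in> Obj U" for a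
    using nat_vcomp_unit[of "p a"] cone_morphismD[OF p] that by auto
  then have "(\<lambda>a\<in>Obj U. nat_vcomp ((\<lambda>a\<in>Obj U. nat_id (Leg t' a)) a) (p a)) = p"
    "(\<lambda>a\<in>Obj U. nat_vcomp (p a) ((\<lambda>a\<in>Obj U. nat_id (Leg t a)) a)) = p"
    using cone_morphismD(1)[OF p] by (auto intro!: extensionalityI[of _ "Obj U"])
  then show "Ide ?S t' \<cdot>\<^bsub>?S\<^esub> f = f" "f \<cdot>\<^bsub>?S\<^esub> Ide ?S t = f" by simp_all
next
  fix f g h t0 t1 t2 t3 assume f: "f \<in> hom ?S t0 t1" and g: "g \<in> hom ?S t1 t2" and h: "h \<in> hom ?S t2 t3"
  obtain p q r where [simp]: "f = (t0, p, t1)" "g = (t1, q, t2)" "h = (t2, r, t3)"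
    using f g h by (cases f, cases g, cases h) (auto simp: hom_def)
  have m: "is_cone_morphism A F E t0 t1 p" "is_cone_morphism A F E t1 t2 q" "is_cone_morphism A F E t2 t3 r"
    using f g h by (simp_all add: hom_def)
  have "nat_vcomp (nat_vcomp (r a) (q a)) (p a) = nat_vcomp (r a) (nat_vcomp (q a) (p a))" if "a \<in> Obj U" for a
    using that cone_morphismD[OF m(1)] cone_morphismD[OF m(2)] cone_morphismD[OF m(3)]
    by (intro nat_vcomp_assoc) simp_all
  then show "(h \<cdot>\<^bsub>?S\<^esub> g) \<cdot>\<^bsub>?S\<^esub> f = h \<cdot>\<^bsub>?S\<^esub> (g \<cdot>\<^bsub>?S\<^esub> f)" by (auto intro: restrict_ext)
qed

end

section \<open>The cone \<open>\<lambda>\<close>\<close>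

context filtered_diagram
begin

abbreviation "lam \<equiv> lambda_cone A \<Sigma> F"

lemma lam_simps [simp]:
  "a \<in> Obj U \<Longrightarrow> Fsrc (Leg lam a) = F0 F a" "a \<in> Obj U \<Longrightarrow> Ftgt (Leg lam a) = L"
  "\<lbrakk>a \<in> Obj U; x \<in> Obj (F0 F a)\<rbrakk> \<Longrightarrow> Omap (Leg lam a) x = (x, a)"
  "\<lbrakk>a \<in> Obj U; \<xi> \<in> Arr (F0 F a)\<rbrakk> \<Longrightarrow> Amap (Leg lam a) \<xi>
    = mor (Dom (F0 F a) \<xi>, a) (Cod (F0 F a) \<xi>, a) (Ide U a, \<xi>, Ide U a)"
  "f \<in> Arr U \<Longrightarrow> Nsrc (Cell lam f) = functor_comp (Leg lam (Cod U f)) (F1 F f)"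
  "f \<in> Arr U \<Longrightarrow> Ntgt (Cell lam f) = Leg lam (Dom U f)"
  "\<lbrakk>f \<in> Arr U; x \<in> Obj (F0 F (Dom U f))\<rbrakk> \<Longrightarrow> Ncmp (Cell lam f) x
    = mor (Fo f x, Cod U f) (x, Dom U f) (Ide U (Cod U f), Ide (F0 F (Cod U f)) (Fo f x), f)"
  by (simp_all add: lambda_cone_def lambda_leg_def lambda_cell_def Let_def)

lemma lam_leg_functor [simp]:
  assumes "a \<in> Obj U"
  shows "is_functor (Leg lam a)"
proof (rule functorI)
  fix \<xi> \<zeta> assume "\<xi> \<in> Arr (Fsrc (Leg lam a))" "\<zeta> \<in> Arr (Fsrc (Leg lam a))"
    "Cod (Fsrc (Leg lam a)) \<xi> = Dom (Fsrc (Leg lam a)) \<zeta>"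
  then show "Amap (Leg lam a) (\<zeta> \<cdot>\<^bsub>Fsrc (Leg lam a)\<^esub> \<xi>) = Amap (Leg lam a) \<zeta> \<cdot>\<^bsub>Ftgt (Leg lam a)\<^esub> Amap (Leg lam a) \<xi>"
    using assms by (simp add: L_Comp_post Pre_iff)
qed (use assms in \<open>simp_all add: L_category L_Ide Pre_iff\<close>, simp_all add: lambda_cone_def lambda_leg_def)

lemma lam_cell_nat_trans [simp]:
  assumes "f \<in> Arr U"
  shows "is_nat_trans (Cell lam f)"
proof (rule nat_transI)
  fix \<xi> assume "\<xi> \<in> Arr (Fsrc (Nsrc (Cell lam f)))"
  then have x: "\<xi> \<in> Arr (F0 F (Dom U f))" using assms by simp
  show "Ncmp (Cell lam f) (Cod (Fsrc (Nsrc (Cell lam f))) \<xi>) \<cdot>\<^bsub>Ftgt (Nsrc (Cell lam f))\<^esub> Amap (Nsrc (Cell lam f)) \<xi>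
    = Amap (Ntgt (Cell lam f)) \<xi> \<cdot>\<^bsub>Ftgt (Nsrc (Cell lam f))\<^esub> Ncmp (Cell lam f) (Dom (Fsrc (Nsrc (Cell lam f))) \<xi>)"
    using assms x by (simp add: L_Comp_post Pre_iff)
qed (use assms in \<open>simp_all add: Pre_iff\<close>, simp add: lambda_cone_def lambda_cell_def Let_def)

text \<open>The right-hand side is the class of \<open>(id, F(\<gamma>)\<^sub>x, g)\<close>, which refines \<open>(id, id, f)\<close> along \<open>\<gamma> : f \<Rightarrow> g\<close>.\<close>
lemma lam_cell_vertical:
  assumes "\<gamma> \<in> Arr V" "x \<in> Obj (F0 F (Dom U (Dom V \<gamma>)))"
  shows "Ncmp (Cell lam (Dom V \<gamma>)) x
    = Ncmp (Cell lam (Cod V \<gamma>)) x \<cdot>\<^bsub>L\<^esub> Amap (Leg lam (Cod U (Dom V \<gamma>))) (Fc \<gamma> x)"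
proof -
  let ?b = "Cod U (Dom V \<gamma>)" and ?a = "Dom U (Dom V \<gamma>)" and ?X = "(Fo (Dom V \<gamma>) x, Cod U (Dom V \<gamma>))"
  have "cls ?X (x, ?a) (Ide U ?b, Ide (F0 F ?b) (Fo (Dom V \<gamma>) x), Dom V \<gamma>)
    = cls ?X (x, ?a) (Ide U ?b, Fc \<gamma> x, Cod V \<gamma>)"
  proof (rule cls_eqI)
    show "refines ?X (x, ?a) (Ide U ?b, Ide (F0 F ?b) (Fo (Dom V \<gamma>) x), Dom V \<gamma>) (Ide U ?b, Fc \<gamma> x, Cod V \<gamma>)"
      by (rule refinesI[of "Ide U ?b" _ _ "Ide V (Ide U ?b)" \<gamma>]) (use assms in \<open>simp_all add: invertible_Ide\<close>)
  qed (use assms in \<open>simp_all add: Pre_iff\<close>)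
  then show ?thesis using assms by (simp add: L_Comp_post Pre_iff)
qed

text \<open>An arrow of \<open>\<Sigma>\<close> may be exchanged with the identity in the first and third place of a premorphism, and
this gives the inverse. One of the two composites is \<open>(f, id, f)\<close>, a refinement of the identity along
\<open>f\<close>; the other one is an identity premorphism.\<close>
lemma lam_cell_invertible:
  assumes "f \<in> \<Sigma>" "x \<in> Obj (F0 F (Dom U f))"
  shows "invertible_arr L (Ncmp (Cell lam f) x)"
    and "Inv L (Ncmp (Cell lam f) x) = mor (x, Dom U f) (Fo f x, Cod U f)
      (f, Ide (F0 F (Cod U f)) (Fo f x), Ide U (Cod U f))"
proof -
  let ?a = "Dom U f" and ?b = "Cod U f"
  let ?g = "mor (x, ?a) (Fo f x, ?b) (f, Ide (F0 F ?b) (Fo f x), Ide U ?b)"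
  have "cls (x, ?a) (x, ?a) (Ide U ?a, Ide (F0 F ?a) x, Ide U ?a) = cls (x, ?a) (x, ?a) (f, Ide (F0 F ?b) (Fo f x), f)"
  proof (rule cls_eqI)
    show "refines (x, ?a) (x, ?a) (Ide U ?a, Ide (F0 F ?a) x, Ide U ?a) (f, Ide (F0 F ?b) (Fo f x), f)"
      by (rule refinesI[of f _ _ "Ide V f" "Ide V f"]) (use assms in \<open>simp_all add: invertible_Ide\<close>)
  qed (use assms in \<open>simp_all add: Pre_iff\<close>)
  then have 1: "Ncmp (Cell lam f) x \<cdot>\<^bsub>L\<^esub> ?g = Ide L (x, ?a)"
    using assms by (simp add: L_Comp_post Pre_iff L_Ide)
  have 2: "?g \<cdot>\<^bsub>L\<^esub> Ncmp (Cell lam f) x = Ide L (Fo f x, ?b)"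
    using assms by (simp add: L_Comp_straight Pre_iff L_Ide)
  show "invertible_arr L (Ncmp (Cell lam f) x)"
    by (rule invertible_arrI[of _ _ ?g]) (use 1 2 assms in \<open>simp_all add: L_category Pre_iff\<close>)
  show "Inv L (Ncmp (Cell lam f) x) = ?g"
    by (rule Inv_unique) (use 1 2 assms in \<open>simp_all add: L_category Pre_iff\<close>)
qed

lemma lam_cone: "is_sigma_cone A \<Sigma> F L lam"
  unfolding sigma_cone_iff
proof (intro conjI ballI impI)
  show "cone_typed L lam"
    by (auto simp: cone_typed_def L_category) (simp_all add: lambda_cone_def)
next
  fix f g x assume "f \<in> Arr U" "g \<in> Arr U" "Cod U f = Dom U g" "x \<in> Obj (F0 F (Dom U f))"
  then show "Ncmp (Cell lam (g \<cdot>\<^bsub>U\<^esub> f)) x = Ncmp (Cell lam f) x \<cdot>\<^bsub>L\<^esub> Ncmp (Cell lam g) (Fo f x)"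
    by (simp add: L_Comp_post Pre_iff)
next
  fix \<gamma> x assume "\<gamma> \<in> Arr V" "x \<in> Obj (F0 F (Dom U (Dom V \<gamma>)))"
  then show "Ncmp (Cell lam (Dom V \<gamma>)) x
    = Ncmp (Cell lam (Cod V \<gamma>)) x \<cdot>\<^bsub>L\<^esub> Amap (Leg lam (Cod U (Dom V \<gamma>))) (Fc \<gamma> x)"
    by (rule lam_cell_vertical)
next
  fix f x assume "f \<in> \<Sigma>" "x \<in> Obj (F0 F (Dom U f))"
  then show "invertible_arr L (Ncmp (Cell lam f) x)" by (rule lam_cell_invertible)
qed (simp add: L_Ide)

sublocale lam: sigma_cone A \<Sigma> F L lam
  by unfold_locales (rule lam_cone)

text \<open>In both composites on the right the left factor is represented by a premorphism whose first arrow is an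
identity, so \<open>L_Comp_post\<close> computes them. Hence the legs of \<open>\<lambda>\<close>, the components of its cells and
the inverses of such components generate \<open>\<L>\<^sub>\<sigma>(F)\<close>.\<close>
lemma mor_decomposition:
  assumes "(u, \<xi>, v) \<in> Pre (x, a) (y, b)" "(x, a) \<in> Ob" "(y, b) \<in> Ob"
  shows "mor (x, a) (y, b) (u, \<xi>, v) =
    Ncmp (Cell lam v) y \<cdot>\<^bsub>L\<^esub> (Amap (Leg lam (Cod U u)) \<xi> \<cdot>\<^bsub>L\<^esub> Inv L (Ncmp (Cell lam u) x))"
proof -
  have "u \<in> \<Sigma>" "Dom U u = a" using assms by (simp_all add: Pre_iff)
  then have "Inv L (Ncmp (Cell lam u) x) = mor (x, a) (Fo u x, Cod U u) (u, Ide (F0 F (Cod U u)) (Fo u x), Ide U (Cod U u))"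
    using lam_cell_invertible(2)[of u x] assms by auto
  then show ?thesis using assms by (simp add: L_Comp_post Pre_iff)
qed

end

section \<open>The functor induced by a cone\<close>

context sigma_cone
begin

text \<open>The decomposition of \<open>[(u, \<xi>, v)]\<close>, with \<open>\<theta>\<close> in the place of \<open>\<lambda>\<close>: no other value on this class is
compatible with a factorization of \<open>\<theta>\<close>.\<close>
definition cone_value :: "'o \<times> 'a \<Rightarrow> 'o \<times> 'a \<Rightarrow> 'f \<times> 'm \<times> 'f \<Rightarrow> 'q"
  where "cone_value = (\<lambda>(x, a) (y, b) (u, \<xi>, v). Tc v y \<cdot>\<^bsub>E\<^esub> (Ta (Cod U u) \<xi> \<cdot>\<^bsub>E\<^esub> Inv E (Tc u x)))"

lemma cone_value_eq: "cone_value (x, a) (y, b) (u, \<xi>, v) = Tc v y \<cdot>\<^bsub>E\<^esub> (Ta (Cod U u) \<xi> \<cdot>\<^bsub>E\<^esub> Inv E (Tc u x))"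
  by (simp add: cone_value_def)

lemma cone_value_typed:
  assumes "p \<in> Pre X Y" "X \<in> Ob" "Y \<in> Ob"
  shows "cone_value X Y p \<in> Arr E" "Dom E (cone_value X Y p) = To (snd X) (fst X)" "Cod E (cone_value X Y p) = To (snd Y) (fst Y)"
  using assms by (cases X, cases Y, cases p, simp add: cone_value_eq Pre_iff)+

text \<open>By the cone axiom for 2-cells, the image of \<open>\<beta>\<close> turns the cell of \<open>\<theta>\<close> at the new third arrow into the one
at \<open>w v\<close>, and the image of \<open>\<alpha>\<close> turns the one at \<open>w u\<close> into the one at the new first arrow. What remains of
\<open>w\<close> is \<open>\<theta>\<^sub>w\<close>, which moves past the image of \<open>\<xi>\<close> by naturality and cancels.\<close>
lemma cone_value_refines:
  assumes "refines X Y p q" "p \<in> Pre X Y" "q \<in> Pre X Y" "X \<in> Ob" "Y \<in> Ob"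
  shows "cone_value X Y q = cone_value X Y p"
proof -
  obtain x a y b u \<xi> v u' \<xi>' v' where
    eq [simp]: "X = (x, a)" "Y = (y, b)" "p = (u, \<xi>, v)" "q = (u', \<xi>', v')"
    by (metis prod.exhaust)
  have pr: "u \<in> \<Sigma>" "Dom U u = a" "v \<in> Arr U" "Dom U v = b" "Cod U v = Cod U u"
     "\<xi> \<in> Arr (F0 F (Cod U u))" "Dom (F0 F (Cod U u)) \<xi> = Fo u x" "Cod (F0 F (Cod U u)) \<xi> = Fo v y"
     "u' \<in> \<Sigma>" "Dom U u' = a" "v' \<in> Arr U" "Dom U v' = b" "Cod U v' = Cod U u'"
     "a \<in> Obj U" "x \<in> Obj (F0 F a)" "b \<in> Obj U" "y \<in> Obj (F0 F b)"
    using assms by (simp_all add: Pre_iff)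
  obtain w \<alpha> \<beta> where w: "w \<in> \<Sigma>" "Dom U w = Cod U u" "Cod U w = Cod U u'"
    and \<alpha>: "\<alpha> \<in> Arr V" "Dom V \<alpha> = u'" "Cod V \<alpha> = w \<cdot>\<^bsub>U\<^esub> u" "invertible_arr V \<alpha>"
    and \<beta>: "\<beta> \<in> Arr V" "Dom V \<beta> = w \<cdot>\<^bsub>U\<^esub> v" "Cod V \<beta> = v'"
    and \<xi>': "\<xi>' = Fc \<beta> y \<cdot>\<^bsub>F0 F (Cod U u')\<^esub> (Fa w \<xi> \<cdot>\<^bsub>F0 F (Cod U u')\<^esub> Fc \<alpha> x)"
    using assms(1) by (auto elim: refinesE)
  note typed = pr w \<alpha> \<beta>
  let ?c' = "Cod U u'" and ?c = "Cod U u"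
  let ?i = "Inv E (Tc u' x)"
  have c\<beta>: "Tc v y \<cdot>\<^bsub>E\<^esub> Tc w (Fo v y) = Tc v' y \<cdot>\<^bsub>E\<^esub> Ta ?c' (Fc \<beta> y)"
    using cone_cell[of \<beta> b ?c' y] typed by simp
  have c\<alpha>: "Tc u' x = Tc u x \<cdot>\<^bsub>E\<^esub> (Tc w (Fo u x) \<cdot>\<^bsub>E\<^esub> Ta ?c' (Fc \<alpha> x))"
    using cone_cell[of \<alpha> a ?c' x] typed by simp
  have n: "Tc w (Fo v y) \<cdot>\<^bsub>E\<^esub> Ta ?c' (Fa w \<xi>) = Ta ?c \<xi> \<cdot>\<^bsub>E\<^esub> Tc w (Fo u x)"
    using cone_natural[of w ?c ?c' \<xi> "Fo u x" "Fo v y"] typed by simp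
  have i: "Tc w (Fo u x) \<cdot>\<^bsub>E\<^esub> (Ta ?c' (Fc \<alpha> x) \<cdot>\<^bsub>E\<^esub> ?i) = Inv E (Tc u x)"
  proof (rule right_inverse_eq_Inv)
    have "Tc u x \<cdot>\<^bsub>E\<^esub> (Tc w (Fo u x) \<cdot>\<^bsub>E\<^esub> (Ta ?c' (Fc \<alpha> x) \<cdot>\<^bsub>E\<^esub> ?i)) =
      (Tc u x \<cdot>\<^bsub>E\<^esub> (Tc w (Fo u x) \<cdot>\<^bsub>E\<^esub> Ta ?c' (Fc \<alpha> x))) \<cdot>\<^bsub>E\<^esub> ?i"
      using typed by simp
    also have "\<dots> = Ide E (Cod E (Tc u x))" unfolding c\<alpha>[symmetric] using typed by simp
    finally show "Tc u x \<cdot>\<^bsub>E\<^esub> (Tc w (Fo u x) \<cdot>\<^bsub>E\<^esub> (Ta ?c' (Fc \<alpha> x) \<cdot>\<^bsub>E\<^esub> ?i)) = Ide E (Cod E (Tc u x))" .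
  qed (use typed in simp_all)
  have "cone_value X Y q = (Tc v' y \<cdot>\<^bsub>E\<^esub> Ta ?c' (Fc \<beta> y)) \<cdot>\<^bsub>E\<^esub> (Ta ?c' (Fa w \<xi>) \<cdot>\<^bsub>E\<^esub> (Ta ?c' (Fc \<alpha> x) \<cdot>\<^bsub>E\<^esub> ?i))"
    using typed by (simp add: cone_value_eq \<xi>')
  also have "\<dots> = Tc v y \<cdot>\<^bsub>E\<^esub> ((Tc w (Fo v y) \<cdot>\<^bsub>E\<^esub> Ta ?c' (Fa w \<xi>)) \<cdot>\<^bsub>E\<^esub> (Ta ?c' (Fc \<alpha> x) \<cdot>\<^bsub>E\<^esub> ?i))"
    unfolding c\<beta>[symmetric] using typed by simp
  also have "\<dots> = Tc v y \<cdot>\<^bsub>E\<^esub> (Ta ?c \<xi> \<cdot>\<^bsub>E\<^esub> (Tc w (Fo u x) \<cdot>\<^bsub>E\<^esub> (Ta ?c' (Fc \<alpha> x) \<cdot>\<^bsub>E\<^esub> ?i)))"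
    unfolding n using typed by simp
  finally show ?thesis unfolding i by (simp add: cone_value_eq)
qed

text \<open>By the naturality of \<open>\<theta>\<^sub>r\<close> and \<open>\<theta>\<^sub>s\<close> the images of \<open>\<xi>\<close> and \<open>\<zeta>\<close> move outwards. Between them remains the
inverse of \<open>\<theta>\<^sub>r\<close>, followed by the image of \<open>\<gamma>\<close> and by \<open>\<theta>\<^sub>s\<close>; by the cone axiom for \<open>\<gamma>\<close> this is the cell at the
third arrow of \<open>p\<close> followed by the inverse of the cell at the first arrow of \<open>q\<close>.\<close>
lemma cone_value_comp:
  assumes "p \<in> Pre X Y" "q \<in> Pre Y Z" "X \<in> Ob" "Y \<in> Ob" "Z \<in> Ob" "composable r s \<gamma> q p"
  shows "cone_value X Z (premor_comp A F (fst Y) r s \<gamma> q p) = cone_value Y Z q \<cdot>\<^bsub>E\<^esub> cone_value X Y p"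
proof -
  obtain x a y b z c u \<xi> v u' \<zeta> v' where
    eq [simp]: "X = (x, a)" "Y = (y, b)" "Z = (z, c)" "p = (u, \<xi>, v)" "q = (u', \<zeta>, v')"
    by (metis prod.exhaust)
  have pr: "u \<in> \<Sigma>" "Dom U u = a" "v \<in> Arr U" "Dom U v = b" "Cod U v = Cod U u"
     "\<xi> \<in> Arr (F0 F (Cod U u))" "Dom (F0 F (Cod U u)) \<xi> = Fo u x" "Cod (F0 F (Cod U u)) \<xi> = Fo v y"
     "u' \<in> \<Sigma>" "Dom U u' = b" "v' \<in> Arr U" "Dom U v' = c" "Cod U v' = Cod U u'"
     "\<zeta> \<in> Arr (F0 F (Cod U u'))" "Dom (F0 F (Cod U u')) \<zeta> = Fo u' y" "Cod (F0 F (Cod U u')) \<zeta> = Fo v' z"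
     "a \<in> Obj U" "x \<in> Obj (F0 F a)" "b \<in> Obj U" "y \<in> Obj (F0 F b)" "c \<in> Obj U" "z \<in> Obj (F0 F c)"
    and r: "r \<in> \<Sigma>" "s \<in> \<Sigma>" "Dom U r = Cod U u" "Dom U s = Cod U u'" "Cod U s = Cod U r"
      "\<gamma> \<in> Arr V" "Dom V \<gamma> = r \<cdot>\<^bsub>U\<^esub> v" "Cod V \<gamma> = s \<cdot>\<^bsub>U\<^esub> u'"
    using assms by (simp_all add: Pre_iff composable_iff)
  note typed = pr r
  let ?d = "Cod U r" and ?c = "Cod U u" and ?c' = "Cod U u'"
  let ?iru = "Inv E (Tc r (Fo u x))" and ?irv = "Inv E (Tc r (Fo v y))" and ?iu = "Inv E (Tc u x)"
  have n1: "Tc s (Fo v' z) \<cdot>\<^bsub>E\<^esub> Ta ?d (Fa s \<zeta>) = Ta ?c' \<zeta> \<cdot>\<^bsub>E\<^esub> Tc s (Fo u' y)"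
    using cone_natural[of s ?c' ?d \<zeta> "Fo u' y" "Fo v' z"] typed by simp
  have "Tc r (Fo v y) \<cdot>\<^bsub>E\<^esub> Ta ?d (Fa r \<xi>) = Ta ?c \<xi> \<cdot>\<^bsub>E\<^esub> Tc r (Fo u x)"
    using cone_natural[of r ?c ?d \<xi> "Fo u x" "Fo v y"] typed by simp
  then have n2: "Ta ?d (Fa r \<xi>) = ?irv \<cdot>\<^bsub>E\<^esub> (Ta ?c \<xi> \<cdot>\<^bsub>E\<^esub> Tc r (Fo u x))"
    using typed by (simp flip: \<open>Tc r (Fo v y) \<cdot>\<^bsub>E\<^esub> Ta ?d (Fa r \<xi>) = _\<close>)
  have m: "Tc s (Fo u' y) \<cdot>\<^bsub>E\<^esub> (Ta ?d (Fc \<gamma> y) \<cdot>\<^bsub>E\<^esub> ?irv) = Inv E (Tc u' y) \<cdot>\<^bsub>E\<^esub> Tc v y"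
  proof -
    have "Tc u' y \<cdot>\<^bsub>E\<^esub> (Tc s (Fo u' y) \<cdot>\<^bsub>E\<^esub> Ta ?d (Fc \<gamma> y)) = Tc v y \<cdot>\<^bsub>E\<^esub> Tc r (Fo v y)"
      using cone_cell[of \<gamma> b ?d y] typed by simp
    then have "Inv E (Tc u' y) \<cdot>\<^bsub>E\<^esub> ((Tc u' y \<cdot>\<^bsub>E\<^esub> (Tc s (Fo u' y) \<cdot>\<^bsub>E\<^esub> Ta ?d (Fc \<gamma> y))) \<cdot>\<^bsub>E\<^esub> ?irv)
      = Inv E (Tc u' y) \<cdot>\<^bsub>E\<^esub> ((Tc v y \<cdot>\<^bsub>E\<^esub> Tc r (Fo v y)) \<cdot>\<^bsub>E\<^esub> ?irv)" by (rule arg_cong)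
    then show ?thesis using typed by simp
  qed
  have "cone_value X Z (premor_comp A F (fst Y) r s \<gamma> q p) =
    Tc v' z \<cdot>\<^bsub>E\<^esub> ((Tc s (Fo v' z) \<cdot>\<^bsub>E\<^esub> Ta ?d (Fa s \<zeta>)) \<cdot>\<^bsub>E\<^esub> (Ta ?d (Fc \<gamma> y) \<cdot>\<^bsub>E\<^esub> (Ta ?d (Fa r \<xi>) \<cdot>\<^bsub>E\<^esub> (?iru \<cdot>\<^bsub>E\<^esub> ?iu))))"
    using typed by (simp add: cone_value_eq premor_comp_eq Inv_Comp)
  also have "\<dots> = Tc v' z \<cdot>\<^bsub>E\<^esub> (Ta ?c' \<zeta> \<cdot>\<^bsub>E\<^esub> ((Tc s (Fo u' y) \<cdot>\<^bsub>E\<^esub> (Ta ?d (Fc \<gamma> y) \<cdot>\<^bsub>E\<^esub> ?irv)) \<cdot>\<^bsub>E\<^esub> (Ta ?c \<xi> \<cdot>\<^bsub>E\<^esub> ?iu)))"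
    unfolding n1 n2 using typed by simp
  also have "\<dots> = cone_value Y Z q \<cdot>\<^bsub>E\<^esub> cone_value X Y p"
    unfolding m using typed by (simp add: cone_value_eq)
  finally show ?thesis .
qed

end

locale filtered_sigma_cone = filtered_diagram A \<Sigma> F + sigma_cone A \<Sigma> F E \<theta>
  for A :: "('a, 'f, 'c) two_cat" and \<Sigma> :: "'f set" and F :: "('a, 'f, 'c, 'o, 'm) cat_valued"
    and E :: "('p, 'q) cat" and \<theta> :: "('a, 'f, 'o, 'm, 'p, 'q) cone"
begin

lemma cone_value_cls:
  assumes "cls X Y p = cls X Y q" "p \<in> Pre X Y" "q \<in> Pre X Y" "X \<in> Ob" "Y \<in> Ob"
  shows "cone_value X Y p = cone_value X Y q"
proof -
  obtain r where "r \<in> Pre X Y" "refines X Y p r" "refines X Y q r"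
    using assms(1) unfolding cls_eq_iff[OF assms(4,5,2,3)] homotopical_iff[OF assms(2-5)] by auto
  then show ?thesis using cone_value_refines assms by metis
qed

text \<open>The value on a class is computed from an arbitrarily chosen representative; by \<open>cone_value_cls\<close> all
representatives have the same value.\<close>
definition induced :: "('o \<times> 'a, ('o \<times> 'a) \<times> ('f \<times> 'm \<times> 'f) set \<times> ('o \<times> 'a), 'p, 'q) cfun"
  where "induced = \<lparr>Fsrc = L, Ftgt = E, Omap = (\<lambda>(x, a)\<in>Ob. To a x),
    Amap = (\<lambda>(X, P, Y)\<in>Arr L. cone_value X Y (SOME p. p \<in> P))\<rparr>"

lemma induced_simps [simp]:
  "Fsrc induced = L" "Ftgt induced = E"
  "a \<in> Obj U \<Longrightarrow> x \<in> Obj (F0 F a) \<Longrightarrow> Omap induced (x, a) = To a x"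
  by (simp_all add: induced_def)

lemma induced_mor [simp]:
  assumes "p \<in> Pre X Y" "X \<in> Ob" "Y \<in> Ob"
  shows "Amap induced (mor X Y p) = cone_value X Y p"
proof -
  let ?p = "SOME p'. p' \<in> cls X Y p"
  have "?p \<in> cls X Y p" using cls_self[OF assms(2,3,1)] by (rule someI)
  then have "cone_value X Y ?p = cone_value X Y p"
    using cone_value_cls[OF cls_member[of ?p X Y p]] cls_subset assms by blast
  then show ?thesis using assms by (simp add: induced_def)
qed

lemma induced_functor: "is_functor induced"
proof (rule functorI)
  fix f g assume "f \<in> Arr (Fsrc induced)" "g \<in> Arr (Fsrc induced)" "Cod (Fsrc induced) f = Dom (Fsrc induced) g"
  then have fg: "f \<in> Arr L" "g \<in> Arr L" "Cod L f = Dom L g" by simp_all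
  obtain X Y p where f: "X \<in> Ob" "Y \<in> Ob" "p \<in> Pre X Y" "f = mor X Y p" by (rule L_ArrE[OF fg(1)])
  obtain Y' Z q where g: "Y' \<in> Ob" "Z \<in> Ob" "q \<in> Pre Y' Z" "g = mor Y' Z q" by (rule L_ArrE[OF fg(2)])
  have "Y' = Y" using f(4) g(4) fg(3) by simp
  with f g have *: "p \<in> Pre X Y" "q \<in> Pre Y Z" "X \<in> Ob" "Y \<in> Ob" "Z \<in> Ob" "f = mor X Y p" "g = mor Y Z q"
    by simp_all
  obtain r s \<gamma> where c: "composable r s \<gamma> q p" by (rule composable_exists[OF *(1,2)])
  show "Amap induced (g \<cdot>\<^bsub>Fsrc induced\<^esub> f) = Amap induced g \<cdot>\<^bsub>Ftgt induced\<^esub> Amap induced f"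
    using L_Comp[OF *(1-5) c] premor_comp_in_Pre[OF *(1,2) c *(3-5)] cone_value_comp[OF *(1-5) c] * by simp
next
  fix X assume "X \<in> Obj (Fsrc induced)"
  then show "Amap induced (Ide (Fsrc induced) X) = Ide (Ftgt induced) (Omap induced X)"
    using Pre_Ide by (cases X) (simp add: L_Ide cone_value_eq)
next
  show "Omap induced \<in> extensional (Obj (Fsrc induced))" "Amap induced \<in> extensional (Arr (Fsrc induced))"
    by (simp_all add: induced_def)
next
  fix f assume "f \<in> Arr (Fsrc induced)"
  then have "f \<in> Arr L" by simp
  then obtain X Y p where *: "X \<in> Ob" "Y \<in> Ob" "p \<in> Pre X Y" "f = mor X Y p"
    by (rule L_ArrE)
  moreover have "Omap induced X = To (snd X) (fst X)" "Omap induced Y = To (snd Y) (fst Y)"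
    using * by (cases X, cases Y, simp)+
  ultimately show "Amap induced f \<in> Arr (Ftgt induced)"
    "Dom (Ftgt induced) (Amap induced f) = Omap induced (Dom (Fsrc induced) f)"
    "Cod (Ftgt induced) (Amap induced f) = Omap induced (Cod (Fsrc induced) f)"
    by (simp_all add: cone_value_typed)
next
  fix X assume "X \<in> Obj (Fsrc induced)"
  then show "Omap induced X \<in> Obj (Ftgt induced)" by (cases X) simp
qed simp_all

lemma induced_factorization: "postcompose_cone A induced lam = \<theta>"
proof (rule sigma_cone_eqI)
  show "is_sigma_cone A \<Sigma> F E (postcompose_cone A induced lam)"
    using lam.postcompose_cone[OF induced_functor] by simp
qed (use induced_functor cone in \<open>simp_all add: Pre_iff cone_value_eq\<close>)

end

section \<open>The universal property\<close>

context filtered_diagram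
begin

abbreviation "pull \<equiv> \<lambda>E. cone_pullback A \<Sigma> F L lam E"

lemma pull_simps [simp]:
  "Fsrc (pull E) = functor_cat L E" "Ftgt (pull E) = sigma_cones A \<Sigma> F E"
  "H \<in> functors L E \<Longrightarrow> Omap (pull E) H = postcompose_cone A H lam"
  "\<eta> \<in> Arr (functor_cat L E) \<Longrightarrow> Amap (pull E) \<eta> = (postcompose_cone A (Nsrc \<eta>) lam,
       (\<lambda>a\<in>Obj U. nat_hcomp \<eta> (nat_id (Leg lam a))), postcompose_cone A (Ntgt \<eta>) lam)"
  by (simp_all add: cone_pullback_def)

lemma whiskered_component:
  assumes "is_nat_trans \<eta>" "Fsrc (Nsrc \<eta>) = L" "Ftgt (Nsrc \<eta>) = E" "a \<in> Obj U" "x \<in> Obj (F0 F a)"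
  shows "Ncmp (nat_hcomp \<eta> (nat_id (Leg lam a))) x = Ncmp \<eta> (x, a)"
  using functorD(2)[of "Nsrc \<eta>"] assms by simp

text \<open>Compatibility with the cells is the naturality of \<open>\<eta>\<close> at the components of the cells of \<open>\<lambda>\<close>.\<close>
lemma whiskered_cone_morphism:
  assumes \<eta>: "is_nat_trans \<eta>" "Fsrc (Nsrc \<eta>) = L" "Ftgt (Nsrc \<eta>) = E"
  shows "is_cone_morphism A F E (postcompose_cone A (Nsrc \<eta>) lam) (postcompose_cone A (Ntgt \<eta>) lam)
    (\<lambda>a\<in>Obj U. nat_hcomp \<eta> (nat_id (Leg lam a)))"
proof -
  have E: "category E" using functorD(2)[of "Nsrc \<eta>"] \<eta> by simp
  have c: "is_sigma_cone A \<Sigma> F E (postcompose_cone A (Nsrc \<eta>) lam)"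
    "is_sigma_cone A \<Sigma> F E (postcompose_cone A (Ntgt \<eta>) lam)"
    using lam.postcompose_cone[of "Nsrc \<eta>" E] lam.postcompose_cone[of "Ntgt \<eta>" E] \<eta> by simp_all
  show ?thesis unfolding cone_morphism_iff[OF c]
  proof (intro conjI ballI)
    fix f x assume f: "f \<in> Arr U" and x: "x \<in> Obj (F0 F (Dom U f))"
    have t: "Ncmp (Cell lam f) x \<in> Arr L" using f x by (simp add: Pre_iff)
    show "Ncmp (Cell (postcompose_cone A (Ntgt \<eta>) lam) f) x \<cdot>\<^bsub>E\<^esub>
         Ncmp ((\<lambda>a\<in>Obj U. nat_hcomp \<eta> (nat_id (Leg lam a))) (Cod U f)) (Fo f x) =
         Ncmp ((\<lambda>a\<in>Obj U. nat_hcomp \<eta> (nat_id (Leg lam a))) (Dom U f)) x \<cdot>\<^bsub>E\<^esub>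
         Ncmp (Cell (postcompose_cone A (Nsrc \<eta>) lam) f) x"
      using f x \<eta> nat_trans_natural[OF \<eta>(1) _ \<eta>(3) refl refl, of "Ncmp (Cell lam f) x"] t E by simp
  qed (use \<eta> in auto)
qed

text \<open>Both functors preserve composites and inverses, so by the decomposition of the arrows of \<open>\<L>\<^sub>\<sigma>(F)\<close>
it suffices that they agree on the legs and the cells of \<open>\<lambda>\<close>.\<close>
lemma functor_from_L_eqI:
  assumes H: "is_functor H" "Fsrc H = L" "Ftgt H = E" and K: "is_functor K" "Fsrc K = L" "Ftgt K = E"
    and eq: "postcompose_cone A H lam = postcompose_cone A K lam"
  shows "H = K"
proof (rule functor_eqI)
  have o: "Omap H (x, a) = Omap K (x, a)" if "a \<in> Obj U" "x \<in> Obj (F0 F a)" for x a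
    using arg_cong[OF eq, of "\<lambda>\<theta>. Omap (Leg \<theta> a) x"] that H K by simp
  have leg: "Amap H (Amap (Leg lam a) \<xi>) = Amap K (Amap (Leg lam a) \<xi>)" if "a \<in> Obj U" "\<xi> \<in> Arr (F0 F a)" for \<xi> a
    using arg_cong[OF eq, of "\<lambda>\<theta>. Amap (Leg \<theta> a) \<xi>"] that H K by (simp del: lam_simps(4))
  have cell: "Amap H (Ncmp (Cell lam f) x) = Amap K (Ncmp (Cell lam f) x)"
    if "f \<in> Arr U" "x \<in> Obj (F0 F (Dom U f))" for f x
    using arg_cong[OF eq, of "\<lambda>\<theta>. Ncmp (Cell \<theta> f) x"] that H K by (simp del: lam_simps(7))
  show "Omap H X = Omap K X" if "X \<in> Obj (Fsrc K)" for X
    using that K o by (cases X) simp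
  fix f assume "f \<in> Arr (Fsrc K)"
  then have "f \<in> Arr L" using K by simp
  then obtain X Y p where f: "X \<in> Ob" "Y \<in> Ob" "p \<in> Pre X Y" "f = mor X Y p" by (rule L_ArrE)
  obtain x a y b u \<xi> v where [simp]: "X = (x, a)" "Y = (y, b)" "p = (u, \<xi>, v)"
    by (metis prod.exhaust)
  have pr: "u \<in> \<Sigma>" "Dom U u = a" "v \<in> Arr U" "Dom U v = b" "Cod U v = Cod U u"
     "\<xi> \<in> Arr (F0 F (Cod U u))" "Dom (F0 F (Cod U u)) \<xi> = Fo u x" "Cod (F0 F (Cod U u)) \<xi> = Fo v y"
     "a \<in> Obj U" "x \<in> Obj (F0 F a)" "b \<in> Obj U" "y \<in> Obj (F0 F b)"
    using f by (simp_all add: Pre_iff)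
  have "f = Ncmp (Cell lam v) y \<cdot>\<^bsub>L\<^esub> (Amap (Leg lam (Cod U u)) \<xi> \<cdot>\<^bsub>L\<^esub> Inv L (Ncmp (Cell lam u) x))"
    using mor_decomposition[of u \<xi> v x a y b] f by simp
  then show "Amap H f = Amap K f"
    using pr H K leg[of "Cod U u" \<xi>] cell[of v y] cell[of u x] by (simp del: lam_simps(4,7))
qed (use H K in auto)

lemma pull_functor:
  assumes E: "category E"
  shows "is_functor (pull E)"
proof (rule functorI)
  fix \<eta> assume "\<eta> \<in> Arr (Fsrc (pull E))"
  then have \<eta>: "is_nat_trans \<eta>" "Fsrc (Nsrc \<eta>) = L" "Ftgt (Nsrc \<eta>) = E" by simp_all
  show "Amap (pull E) \<eta> \<in> Arr (Ftgt (pull E))"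
    "Dom (Ftgt (pull E)) (Amap (pull E) \<eta>) = Omap (pull E) (Dom (Fsrc (pull E)) \<eta>)"
    "Cod (Ftgt (pull E)) (Amap (pull E) \<eta>) = Omap (pull E) (Cod (Fsrc (pull E)) \<eta>)"
    using \<eta> whiskered_cone_morphism[OF \<eta>] lam.postcompose_cone[of "Nsrc \<eta>" E]
      lam.postcompose_cone[of "Ntgt \<eta>" E] by (simp_all add: functors_iff)
next
  fix H assume "H \<in> Obj (Fsrc (pull E))"
  then have H: "is_functor H" "Fsrc H = L" "Ftgt H = E" by (simp_all add: functors_iff)
  show "Omap (pull E) H \<in> Obj (Ftgt (pull E))"
    using lam.postcompose_cone[OF H] H by (simp add: functors_iff)
  have "nat_hcomp (nat_id H) (nat_id (Leg lam a)) = nat_id (functor_comp H (Leg lam a))" if "a \<in> Obj U" for a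
    by (rule nat_trans_eqI) (use that H in auto)
  then show "Amap (pull E) (Ide (Fsrc (pull E)) H) = Ide (Ftgt (pull E)) (Omap (pull E) H)"
    using H by (auto simp: functors_iff intro: restrict_ext)
next
  fix \<eta> \<epsilon> assume "\<eta> \<in> Arr (Fsrc (pull E))" "\<epsilon> \<in> Arr (Fsrc (pull E))" "Cod (Fsrc (pull E)) \<eta> = Dom (Fsrc (pull E)) \<epsilon>"
  then have \<eta>: "is_nat_trans \<eta>" "Fsrc (Nsrc \<eta>) = L" "Ftgt (Nsrc \<eta>) = E"
    and \<epsilon>: "is_nat_trans \<epsilon>" "Ntgt \<eta> = Nsrc \<epsilon>" by simp_all
  have \<epsilon>': "Fsrc (Nsrc \<epsilon>) = L" "Ftgt (Nsrc \<epsilon>) = E" using nat_transD(3,4)[OF \<eta>(1)] \<eta> \<epsilon> by simp_all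
  have "nat_hcomp (nat_vcomp \<epsilon> \<eta>) (nat_id (Leg lam a)) =
      nat_vcomp (nat_hcomp \<epsilon> (nat_id (Leg lam a))) (nat_hcomp \<eta> (nat_id (Leg lam a)))" if "a \<in> Obj U" for a
    by (rule nat_trans_eqI) (use that \<eta> \<epsilon> \<epsilon>' in auto)
  then show "Amap (pull E) (\<epsilon> \<cdot>\<^bsub>Fsrc (pull E)\<^esub> \<eta>) = Amap (pull E) \<epsilon> \<cdot>\<^bsub>Ftgt (pull E)\<^esub> Amap (pull E) \<eta>"
    using \<eta> \<epsilon> \<epsilon>' by (auto intro: restrict_ext)
next
  show "Omap (pull E) \<in> extensional (Obj (Fsrc (pull E)))" "Amap (pull E) \<in> extensional (Arr (Fsrc (pull E)))"
    by (simp_all add: cone_pullback_def)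
qed (simp_all add: E functor_cat_category sigma_cones_category)

lemma pull_surj_obj:
  assumes "is_sigma_cone A \<Sigma> F E \<theta>"
  obtains H where "is_functor H" "Fsrc H = L" "Ftgt H = E" "postcompose_cone A H lam = \<theta>"
proof -
  interpret filtered_sigma_cone A \<Sigma> F E \<theta> by unfold_locales (rule assms)
  show thesis by (rule that[of induced]) (simp_all add: induced_functor induced_factorization)
qed

text \<open>A cone morphism is natural with respect to \<open>\<lambda>\<^sub>C(\<xi>)\<close>, because its members are natural transformations,
and with respect to the components of the cells of \<open>\<lambda>\<close>, because it is a cone morphism. Naturality
passes to inverses and composites, hence holds for all arrows of \<open>\<L>\<^sub>\<sigma>(F)\<close>.\<close>
lemma cone_morphism_lift:
  assumes H: "is_functor H" "Fsrc H = L" "Ftgt H = E" and K: "is_functor K" "Fsrc K = L" "Ftgt K = E"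
    and \<phi>: "is_cone_morphism A F E (postcompose_cone A H lam) (postcompose_cone A K lam) \<phi>"
  obtains \<eta> where "is_nat_trans \<eta>" "Nsrc \<eta> = H" "Ntgt \<eta> = K"
    "(\<lambda>a\<in>Obj U. nat_hcomp \<eta> (nat_id (Leg lam a))) = \<phi>"
proof -
  have E: "category E" using functorD(2)[OF H(1)] H by simp
  have c: "is_sigma_cone A \<Sigma> F E (postcompose_cone A H lam)" "is_sigma_cone A \<Sigma> F E (postcompose_cone A K lam)"
    using lam.postcompose_cone[OF H] lam.postcompose_cone[OF K] by simp_all
  have p: "is_nat_trans (\<phi> a)" "Nsrc (\<phi> a) = functor_comp H (Leg lam a)" "Ntgt (\<phi> a) = functor_comp K (Leg lam a)"
    if "a \<in> Obj U" for a
    using cone_morphismD(2-4)[OF \<phi>, of a] that H K by simp_all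
  have ext: "\<phi> \<in> extensional (Obj U)" by (rule cone_morphismD(1)[OF \<phi>])
  \<comment> \<open>The objects of \<open>L\<close> are exactly the \<open>(x, a)\<close>, so \<open>\<phi>\<close> already prescribes every component.\<close>
  define \<eta> where "\<eta> = \<lparr>Nsrc = H, Ntgt = K, Ncmp = (\<lambda>(x, a)\<in>Ob. Ncmp (\<phi> a) x)\<rparr>"
  have \<eta> [simp]: "Nsrc \<eta> = H" "Ntgt \<eta> = K" "a \<in> Obj U \<Longrightarrow> x \<in> Obj (F0 F a) \<Longrightarrow> Ncmp \<eta> (x, a) = Ncmp (\<phi> a) x" for x a
    by (simp_all add: \<eta>_def)
  have cell: "Ncmp (\<phi> (Dom U f)) x \<cdot>\<^bsub>E\<^esub> Amap H (Ncmp (Cell lam f) x)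
      = Amap K (Ncmp (Cell lam f) x) \<cdot>\<^bsub>E\<^esub> Ncmp (\<phi> (Cod U f)) (Fo f x)"
    if "f \<in> Arr U" "x \<in> Obj (F0 F (Dom U f))" for f x
    using \<phi> that H K unfolding cone_morphism_iff[OF c] by (simp del: lam_simps(7))
  have leg: "Ncmp (\<phi> a) y \<cdot>\<^bsub>E\<^esub> Amap H (Amap (Leg lam a) \<xi>) = Amap K (Amap (Leg lam a) \<xi>) \<cdot>\<^bsub>E\<^esub> Ncmp (\<phi> a) x"
    if "a \<in> Obj U" "\<xi> \<in> Arr (F0 F a)" "Dom (F0 F a) \<xi> = x" "Cod (F0 F a) \<xi> = y" for a \<xi> x y
    using nat_trans_natural[OF p(1)[OF that(1)], of \<xi> E x y] that p H K by (simp del: lam_simps(4))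
  have nat: "is_nat_trans \<eta>"
  proof (rule nat_transI)
    fix f assume "f \<in> Arr (Fsrc (Nsrc \<eta>))"
    then have "f \<in> Arr L" using H by simp
    then obtain X Y q where f: "X \<in> Ob" "Y \<in> Ob" "q \<in> Pre X Y" "f = mor X Y q" by (rule L_ArrE)
    obtain x a y b u \<xi> v where eq [simp]: "X = (x, a)" "Y = (y, b)" "q = (u, \<xi>, v)"
      by (metis prod.exhaust)
    have pr: "u \<in> \<Sigma>" "Dom U u = a" "v \<in> Arr U" "Dom U v = b" "Cod U v = Cod U u"
       "\<xi> \<in> Arr (F0 F (Cod U u))" "Dom (F0 F (Cod U u)) \<xi> = Fo u x" "Cod (F0 F (Cod U u)) \<xi> = Fo v y"
       "a \<in> Obj U" "x \<in> Obj (F0 F a)" "b \<in> Obj U" "y \<in> Obj (F0 F b)"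
      using f by (simp_all add: Pre_iff)
    let ?c = "Cod U u" and ?u = "Ncmp (Cell lam u) x" and ?v = "Ncmp (Cell lam v) y"
    have d: "f = ?v \<cdot>\<^bsub>L\<^esub> (Amap (Leg lam ?c) \<xi> \<cdot>\<^bsub>L\<^esub> Inv L ?u)"
      using mor_decomposition[of u \<xi> v x a y b] f by simp
    \<comment> \<open>Naturality at \<open>f\<close> is pasted from its naturality squares at the three factors.\<close>
    have 1: "Ncmp (\<phi> ?c) (Fo u x) \<cdot>\<^bsub>E\<^esub> Inv E (Amap H ?u) = Inv E (Amap K ?u) \<cdot>\<^bsub>E\<^esub> Ncmp (\<phi> a) x"
      by (rule square_Inv) (use cell[of u x] pr H K p E in \<open>simp_all del: lam_simps(7)\<close>)
    have 2: "Ncmp (\<phi> ?c) (Fo v y) \<cdot>\<^bsub>E\<^esub> (Amap H (Amap (Leg lam ?c) \<xi>) \<cdot>\<^bsub>E\<^esub> Inv E (Amap H ?u))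
      = (Amap K (Amap (Leg lam ?c) \<xi>) \<cdot>\<^bsub>E\<^esub> Inv E (Amap K ?u)) \<cdot>\<^bsub>E\<^esub> Ncmp (\<phi> a) x"
      by (rule square_comp[OF _ _ _ _ _ _ _ _ _ _ _ _ _ _ _ _ 1 leg])
        (use pr H K p E in \<open>simp_all del: lam_simps(4,7)\<close>)
    have 3: "Ncmp (\<phi> b) y \<cdot>\<^bsub>E\<^esub> (Amap H ?v \<cdot>\<^bsub>E\<^esub> (Amap H (Amap (Leg lam ?c) \<xi>) \<cdot>\<^bsub>E\<^esub> Inv E (Amap H ?u)))
      = (Amap K ?v \<cdot>\<^bsub>E\<^esub> (Amap K (Amap (Leg lam ?c) \<xi>) \<cdot>\<^bsub>E\<^esub> Inv E (Amap K ?u))) \<cdot>\<^bsub>E\<^esub> Ncmp (\<phi> a) x"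
      by (rule square_comp[OF _ _ _ _ _ _ _ _ _ _ _ _ _ _ _ _ 2])
        (use pr H K p E cell[of v y] in \<open>simp_all del: lam_simps(4,7)\<close>)
    have "Ncmp (\<phi> b) y \<cdot>\<^bsub>E\<^esub> Amap H f = Amap K f \<cdot>\<^bsub>E\<^esub> Ncmp (\<phi> a) x"
      unfolding d using 3 pr H K p E by (simp del: lam_simps(4,7) cat_assoc)
    then show "Ncmp \<eta> (Cod (Fsrc (Nsrc \<eta>)) f) \<cdot>\<^bsub>Ftgt (Nsrc \<eta>)\<^esub> Amap (Nsrc \<eta>) f
      = Amap (Ntgt \<eta>) f \<cdot>\<^bsub>Ftgt (Nsrc \<eta>)\<^esub> Ncmp \<eta> (Dom (Fsrc (Nsrc \<eta>)) f)"
      using pr f H K by simp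
  next
    show "Ncmp \<eta> \<in> extensional (Obj (Fsrc (Nsrc \<eta>)))" using H by (simp add: \<eta>_def)
  qed (use H K p E in auto)
  have "nat_hcomp \<eta> (nat_id (Leg lam a)) = \<phi> a" if "a \<in> Obj U" for a
    by (rule nat_trans_eqI) (use that nat p H K E in simp_all)
  then have "(\<lambda>a\<in>Obj U. nat_hcomp \<eta> (nat_id (Leg lam a))) = \<phi>"
    using ext by (auto intro!: extensionalityI[of _ "Obj U"])
  then show thesis using that[of \<eta>] nat by simp
qed

lemma pull_iso:
  assumes E: "category E"
  shows "is_cat_isomorphism (pull E)"
proof (rule cat_isomorphismI[OF pull_functor[OF E]])
  show "bij_betw (Omap (pull E)) (Obj (Fsrc (pull E))) (Obj (Ftgt (pull E)))"
    unfolding bij_betw_def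
  proof
    show "inj_on (Omap (pull E)) (Obj (Fsrc (pull E)))"
      by (rule inj_onI) (auto simp: functors_iff intro: functor_from_L_eqI)
    show "Omap (pull E) ` Obj (Fsrc (pull E)) = Obj (Ftgt (pull E))"
    proof
      show "Omap (pull E) ` Obj (Fsrc (pull E)) \<subseteq> Obj (Ftgt (pull E))"
        by (auto simp: functors_iff intro!: lam.postcompose_cone)
      show "Obj (Ftgt (pull E)) \<subseteq> Omap (pull E) ` Obj (Fsrc (pull E))"
      proof
        fix \<theta> assume "\<theta> \<in> Obj (Ftgt (pull E))"
        then have "is_sigma_cone A \<Sigma> F E \<theta>" by simp
        then obtain H where "is_functor H" "Fsrc H = L" "Ftgt H = E" "postcompose_cone A H lam = \<theta>"
          by (rule pull_surj_obj)
        then show "\<theta> \<in> Omap (pull E) ` Obj (Fsrc (pull E))"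
          by (intro image_eqI[of _ _ H]) (auto simp: functors_iff)
      qed
    qed
  qed
  show "bij_betw (Amap (pull E)) (Arr (Fsrc (pull E))) (Arr (Ftgt (pull E)))"
    unfolding bij_betw_def
  proof
    show "inj_on (Amap (pull E)) (Arr (Fsrc (pull E)))"
    proof (rule inj_onI)
      fix \<eta> \<epsilon> assume "\<eta> \<in> Arr (Fsrc (pull E))" "\<epsilon> \<in> Arr (Fsrc (pull E))"
        and eq: "Amap (pull E) \<eta> = Amap (pull E) \<epsilon>"
      then have \<eta>: "is_nat_trans \<eta>" "Fsrc (Nsrc \<eta>) = L" "Ftgt (Nsrc \<eta>) = E"
        and \<epsilon>: "is_nat_trans \<epsilon>" "Fsrc (Nsrc \<epsilon>) = L" "Ftgt (Nsrc \<epsilon>) = E" by simp_all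
      have e: "postcompose_cone A (Nsrc \<eta>) lam = postcompose_cone A (Nsrc \<epsilon>) lam"
        "postcompose_cone A (Ntgt \<eta>) lam = postcompose_cone A (Ntgt \<epsilon>) lam"
        "(\<lambda>a\<in>Obj U. nat_hcomp \<eta> (nat_id (Leg lam a))) = (\<lambda>a\<in>Obj U. nat_hcomp \<epsilon> (nat_id (Leg lam a)))"
        using eq \<eta> \<epsilon> by simp_all
      show "\<eta> = \<epsilon>"
      proof (rule nat_trans_eqI[OF \<eta>(1) \<epsilon>(1)])
        show "Nsrc \<eta> = Nsrc \<epsilon>" "Ntgt \<eta> = Ntgt \<epsilon>"
          by (rule functor_from_L_eqI; use e \<eta> \<epsilon> in simp)+
        fix X assume "X \<in> Obj (Fsrc (Nsrc \<epsilon>))"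
        then obtain x a where X: "X = (x, a)" "a \<in> Obj U" "x \<in> Obj (F0 F a)" using \<epsilon> by (cases X) auto
        have "nat_hcomp \<eta> (nat_id (Leg lam a)) = nat_hcomp \<epsilon> (nat_id (Leg lam a))"
          using fun_cong[OF e(3), of a] X by simp
        then show "Ncmp \<eta> X = Ncmp \<epsilon> X"
          using whiskered_component[OF \<eta>, of a x] whiskered_component[OF \<epsilon>, of a x] X by simp
      qed
    qed
    show "Amap (pull E) ` Arr (Fsrc (pull E)) = Arr (Ftgt (pull E))"
    proof
      show "Amap (pull E) ` Arr (Fsrc (pull E)) \<subseteq> Arr (Ftgt (pull E))"
        using functorD(4)[OF pull_functor[OF E]] by blast
      show "Arr (Ftgt (pull E)) \<subseteq> Amap (pull E) ` Arr (Fsrc (pull E))"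
      proof
        fix m assume m: "m \<in> Arr (Ftgt (pull E))"
        obtain \<theta> \<phi> \<theta>' where [simp]: "m = (\<theta>, \<phi>, \<theta>')" by (cases m)
        have c: "is_sigma_cone A \<Sigma> F E \<theta>" "is_sigma_cone A \<Sigma> F E \<theta>'" "is_cone_morphism A F E \<theta> \<theta>' \<phi>"
          using m by simp_all
        obtain H where H: "is_functor H" "Fsrc H = L" "Ftgt H = E" "postcompose_cone A H lam = \<theta>"
          by (rule pull_surj_obj[OF c(1)])
        obtain K where K: "is_functor K" "Fsrc K = L" "Ftgt K = E" "postcompose_cone A K lam = \<theta>'"
          by (rule pull_surj_obj[OF c(2)])
        obtain \<eta> where "is_nat_trans \<eta>" "Nsrc \<eta> = H" "Ntgt \<eta> = K"
          "(\<lambda>a\<in>Obj U. nat_hcomp \<eta> (nat_id (Leg lam a))) = \<phi>"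
          by (rule cone_morphism_lift[OF H(1-3) K(1-3) c(3)[folded H(4) K(4)]])
        then show "m \<in> Amap (pull E) ` Arr (Fsrc (pull E))"
          using H K by (intro image_eqI[of _ _ \<eta>]) simp_all
      qed
    qed
  qed
qed

lemma lam_colimit: "is_sigma_colimit TYPE('r \<times> 's) A \<Sigma> F L lam"
  unfolding is_sigma_colimit_def using lam_cone pull_iso by blast

end

theorem theorem2p23:
  fixes A :: "('a, 'f, 'c) two_cat"
    and \<Sigma> :: "'f set"
    and F :: "('a, 'f, 'c, 'o, 'm) cat_valued"
  assumes "sigma_filtered A \<Sigma>"
    and "two_functor A CAT F"
  shows "category (L_sigma A \<Sigma> F) \<and>
    is_sigma_cone A \<Sigma> F (L_sigma A \<Sigma> F) (lambda_cone A \<Sigma> F) \<and>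
    is_sigma_colimit TYPE('r \<times> 's) A \<Sigma> F (L_sigma A \<Sigma> F) (lambda_cone A \<Sigma> F)"
proof -
  interpret filtered_diagram A \<Sigma> F
    using assms sigma_filtered.axioms(1)[OF assms(1)]
    by (intro filtered_diagram.intro sigma_diagram.intro)
  show ?thesis using L_category lam_cone lam_colimit by blast
qed

end
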